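(* Let $(M,\omega)$ be a compact finite-dimensional symplectic manifold, $(\Sigma,\sigma)$ a closed connected symplectic $2$-manifold, and $f\in\mathcal{S}_{\mathrm{e}}(\Sigma,\sigma)$. For every $u\in T_f\mathcal{S}_{\mathrm{e}}(\Sigma,\sigma)$ such that the $1$-form $\omega(u,df(\cdot))$ on $\Sigma$ is exact, $$\iota_u(\omega_{\mathcal{S}_{\mathrm{e}}(\Sigma,\sigma)})_f=2\int_\Sigma\omega(u,\cdot)\,\sigma=2\,\iota_u(\omega^D_{\mathcal{S}_{\mathrm{e}}(\Sigma,\sigma)})_f$$ as linear functionals on $T_f\mathcal{S}_{\mathrm{e}}(\Sigma,\sigma)$; i.e., the two forms coincide in exact directions, up to multiplication by a constant.
   Context: $\mathcal{S}_{\mathrm{e}}(\Sigma,\sigma)$ is the manifold (in the convenient setup of Fr\"olicher, Kriegl and Michor) of embeddings $f\colon\Sigma\to M$ with $f^*\omega=\sigma$; its tangent space at $f$ is a subspace of $T_fC^\infty(\Sigma,M)=\Gamma(f^*TM)$. $\omega^D_{\mathcal{S}_{\mathrm{e}}(\Sigma,\sigma)}$ is the pullback to $\mathcal{S}_{\mathrm{e}}(\Sigma,\sigma)$ of the $2$-form on $C^\infty(\Sigma,M)$ given by $(\omega^D_{(\Sigma,\sigma)})_f(\tau_1,\tau_2)=\int_\Sigma\omega_{f(x)}(\tau_1(x),\tau_2(x))\,\sigma$. $\omega_{\mathcal{S}_{\mathrm{e}}(\Sigma,\sigma)}$ is the pullback to $\mathcal{S}_{\mathrm{e}}(\Sigma,\sigma)$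 of the $2$-form on $C^\infty(\Sigma,M)$ given by $(\omega_{C^\infty(\Sigma,M)})_f(\tau_1,\tau_2)=\int_{\{f\}\times\Sigma}\iota_{(\ell_1\wedge\ell_2)}\mathrm{ev}^*(\omega\wedge\omega)$, where $\mathrm{ev}(f,x)=f(x)$ and $\ell_k$ is any lift of $\tau_k$ to a vector field along $\{f\}\times\Sigma$ in $C^\infty(\Sigma,M)\times\Sigma$ (e.g. $\ell_k=(\tau_k,0)$); this is independent of the lifts. *)

theory Defs
  imports "HOL-Analysis.Analysis" "HOL-Combinatorics.Combinatorics"
begin

section \<open>Smooth manifolds\<close>

primrec Ck_on :: "nat \<Rightarrow> 'a::real_normed_vector set \<Rightarrow> ('a \<Rightarrow> 'b::real_normed_vector) \<Rightarrow> bool" where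
  "Ck_on 0 S f \<longleftrightarrow> continuous_on S f"
| "Ck_on (Suc k) S f \<longleftrightarrow>
     (\<forall>x\<in>S. f differentiable (at x)) \<and> (\<forall>v. Ck_on k S (\<lambda>x. frechet_derivative f (at x) v))"

text \<open>Only used for open \<open>S\<close>.\<close>

definition smooth_on :: "'a::real_normed_vector set \<Rightarrow> ('a \<Rightarrow> 'b::real_normed_vector) \<Rightarrow> bool" where
  "smooth_on S f \<longleftrightarrow> (\<forall>k. Ck_on k S f)"

lemma smooth_on_imp_differentiable: "smooth_on S f \<Longrightarrow> x \<in> S \<Longrightarrow> f differentiable (at x)"
  unfolding smooth_on_def by (metis Ck_on.simps(2))

text \<open>A chart is a pair \<open>(U, \<phi>)\<close> of a domain and a coordinate map; the values of \<open>\<phi>\<close> outside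
  \<open>U\<close> are irrelevant. The manifold is the whole type \<open>'m\<close>, its dimension is \<open>DIM('e)\<close>, and it has
  no boundary.\<close>

type_synonym ('m, 'e) chart = "'m set \<times> ('m \<Rightarrow> 'e)"
type_synonym ('m, 'e) atlas = "('m, 'e) chart set"

definition inv_chart :: "('m, 'e) chart \<Rightarrow> 'e \<Rightarrow> 'm" where
  "inv_chart c = inv_into (fst c) (snd c)"

definition transition :: "('m, 'e) chart \<Rightarrow> ('m, 'e) chart \<Rightarrow> 'e \<Rightarrow> 'e" where
  "transition c d = snd d \<circ> inv_chart c"

definition smooth_atlas :: "('m::topological_space, 'e::euclidean_space) atlas \<Rightarrow> bool" where
  "smooth_atlas A \<longleftrightarrow>
     (\<Union>c\<in>A. fst c) = UNIV \<and>
     (\<forall>c\<in>A. open (fst c) \<and> open (snd c ` fst c) \<and>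
        homeomorphism (fst c) (snd c ` fst c) (snd c) (inv_chart c)) \<and>
     (\<forall>c\<in>A. \<forall>d\<in>A. smooth_on (snd c ` (fst c \<inter> fst d)) (transition c d))"

definition smooth_map ::
    "('s::topological_space, 'd::euclidean_space) atlas \<Rightarrow>
     ('m::topological_space, 'e::euclidean_space) atlas \<Rightarrow> ('s \<Rightarrow> 'm) \<Rightarrow> bool" where
  "smooth_map A B f \<longleftrightarrow> continuous_on UNIV f \<and>
     (\<forall>c\<in>A. \<forall>d\<in>B. smooth_on (snd c ` (fst c \<inter> f -` fst d)) (snd d \<circ> f \<circ> inv_chart c))"

definition smooth_fun :: "('s::topological_space, 'd::euclidean_space) atlas \<Rightarrow> ('s \<Rightarrow> real) \<Rightarrow> bool" where
  "smooth_fun A h \<longleftrightarrow> (\<forall>c\<in>A. smooth_on (snd c ` fst c) (h \<circ> inv_chart c))"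


section \<open>Tangent vectors\<close>

text \<open>A tangent vector at \<open>p\<close> is the family of its coordinate vectors in the charts around \<open>p\<close>,
  related by the derivatives of the transition maps. To make equality of tangent vectors
  extensional, the family is \<open>0\<close> off the charts of the atlas around \<open>p\<close>. The linear structure is
  pointwise.\<close>

type_synonym ('m, 'e) tangent = "('m, 'e) chart \<Rightarrow> 'e"

definition tangent_space ::
    "('m::topological_space, 'e::euclidean_space) atlas \<Rightarrow> 'm \<Rightarrow> ('m, 'e) tangent set" where
  "tangent_space A p =
     {X. (\<forall>c. c \<notin> A \<or> p \<notin> fst c \<longrightarrow> X c = 0) \<and>
         (\<forall>c\<in>A. \<forall>d\<in>A. p \<in> fst c \<inter> fst d \<longrightarrow>
            X d = frechet_derivative (transition c d) (at (snd c p)) (X c))}"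

text \<open>The tangent vector at \<open>p\<close> with coordinates \<open>v\<close> in the chart \<open>c\<close>.\<close>

definition chart_vector ::
    "('m::topological_space, 'e::euclidean_space) atlas \<Rightarrow> ('m, 'e) chart \<Rightarrow> 'm \<Rightarrow> 'e \<Rightarrow> ('m, 'e) tangent" where
  "chart_vector A c p v =
     (\<lambda>d. if d \<in> A \<and> p \<in> fst d then frechet_derivative (transition c d) (at (snd c p)) v else 0)"

definition chart_at :: "('m, 'e) atlas \<Rightarrow> 'm \<Rightarrow> ('m, 'e) chart" where
  "chart_at A p = (SOME c. c \<in> A \<and> p \<in> fst c)"

text \<open>The differentials \<open>df\<^sub>x\<close> and \<open>dh\<^sub>x\<close> do not depend on the chart chosen around \<open>x\<close>.\<close>

definition tangent_map ::
    "('s::topological_space, 'd::euclidean_space) atlas \<Rightarrow>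
     ('m::topological_space, 'e::euclidean_space) atlas \<Rightarrow>
     ('s \<Rightarrow> 'm) \<Rightarrow> 's \<Rightarrow> ('s, 'd) tangent \<Rightarrow> ('m, 'e) tangent" where
  "tangent_map A B f x \<xi> =
     (let c = chart_at A x in
      (\<lambda>d. if d \<in> B \<and> f x \<in> fst d
           then frechet_derivative (snd d \<circ> f \<circ> inv_chart c) (at (snd c x)) (\<xi> c) else 0))"

definition fun_differential ::
    "('s::topological_space, 'd::euclidean_space) atlas \<Rightarrow> ('s \<Rightarrow> real) \<Rightarrow> 's \<Rightarrow> ('s, 'd) tangent \<Rightarrow> real" where
  "fun_differential A h x \<xi> =
     (let c = chart_at A x in frechet_derivative (h \<circ> inv_chart c) (at (snd c x)) (\<xi> c))"

definition velocity ::
    "('m::topological_space, 'e::euclidean_space) atlas \<Rightarrow> (real \<Rightarrow> 'm) \<Rightarrow> ('m, 'e) tangent" where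
  "velocity B \<gamma> =
     (\<lambda>d. if d \<in> B \<and> \<gamma> 0 \<in> fst d then vector_derivative (snd d \<circ> \<gamma>) (at 0) else 0)"


section \<open>Differential forms\<close>

text \<open>Forms are functions on all families \<open>('m, 'e) tangent\<close>, but only their values on
  \<open>tangent_space A p\<close> matter.\<close>

type_synonym ('m, 'e) form1 = "'m \<Rightarrow> ('m, 'e) tangent \<Rightarrow> real"
type_synonym ('m, 'e) form2 = "'m \<Rightarrow> ('m, 'e) tangent \<Rightarrow> ('m, 'e) tangent \<Rightarrow> real"

definition form2_coord ::
    "('m::topological_space, 'e::euclidean_space) atlas \<Rightarrow> ('m, 'e) form2 \<Rightarrow> ('m, 'e) chart \<Rightarrow>
     'e \<Rightarrow> 'e \<Rightarrow> 'e \<Rightarrow> real" where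
  "form2_coord A \<alpha> c v w y =
     (let p = inv_chart c y in \<alpha> p (chart_vector A c p v) (chart_vector A c p w))"

definition smooth_form2 ::
    "('m::topological_space, 'e::euclidean_space) atlas \<Rightarrow> ('m, 'e) form2 \<Rightarrow> bool" where
  "smooth_form2 A \<alpha> \<longleftrightarrow>
     (\<forall>p. \<forall>X\<in>tangent_space A p. \<forall>Y\<in>tangent_space A p. \<forall>Z\<in>tangent_space A p. \<forall>a b.
        \<alpha> p (\<lambda>c. a *\<^sub>R X c + b *\<^sub>R Y c) Z = a * \<alpha> p X Z + b * \<alpha> p Y Z \<and> \<alpha> p X Y = - \<alpha> p Y X) \<and>
     (\<forall>c\<in>A. \<forall>v w. smooth_on (snd c ` fst c) (form2_coord A \<alpha> c v w))"

text \<open>\<open>d\<alpha> = 0\<close>, evaluated on constant coordinate vector fields, whose Lie brackets vanish.\<close>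

definition closed_form2 ::
    "('m::topological_space, 'e::euclidean_space) atlas \<Rightarrow> ('m, 'e) form2 \<Rightarrow> bool" where
  "closed_form2 A \<alpha> \<longleftrightarrow>
     (\<forall>c\<in>A. \<forall>y \<in> snd c ` fst c. \<forall>v1 v2 v3.
        frechet_derivative (form2_coord A \<alpha> c v2 v3) (at y) v1
        - frechet_derivative (form2_coord A \<alpha> c v1 v3) (at y) v2
        + frechet_derivative (form2_coord A \<alpha> c v1 v2) (at y) v3 = 0)"

definition nondegenerate_form2 ::
    "('m::topological_space, 'e::euclidean_space) atlas \<Rightarrow> ('m, 'e) form2 \<Rightarrow> bool" where
  "nondegenerate_form2 A \<alpha> \<longleftrightarrow>
     (\<forall>p. \<forall>X\<in>tangent_space A p. (\<forall>Y\<in>tangent_space A p. \<alpha> p X Y = 0) \<longrightarrow> X = (\<lambda>_. 0))"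

definition symplectic_manifold ::
    "('m::topological_space, 'e::euclidean_space) atlas \<Rightarrow> ('m, 'e) form2 \<Rightarrow> bool" where
  "symplectic_manifold A \<omega> \<longleftrightarrow>
     smooth_atlas A \<and> smooth_form2 A \<omega> \<and> closed_form2 A \<omega> \<and> nondegenerate_form2 A \<omega>"

definition exact_form1 ::
    "('s::topological_space, 'd::euclidean_space) atlas \<Rightarrow> ('s, 'd) form1 \<Rightarrow> bool" where
  "exact_form1 A \<alpha> \<longleftrightarrow>
     (\<exists>h. smooth_fun A h \<and> (\<forall>x. \<forall>\<xi>\<in>tangent_space A x. \<alpha> x \<xi> = fun_differential A h x \<xi>))"

text \<open>The exterior product of two alternating bilinear forms, as a 4-form on the first four entries
  of a sequence of vectors. It carries the factor \<open>1 / (2! 2!)\<close> and not \<open>1 / 4!\<close>, so that, e.g.,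
  \<open>dx\<^sub>1 \<and> dx\<^sub>2 \<and> dx\<^sub>3 \<and> dx\<^sub>4\<close> is \<open>1\<close> on the standard basis.\<close>

definition wedge2 :: "('v \<Rightarrow> 'v \<Rightarrow> real) \<Rightarrow> ('v \<Rightarrow> 'v \<Rightarrow> real) \<Rightarrow> (nat \<Rightarrow> 'v) \<Rightarrow> real" where
  "wedge2 \<alpha> \<beta> v =
     (\<Sum>\<pi> | \<pi> permutes {..<4}.
        of_int (sign \<pi>) * \<alpha> (v (\<pi> 0)) (v (\<pi> 1)) * \<beta> (v (\<pi> 2)) (v (\<pi> 3))) / (fact 2 * fact 2)"


section \<open>Integration over a closed surface\<close>

text \<open>A finite smooth partition of unity, indexed by the charts to whose domains it is subordinate.\<close>

definition partition_of_unity ::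
    "('s::topological_space, 'd::euclidean_space) atlas \<Rightarrow>
     ('s, 'd) chart set \<Rightarrow> (('s, 'd) chart \<Rightarrow> 's \<Rightarrow> real) \<Rightarrow> bool" where
  "partition_of_unity A I \<rho> \<longleftrightarrow> finite I \<and> I \<subseteq> A \<and>
     (\<forall>c\<in>I. smooth_fun A (\<rho> c) \<and> (\<forall>x. 0 \<le> \<rho> c x) \<and> closure {x. \<rho> c x \<noteq> 0} \<subseteq> fst c) \<and>
     (\<forall>x. (\<Sum>c\<in>I. \<rho> c x) = 1)"

text \<open>The integral of the 2-form \<open>\<eta>\<close> over a compact surface oriented by the area form \<open>\<sigma>\<close>. The sign
  of \<open>\<sigma>\<close> accounts for charts that are not oriented. The integral does not depend on the partition
  of unity.\<close>

definition surface_integral ::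
    "('s::topological_space, real^2) atlas \<Rightarrow> ('s, real^2) form2 \<Rightarrow> ('s, real^2) form2 \<Rightarrow> real" where
  "surface_integral A \<sigma> \<eta> =
     (let (I, \<rho>) = (SOME (I, \<rho>). partition_of_unity A I \<rho>) in
      \<Sum>c\<in>I. integral (snd c ` fst c)
        (\<lambda>y. \<rho> c (inv_chart c y) * sgn (form2_coord A \<sigma> c (axis 1 1) (axis 2 1) y)
              * form2_coord A \<eta> c (axis 1 1) (axis 2 1) y))"


section \<open>Symplectic embeddings of a surface\<close>

definition smooth_embedding ::
    "('s::topological_space, 'd::euclidean_space) atlas \<Rightarrow>
     ('m::topological_space, 'e::euclidean_space) atlas \<Rightarrow> ('s \<Rightarrow> 'm) \<Rightarrow> bool" where
  "smooth_embedding A B f \<longleftrightarrow> smooth_map A B f \<and>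
     (\<forall>x. inj_on (tangent_map A B f x) (tangent_space A x)) \<and>
     (\<exists>g. homeomorphism UNIV (range f) f g)"

definition symplectic_embeddings ::
    "('s::topological_space, 'd::euclidean_space) atlas \<Rightarrow> ('s, 'd) form2 \<Rightarrow>
     ('m::topological_space, 'e::euclidean_space) atlas \<Rightarrow> ('m, 'e) form2 \<Rightarrow> ('s \<Rightarrow> 'm) set" where
  "symplectic_embeddings A \<sigma> B \<omega> =
     {f. smooth_embedding A B f \<and>
         (\<forall>x. \<forall>\<xi>\<in>tangent_space A x. \<forall>\<zeta>\<in>tangent_space A x.
            \<omega> (f x) (tangent_map A B f x \<xi>) (tangent_map A B f x \<zeta>) = \<sigma> x \<xi> \<zeta>)}"

text \<open>The product atlas of \<open>\<real> \<times> \<Sigma>\<close>.\<close>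

definition cylinder_atlas :: "('s, 'd) atlas \<Rightarrow> (real \<times> 's, real \<times> 'd) atlas" where
  "cylinder_atlas A = (\<lambda>c. (UNIV \<times> fst c, map_prod id (snd c))) ` A"

text \<open>In the convenient setup, the tangent vectors at \<open>f\<close> are the velocities of the smooth curves
  through \<open>f\<close>. As \<open>\<Sigma>\<close> is compact, a curve \<open>F\<close> in \<open>C\<^sup>\<infinity>(\<Sigma>, M)\<close> is smooth iff \<open>(t, x) \<mapsto> F t x\<close> is smooth
  on \<open>\<real> \<times> \<Sigma>\<close>. Its velocity is the section \<open>x \<mapsto> d/dt F t x\<close> of \<open>f\<^sup>*TM\<close>.\<close>

definition tangent_symplectic_embeddings ::
    "('s::topological_space, 'd::euclidean_space) atlas \<Rightarrow> ('s, 'd) form2 \<Rightarrow>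
     ('m::topological_space, 'e::euclidean_space) atlas \<Rightarrow> ('m, 'e) form2 \<Rightarrow> ('s \<Rightarrow> 'm) \<Rightarrow>
     ('s \<Rightarrow> ('m, 'e) tangent) set" where
  "tangent_symplectic_embeddings A \<sigma> B \<omega> f =
     {\<lambda>x. velocity B (\<lambda>t. F t x) | F.
        smooth_map (cylinder_atlas A) B (case_prod F) \<and>
        (\<forall>t. F t \<in> symplectic_embeddings A \<sigma> B \<omega>) \<and> F 0 = f}"


section \<open>Two 2-forms on the space of maps\<close>

text \<open>These are defined on \<open>C\<^sup>\<infinity>(\<Sigma>, M)\<close>. On tangent vectors, the inclusion of the space of symplectic
  embeddings is the inclusion of a subset of \<open>\<Gamma>(f\<^sup>*TM)\<close>, so their pullbacks to that space are given by
  the same terms, for arguments in \<open>tangent_symplectic_embeddings A \<sigma> B \<omega> f\<close>.\<close>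

definition omega_D ::
    "('s::topological_space, real^2) atlas \<Rightarrow> ('s, real^2) form2 \<Rightarrow>
     ('m::topological_space, 'e::euclidean_space) form2 \<Rightarrow>
     ('s \<Rightarrow> 'm) \<Rightarrow> ('s \<Rightarrow> ('m, 'e) tangent) \<Rightarrow> ('s \<Rightarrow> ('m, 'e) tangent) \<Rightarrow> real" where
  "omega_D A \<sigma> \<omega> f \<tau>1 \<tau>2 =
     surface_integral A \<sigma> (\<lambda>x \<xi>1 \<xi>2. \<omega> (f x) (\<tau>1 x) (\<tau>2 x) * \<sigma> x \<xi>1 \<xi>2)"

text \<open>The differential of \<open>ev(f, x) = f(x)\<close> at \<open>(f, x)\<close>, on a tangent vector \<open>(\<tau>, \<xi>)\<close> of
  \<open>C\<^sup>\<infinity>(\<Sigma>, M) \<times> \<Sigma>\<close> where \<open>\<tau> \<in> \<Gamma>(f\<^sup>*TM)\<close> and \<open>\<xi> \<in> T\<^sub>x\<Sigma>\<close>: it is \<open>\<tau>(x) + df\<^sub>x(\<xi>)\<close>. The lemma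
  \<open>velocity_ev\<close> below derives this from its action on curves.\<close>

definition ev_differential ::
    "('s::topological_space, 'd::euclidean_space) atlas \<Rightarrow>
     ('m::topological_space, 'e::euclidean_space) atlas \<Rightarrow> ('s \<Rightarrow> 'm) \<Rightarrow> 's \<Rightarrow>
     ('s \<Rightarrow> ('m, 'e) tangent) \<times> ('s, 'd) tangent \<Rightarrow> ('m, 'e) tangent" where
  "ev_differential A B f x = (\<lambda>(\<tau>, \<xi>). \<lambda>d. \<tau> x d + tangent_map A B f x \<xi> d)"

lemma velocity_ev:
  fixes A :: "('s::topological_space, 'd::euclidean_space) atlas"
    and B :: "('m::topological_space, 'e::euclidean_space) atlas"
  assumes A: "smooth_atlas A"
    and F: "smooth_map (cylinder_atlas A) B (case_prod F)"
    and g: "smooth_map {(UNIV, id)} A \<gamma>"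
  shows "velocity B (\<lambda>t. F t (\<gamma> t)) =
    ev_differential A B (F 0) (\<gamma> 0) (\<lambda>x. velocity B (\<lambda>t. F t x), velocity A \<gamma>)"
proof
  fix d
  define x where "x = \<gamma> 0"
  define c where "c = chart_at A x"
  have "\<exists>c. c \<in> A \<and> x \<in> fst c" using A unfolding smooth_atlas_def by blast
  then have c: "c \<in> A" "x \<in> fst c"
    unfolding c_def chart_at_def by (metis (mono_tags, lifting) someI_ex)+
  have oc: "open (fst c)" "open (snd c ` fst c)"
    and hc: "homeomorphism (fst c) (snd c ` fst c) (snd c) (inv_chart c)"
    using A c unfolding smooth_atlas_def by auto
  have inv: "inv_chart c (snd c z) = z" if "z \<in> fst c" for z
    using hc that by (simp add: homeomorphism_def)
  have inj: "inj_on (snd c) (fst c)" by (metis inj_on_inverseI inv)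
  show "velocity B (\<lambda>t. F t (\<gamma> t)) d =
    ev_differential A B (F 0) (\<gamma> 0) (\<lambda>x. velocity B (\<lambda>t. F t x), velocity A \<gamma>) d"
  proof (cases "d \<in> B \<and> F 0 x \<in> fst d")
    case False
    then show ?thesis by (auto simp: velocity_def ev_differential_def tangent_map_def Let_def x_def)
  next
    case True
    define c' where "c' = (UNIV \<times> fst c :: (real \<times> 's) set, map_prod id (snd c) :: real \<times> 's \<Rightarrow> real \<times> 'd)"
    have "c' \<in> cylinder_atlas A" using c by (auto simp: c'_def cylinder_atlas_def)
    define G where "G = snd d \<circ> case_prod F \<circ> inv_chart c'"
    have inj': "inj_on (snd c') (fst c')"
      using inj by (auto simp: c'_def inj_on_def)
    have inv': "inv_chart c' (t, snd c z) = (t, z)" if "z \<in> fst c" for t z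
    proof -
      have "(t, z) \<in> fst c'" "snd c' (t, z) = (t, snd c z)" using that by (auto simp: c'_def)
      then show ?thesis unfolding inv_chart_def using inv_into_f_f[OF inj'] by metis
    qed
    have Geq: "G (t, snd c z) = snd d (F t z)" if "z \<in> fst c" for t z
      using inv'[OF that] by (simp add: G_def)
    have "smooth_on (snd c' ` (fst c' \<inter> case_prod F -` fst d)) G"
      using F \<open>c' \<in> _\<close> True unfolding smooth_map_def G_def by blast
    moreover have "(0, snd c x) \<in> snd c' ` (fst c' \<inter> case_prod F -` fst d)"
      using c True by (intro image_eqI[of _ _ "(0, x)"]) (auto simp: c'_def)
    ultimately have "G differentiable (at (0, snd c x))"
      by (rule smooth_on_imp_differentiable)
    then obtain G' where G': "(G has_derivative G') (at (0, snd c x))"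
      unfolding differentiable_def by blast
    then have lin: "linear G'" by (rule has_derivative_linear)
    \<comment> \<open>the curve in the chart\<close>
    have gcont: "continuous_on UNIV \<gamma>" using g unfolding smooth_map_def by blast
    have invid: "inv_chart (UNIV, id :: real \<Rightarrow> real) = id"
      by (auto simp: inv_chart_def fun_eq_iff)
    have "smooth_on (\<gamma> -` fst c) (snd c \<circ> \<gamma>)"
      using g c(1) invid unfolding smooth_map_def by auto
    then have "(snd c \<circ> \<gamma>) differentiable (at 0)"
      using c(2) by (auto simp: x_def intro: smooth_on_imp_differentiable)
    then have w: "((snd c \<circ> \<gamma>) has_vector_derivative vector_derivative (snd c \<circ> \<gamma>) (at 0)) (at 0)"
      by (simp add: vector_derivative_works)
    define w where "w = vector_derivative (snd c \<circ> \<gamma>) (at 0)"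
    have og: "open (\<gamma> -` fst c)" "0 \<in> \<gamma> -` fst c"
      using gcont oc(1) c(2) by (auto simp: open_vimage x_def)
    have v1: "((snd d \<circ> (\<lambda>t. F t (\<gamma> t))) has_vector_derivative G' (1, w)) (at 0)"
    proof -
      have "((\<lambda>t. (t, (snd c \<circ> \<gamma>) t)) has_derivative (\<lambda>h. (h, h *\<^sub>R w))) (at 0)"
        using w by (auto intro!: has_derivative_Pair simp: has_vector_derivative_def w_def o_def)
      moreover have "(G has_derivative G') (at (0, (snd c \<circ> \<gamma>) 0))" using G' by (simp add: x_def)
      ultimately have "((\<lambda>t. G (t, (snd c \<circ> \<gamma>) t)) has_derivative (\<lambda>h. G' (h, h *\<^sub>R w))) (at 0)"
        by (rule has_derivative_compose)
      moreover have "G' (h, h *\<^sub>R w) = h *\<^sub>R G' (1, w)" for h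
        using linear_scale[OF lin, of h "(1, w)"] by simp
      ultimately have "((\<lambda>t. G (t, (snd c \<circ> \<gamma>) t)) has_vector_derivative G' (1, w)) (at 0)"
        by (simp add: has_vector_derivative_def)
      then show ?thesis
        by (rule has_vector_derivative_transform_within_open[OF _ og]) (simp add: Geq)
    qed
    have v2: "((snd d \<circ> (\<lambda>t. F t x)) has_vector_derivative G' (1, 0)) (at 0)"
    proof -
      have "((\<lambda>t. (t, snd c x)) has_derivative (\<lambda>h. (h, 0))) (at 0)"
        by (auto intro!: derivative_eq_intros)
      then have "((\<lambda>t. G (t, snd c x)) has_derivative (\<lambda>h. G' (h, 0))) (at 0)"
        using G' by (rule has_derivative_compose)
      moreover have "(\<lambda>h. G' (h, 0)) = (\<lambda>h. h *\<^sub>R G' (1, 0))"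
      proof
        show "G' (h, 0) = h *\<^sub>R G' (1, 0)" for h
          using linear_scale[OF lin, of h "(1, 0)"] by simp
      qed
      ultimately have "((\<lambda>t. G (t, snd c x)) has_vector_derivative G' (1, 0)) (at 0)"
        unfolding has_vector_derivative_def by metis
      then show ?thesis
        using c(2) by (simp add: Geq o_def)
    qed
    have v3: "((snd d \<circ> F 0 \<circ> inv_chart c) has_derivative (\<lambda>v. G' (0, v))) (at (snd c x))"
    proof -
      have "((\<lambda>z. (0, z)) has_derivative (\<lambda>v. (0, v))) (at (snd c x))"
        by (auto intro!: derivative_eq_intros)
      then have "((\<lambda>z. G (0, z)) has_derivative (\<lambda>v. G' (0, v))) (at (snd c x))"
        using G' by (rule has_derivative_compose)
      then show ?thesis
        by (rule has_derivative_transform_within_open[OF _ oc(2)]) (use c(2) in \<open>auto simp: Geq inv\<close>)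
    qed
    have "G' (1, w) = G' (1, 0) + G' (0, w)"
      using linear_add[OF lin, of "(1, 0)" "(0, w)"] by simp
    moreover have "velocity B (\<lambda>t. F t (\<gamma> t)) d = G' (1, w)"
      using True vector_derivative_at[OF v1] by (simp add: velocity_def x_def)
    moreover have "velocity B (\<lambda>t. F t x) d = G' (1, 0)"
      using True vector_derivative_at[OF v2] by (simp add: velocity_def)
    moreover have "velocity A \<gamma> c = w"
      using c by (simp add: velocity_def x_def w_def)
    then have "tangent_map A B (F 0) x (velocity A \<gamma>) d = G' (0, w)"
      using True unfolding tangent_map_def c_def[symmetric] Let_def frechet_derivative_at[OF v3, symmetric]
      by simp
    ultimately show ?thesis
      by (simp add: ev_differential_def flip: x_def)
  qed
qed

text \<open>The 4-form \<open>ev\<^sup>*(\<omega> \<and> \<omega>)\<close> at \<open>(f, x)\<close>.\<close>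

definition ev_pullback_wedge ::
    "('s::topological_space, 'd::euclidean_space) atlas \<Rightarrow>
     ('m::topological_space, 'e::euclidean_space) atlas \<Rightarrow> ('m, 'e) form2 \<Rightarrow> ('s \<Rightarrow> 'm) \<Rightarrow> 's \<Rightarrow>
     (nat \<Rightarrow> ('s \<Rightarrow> ('m, 'e) tangent) \<times> ('s, 'd) tangent) \<Rightarrow> real" where
  "ev_pullback_wedge A B \<omega> f x v =
     wedge2 (\<omega> (f x)) (\<omega> (f x)) (\<lambda>i. ev_differential A B f x (v i))"

text \<open>The contraction with \<open>\<ell>\<^sub>1 \<and> \<ell>\<^sub>2\<close> inserts \<open>\<ell>\<^sub>1, \<ell>\<^sub>2\<close> into the first two slots, where
  \<open>\<ell>\<^sub>k = (\<tau>\<^sub>k, 0)\<close>. The resulting form is restricted to \<open>{f} \<times> \<Sigma>\<close>, whose tangent vectors are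
  \<open>(0, \<xi>)\<close>.\<close>

definition omega_maps ::
    "('s::topological_space, real^2) atlas \<Rightarrow> ('s, real^2) form2 \<Rightarrow>
     ('m::topological_space, 'e::euclidean_space) atlas \<Rightarrow> ('m, 'e) form2 \<Rightarrow>
     ('s \<Rightarrow> 'm) \<Rightarrow> ('s \<Rightarrow> ('m, 'e) tangent) \<Rightarrow> ('s \<Rightarrow> ('m, 'e) tangent) \<Rightarrow> real" where
  "omega_maps A \<sigma> B \<omega> f \<tau>1 \<tau>2 =
     surface_integral A \<sigma> (\<lambda>x \<xi>1 \<xi>2.
       ev_pullback_wedge A B \<omega> f x
         (nth [(\<tau>1, \<lambda>_. 0), (\<tau>2, \<lambda>_. 0), (\<lambda>_ _. 0, \<xi>1), (\<lambda>_ _. 0, \<xi>2)]))"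

end

theory Submission
  imports Defs
begin

text \<open>Put \<open>\<alpha> = \<omega>(u, df)\<close> and \<open>\<beta> = \<omega>(v, df)\<close>. Inserting \<open>u, v\<close> into \<open>ev\<^sup>*(\<omega> \<and> \<omega>)\<close>
  leaves the 2-form \<open>2 \<omega>(u, v) \<sigma> - 2 \<alpha> \<and> \<beta>\<close>, since \<open>f\<^sup>*\<omega> = \<sigma>\<close>.
  If \<open>v\<close> is the velocity of a curve \<open>F\<close> of symplectic embeddings, \<open>\<beta>\<close> is the time
  component of the closed form \<open>F\<^sup>*\<omega>\<close> on \<open>\<real> \<times> \<Sigma>\<close>, whose restriction to the slices is the constant \<open>\<sigma>\<close>;
  hence \<open>\<beta>\<close> is closed. As \<open>\<alpha> = dh\<close>, Stokes' theorem on the closed surface \<open>\<Sigma>\<close> gives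
  \<open>\<integral> dh \<and> \<beta> = 0\<close>. For the latter, a partition of unity splits \<open>h\<close> into summands \<open>k\<close>
  supported in a single chart, where \<open>dk \<and> \<beta> = d(k\<beta>)\<close> is the divergence of a compactly supported
  vector field.\<close>

section \<open>Smooth functions on open sets\<close>

text \<open>The two directions enter differently: \<alpha> is exact by assumption, but closedness of
  \<beta> cannot be read off from \<omega>, f and the values of v. It comes from the fact that all
  maps of the curve pull \<omega> back to the same \<sigma>. Working with F^*\<omega> on \<real>
  \<times> \<Sigma> avoids extending v to a vector field on M. The obstacle in Stokes' theorem is
  that \<open>surface_integral\<close> rests on a partition of unity about which only its existence
  is known; it need not have anything to do with the chart that carries the support of k. Each
  weighted piece is first moved to that chart by a change of variables, and there the weights add up
  to 1. The factor \<open>sgn\<close> in the integrand turns the Jacobian determinant into its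
  absolute value; it is only locally constant, since chart domains may be disconnected.
  \<open>Ck_on\<close> controls derivatives in fixed directions only. Whenever a direction moves
  with the point, a basis expansion leads back to fixed directions; this is why coordinate spaces
  are Euclidean throughout.\<close>

lemma frechet_derivative_eqI: "(f has_derivative f') (at x) \<Longrightarrow> frechet_derivative f (at x) = f'"
  using frechet_derivative_at by metis

lemma differentiableD: "f differentiable (at x) \<Longrightarrow> (f has_derivative frechet_derivative f (at x)) (at x)"
  by (simp add: frechet_derivative_works)

text \<open>Both functions have exactly the same derivatives at \<open>x\<close>, so the choice
  operator behind \<open>frechet_derivative\<close> returns the same map, even where neither is
  differentiable.\<close>

lemma frechet_derivative_cong_open:
  assumes "open S" "x \<in> S" "\<And>y. y \<in> S \<Longrightarrow> f y = g y"
  shows "frechet_derivative f (at x) = frechet_derivative g (at x)"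
proof -
  have "(f has_derivative D) (at x) \<longleftrightarrow> (g has_derivative D) (at x)" for D
    using assms by (metis has_derivative_transform_within_open)
  then show ?thesis unfolding frechet_derivative_def by simp
qed

lemma differentiable_cong_open:
  assumes "open S" "x \<in> S" "\<And>y. y \<in> S \<Longrightarrow> f y = g y" "f differentiable (at x)"
  shows "g differentiable (at x)"
  using assms unfolding differentiable_def by (metis has_derivative_transform_within_open)

text \<open>Derivatives in \<open>Ck_on\<close> are taken in the full space, so on a set that is not
  open the values outside would matter. Openness lets agreement on \<open>S\<close> pass to the
  derivatives and hence through the induction.\<close>

lemma Ck_on_cong:
  assumes "open S" "\<And>y. y \<in> S \<Longrightarrow> f y = g y" "Ck_on k S f"
  shows "Ck_on k S g"
  using assms(2,3)
proof (induction k arbitrary: f g)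
  case 0
  then show ?case by (auto cong: continuous_on_cong)
next
  case (Suc k)
  have "frechet_derivative f (at x) v = frechet_derivative g (at x) v" if "x \<in> S" for x v
    using frechet_derivative_cong_open[OF assms(1) that Suc.prems(1)] by simp
  then have "Ck_on k S (\<lambda>x. frechet_derivative g (at x) v)" for v
    by (rule Suc.IH[of "\<lambda>x. frechet_derivative f (at x) v"]) (use Suc.prems(2) in auto)
  moreover have "g differentiable (at x)" if "x \<in> S" for x
    using differentiable_cong_open[OF assms(1) that Suc.prems(1)] Suc.prems(2) that by simp
  ultimately show ?case by simp
qed

lemma Ck_on_subset: "T \<subseteq> S \<Longrightarrow> Ck_on k S f \<Longrightarrow> Ck_on k T f"
  by (induction k arbitrary: f) (auto intro: continuous_on_subset)

lemma Ck_on_SucD: "Ck_on (Suc k) S f \<Longrightarrow> Ck_on k S f"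
proof (induction k arbitrary: f)
  case 0
  then show ?case
    by (auto intro!: continuous_at_imp_continuous_on differentiable_imp_continuous_within)
next
  case (Suc k)
  then show ?case by (metis Ck_on.simps(2))
qed

lemma Ck_on_continuous: "Ck_on k S f \<Longrightarrow> continuous_on S f"
  by (induction k) (auto dest: Ck_on_SucD simp del: Ck_on.simps(2))

text \<open>Lets smoothness on a chart image be checked near each point, with a target chart that
  depends on the point.\<close>

lemma Ck_on_local:
  assumes "\<And>x. x \<in> S \<Longrightarrow> \<exists>U. open U \<and> x \<in> U \<and> Ck_on k U f"
  shows "Ck_on k S f"
  using assms
proof (induction k arbitrary: f)
  case 0
  then show ?case
    by (auto intro!: continuous_at_imp_continuous_on simp: continuous_on_eq_continuous_at)
       (metis continuous_on_eq_continuous_at)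
next
  case (Suc k)
  show ?case unfolding Ck_on.simps
  proof (intro conjI ballI allI)
    show "f differentiable (at x)" if "x \<in> S" for x
      using Suc.prems[OF that] by auto
    show "Ck_on k S (\<lambda>x. frechet_derivative f (at x) v)" for v
      by (rule Suc.IH) (use Suc.prems in \<open>metis Ck_on.simps(2)\<close>)
  qed
qed

lemma Ck_on_const: "Ck_on k S (\<lambda>x. c)"
  by (induction k arbitrary: c) (auto simp: frechet_derivative_const)

lemma Ck_on_add:
  assumes "open S"
  shows "Ck_on k S f \<Longrightarrow> Ck_on k S g \<Longrightarrow> Ck_on k S (\<lambda>x. f x + g x)"
proof (induction k arbitrary: f g)
  case 0
  then show ?case by (auto intro: continuous_on_add)
next
  case (Suc k)
  have d: "((\<lambda>x. f x + g x) has_derivative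
      (\<lambda>v. frechet_derivative f (at x) v + frechet_derivative g (at x) v)) (at x)" if "x \<in> S" for x
    using Suc.prems that by (auto intro!: has_derivative_add differentiableD)
  have "Ck_on k S (\<lambda>x. frechet_derivative (\<lambda>x. f x + g x) (at x) v)" for v
    by (rule Ck_on_cong[OF assms _ Suc.IH[of "\<lambda>x. frechet_derivative f (at x) v" "\<lambda>x. frechet_derivative g (at x) v"]])
       (use Suc.prems frechet_derivative_eqI[OF d] in auto)
  then show ?case using d by (auto simp: differentiable_def)
qed

text \<open>One Leibniz rule for products, inner products and scaling. The induction hypothesis is
  applied to \<open>f\<close> with a derivative of \<open>g\<close> and vice versa, so the
  undifferentiated factor has to be lowered by one order with \<open>Ck_on_SucD\<close>.\<close>

lemma Ck_on_bilinear:
  assumes "open S" and b: "bounded_bilinear b"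
  shows "Ck_on k S f \<Longrightarrow> Ck_on k S g \<Longrightarrow> Ck_on k S (\<lambda>x. b (f x) (g x))"
proof (induction k arbitrary: f g)
  case 0
  then show ?case using bounded_bilinear.continuous_on[OF b] by auto
next
  case (Suc k)
  have d: "((\<lambda>x. b (f x) (g x)) has_derivative
      (\<lambda>v. b (f x) (frechet_derivative g (at x) v) + b (frechet_derivative f (at x) v) (g x))) (at x)"
    if "x \<in> S" for x
    using Suc.prems that by (auto intro!: bounded_bilinear.FDERIV[OF b] differentiableD)
  have "Ck_on k S (\<lambda>x. frechet_derivative (\<lambda>x. b (f x) (g x)) (at x) v)" for v
    by (rule Ck_on_cong[OF assms(1), of "\<lambda>x. b (f x) (frechet_derivative g (at x) v) + b (frechet_derivative f (at x) v) (g x)"])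
       (use Suc.prems Ck_on_SucD[OF Suc.prems(1)] Ck_on_SucD[OF Suc.prems(2)] frechet_derivative_eqI[OF d]
        in \<open>auto intro!: Ck_on_add Suc.IH assms(1)\<close>)
  then show ?case using d by (auto simp: differentiable_def)
qed

lemma Ck_on_bounded_linear:
  assumes "bounded_linear f"
  shows "Ck_on k S f"
proof (cases k)
  case 0
  then show ?thesis using assms by (auto intro: linear_continuous_on)
next
  case (Suc n)
  have "frechet_derivative f (at x) = f" for x
    by (rule frechet_derivative_eqI) (rule bounded_linear_imp_has_derivative[OF assms])
  then show ?thesis using Suc Ck_on_const assms by (auto simp: bounded_linear_imp_differentiable)
qed

lemma Ck_on_sum:
  assumes "open S"
  shows "(\<And>i. i \<in> I \<Longrightarrow> Ck_on k S (f i)) \<Longrightarrow> Ck_on k S (\<lambda>x. \<Sum>i\<in>I. f i x)"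
  by (induction I rule: infinite_finite_induct) (auto intro: Ck_on_add[OF assms] Ck_on_const)

lemma linear_basis_expansion:
  fixes f :: "'a::euclidean_space \<Rightarrow> 'b::real_vector"
  assumes "linear f"
  shows "f v = (\<Sum>b\<in>Basis. (v \<bullet> b) *\<^sub>R f b)"
  by (metis (mono_tags, lifting) assms euclidean_representation linear_scale linear_sum sum.cong)

text \<open>In the chain rule the outer derivative is taken in the direction
  \<open>frechet_derivative g (at x) v\<close>, which moves with \<open>x\<close>. Expanding this
  direction in the basis leaves derivatives of \<open>f\<close> in fixed directions, to which the
  induction hypothesis applies.\<close>

lemma Ck_on_compose:
  fixes f :: "'b::euclidean_space \<Rightarrow> 'c::real_normed_vector" and g :: "'a::real_normed_vector \<Rightarrow> 'b"
  assumes S: "open S"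
  shows "Ck_on k S g \<Longrightarrow> Ck_on k T f \<Longrightarrow> g ` S \<subseteq> T \<Longrightarrow> Ck_on k S (\<lambda>x. f (g x))"
proof (induction k arbitrary: f g)
  case 0
  then show ?case by (auto intro: continuous_on_compose2)
next
  case (Suc k)
  have d: "((\<lambda>x. f (g x)) has_derivative
      (\<lambda>v. frechet_derivative f (at (g x)) (frechet_derivative g (at x) v))) (at x)"
    if "x \<in> S" for x
    using Suc.prems that
    by (intro has_derivative_compose[of g _ x UNIV f] differentiableD) auto
  have e: "frechet_derivative (\<lambda>x. f (g x)) (at x) v =
      (\<Sum>b\<in>Basis. (frechet_derivative g (at x) v \<bullet> b) *\<^sub>R frechet_derivative f (at (g x)) b)"
    if "x \<in> S" for x v
    using Suc.prems that
    by (subst frechet_derivative_eqI[OF d[OF that]], subst linear_basis_expansion[of "frechet_derivative f (at (g x))"])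
       (auto intro!: linear_frechet_derivative)
  have "Ck_on k S (\<lambda>x. frechet_derivative (\<lambda>x. f (g x)) (at x) v)" for v
  proof (rule Ck_on_cong[OF S e[symmetric]], assumption, intro Ck_on_sum[OF S]
      Ck_on_bilinear[OF S bounded_bilinear_scaleR] Ck_on_bilinear[OF S bounded_bilinear_inner] Ck_on_const)
    show "Ck_on k S (\<lambda>x. frechet_derivative g (at x) v)" using Suc.prems by auto
    show "Ck_on k S (\<lambda>x. frechet_derivative f (at (g x)) b)" for b
      by (rule Suc.IH[of g "\<lambda>y. frechet_derivative f (at y) b"]) (use Suc.prems Ck_on_SucD[OF Suc.prems(1)] in auto)
  qed
  then show ?case using d by (auto simp: differentiable_def)
qed

lemma Ck_on_inverse:
  fixes g :: "'a::real_normed_vector \<Rightarrow> real"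
  assumes S: "open S" and nz: "\<And>x. x \<in> S \<Longrightarrow> g x \<noteq> 0"
  shows "Ck_on k S g \<Longrightarrow> Ck_on k S (\<lambda>x. inverse (g x))"
proof (induction k)
  case 0
  then show ?case using nz by (auto intro!: continuous_on_inverse)
next
  case (Suc k)
  have d: "((\<lambda>x. inverse (g x)) has_derivative
      (\<lambda>v. - 1 * (inverse (g x) * frechet_derivative g (at x) v * inverse (g x)))) (at x)"
    if "x \<in> S" for x
    using Suc.prems that nz
    by (auto intro!: derivative_eq_intros differentiableD)
  have g: "Ck_on k S g" "Ck_on k S (\<lambda>x. frechet_derivative g (at x) v)" for v
    using Ck_on_SucD[OF Suc.prems] Suc.prems by auto
  have "Ck_on k S (\<lambda>x. frechet_derivative (\<lambda>x. inverse (g x)) (at x) v)" for v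
  proof (rule Ck_on_cong[OF S])
    show "Ck_on k S (\<lambda>x. - 1 * (inverse (g x) * frechet_derivative g (at x) v * inverse (g x)))"
      by (intro Ck_on_bilinear[OF S bounded_bilinear_mult] Ck_on_const Suc.IH g)
  qed (simp add: frechet_derivative_eqI[OF d])
  then show ?case using d by (auto simp: differentiable_def)
qed

lemma smooth_on_cong:
  "open S \<Longrightarrow> smooth_on S f \<Longrightarrow> (\<And>y. y \<in> S \<Longrightarrow> f y = g y) \<Longrightarrow> smooth_on S g"
  unfolding smooth_on_def using Ck_on_cong by blast

lemma smooth_on_subset: "smooth_on S f \<Longrightarrow> T \<subseteq> S \<Longrightarrow> smooth_on T f"
  unfolding smooth_on_def using Ck_on_subset by blast

lemma smooth_on_continuous: "smooth_on S f \<Longrightarrow> continuous_on S f"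
  unfolding smooth_on_def using Ck_on_continuous by blast

lemma smooth_on_local:
  "(\<And>x. x \<in> S \<Longrightarrow> \<exists>U. open U \<and> x \<in> U \<and> smooth_on U f) \<Longrightarrow> smooth_on S f"
  unfolding smooth_on_def using Ck_on_local by metis

lemma smooth_on_deriv: "smooth_on S f \<Longrightarrow> smooth_on S (\<lambda>x. frechet_derivative f (at x) v)"
  unfolding smooth_on_def by (metis Ck_on.simps(2))

lemma smooth_on_has_derivative:
  "smooth_on S f \<Longrightarrow> x \<in> S \<Longrightarrow> (f has_derivative frechet_derivative f (at x)) (at x)"
  by (intro differentiableD smooth_on_imp_differentiable)

lemma smooth_on_const: "smooth_on S (\<lambda>x. c)"
  by (simp add: smooth_on_def Ck_on_const)

lemma smooth_on_bounded_linear: "bounded_linear f \<Longrightarrow> smooth_on S f"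
  by (simp add: smooth_on_def Ck_on_bounded_linear)

lemma smooth_on_add: "open S \<Longrightarrow> smooth_on S f \<Longrightarrow> smooth_on S g \<Longrightarrow> smooth_on S (\<lambda>x. f x + g x)"
  by (simp add: smooth_on_def Ck_on_add)

lemma smooth_on_bilinear:
  "bounded_bilinear b \<Longrightarrow> open S \<Longrightarrow> smooth_on S f \<Longrightarrow> smooth_on S g \<Longrightarrow> smooth_on S (\<lambda>x. b (f x) (g x))"
  by (simp add: smooth_on_def Ck_on_bilinear)

lemmas smooth_on_mult = smooth_on_bilinear[OF bounded_bilinear_mult]
lemmas smooth_on_inner = smooth_on_bilinear[OF bounded_bilinear_inner]

lemma smooth_on_sum:
  "open S \<Longrightarrow> (\<And>i. i \<in> I \<Longrightarrow> smooth_on S (f i)) \<Longrightarrow> smooth_on S (\<lambda>x. \<Sum>i\<in>I. f i x)"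
  by (simp add: smooth_on_def Ck_on_sum)

lemma smooth_on_compose:
  fixes f :: "'b::euclidean_space \<Rightarrow> 'c::real_normed_vector" and g :: "'a::real_normed_vector \<Rightarrow> 'b"
  shows "open S \<Longrightarrow> smooth_on S g \<Longrightarrow> smooth_on T f \<Longrightarrow> g ` S \<subseteq> T \<Longrightarrow> smooth_on S (\<lambda>x. f (g x))"
  unfolding smooth_on_def by (blast intro: Ck_on_compose)

lemma smooth_on_inverse:
  fixes g :: "'a::real_normed_vector \<Rightarrow> real"
  shows "open S \<Longrightarrow> (\<And>x. x \<in> S \<Longrightarrow> g x \<noteq> 0) \<Longrightarrow> smooth_on S g \<Longrightarrow> smooth_on S (\<lambda>x. inverse (g x))"
  by (simp add: smooth_on_def Ck_on_inverse)

text \<open>The powers of \<open>1/t\<close> make the family closed under differentiation, up to linear combinations.\<close>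

definition flat :: "nat \<Rightarrow> real \<Rightarrow> real" where
  "flat n t = (if t > 0 then inverse t ^ n * exp (- inverse t) else 0)"

lemma flat_tendsto_0: "((\<lambda>t. flat n t) \<longlongrightarrow> 0) (at_right 0)"
proof -
  have "((\<lambda>t::real. inverse t ^ n / exp (inverse t)) \<longlongrightarrow> 0) (at_right 0)"
    by (rule filterlim_compose[OF tendsto_power_div_exp_0 filterlim_inverse_at_top_right])
  moreover have "eventually (\<lambda>t. inverse t ^ n / exp (inverse t) = flat n t) (at_right (0::real))"
    by (auto simp: eventually_at_filter flat_def exp_minus divide_inverse)
  ultimately show ?thesis by (rule Lim_transform_eventually)
qed

text \<open>Differentiating the exponential contributes the factor 1/t^2, differentiating the power
  the factor -n/t; hence the shifts by two and by one.\<close>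

lemma flat_has_derivative:
  "(flat n has_real_derivative flat (n + 2) t - real n * flat (n + 1) t) (at t)"
proof -
  consider "t > 0" | "t < 0" | "t = 0" by linarith
  then show ?thesis
  proof cases
    case 1
    have pow: "m = 0 \<or> t ^ m = t * t ^ (m - Suc 0)" for m
      by (cases m) auto
    have "((\<lambda>t. inverse t ^ n * exp (- inverse t)) has_real_derivative
        flat (n + 2) t - real n * flat (n + 1) t) (at t)"
      using 1 pow by (cases n) (auto intro!: derivative_eq_intros simp: flat_def field_simps power2_eq_square)
    then show ?thesis
      by (rule has_field_derivative_transform_within_open[of _ _ _ "{0<..}"]) (use 1 in \<open>auto simp: flat_def\<close>)
  next
    case 2
    have "((\<lambda>t. 0) has_real_derivative 0) (at t)" by simp
    then have "(flat n has_real_derivative 0) (at t)"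
      by (rule has_field_derivative_transform_within_open[of _ _ _ "{..<0}"]) (use 2 in \<open>auto simp: flat_def\<close>)
    then show ?thesis using 2 by (simp add: flat_def)
  next
    case 3
    have "((\<lambda>h. (flat n (0 + h) - flat n 0) / h) \<longlongrightarrow> 0) (at 0)"
    proof (rule filterlim_split_at_real)
      have "eventually (\<lambda>h. 0 = (flat n (0 + h) - flat n 0) / h) (at_left 0)"
        by (auto simp: eventually_at_filter flat_def)
      then show "((\<lambda>h. (flat n (0 + h) - flat n 0) / h) \<longlongrightarrow> 0) (at_left 0)"
        by (rule Lim_transform_eventually[OF tendsto_const])
      \<comment> \<open>For \<open>h > 0\<close> the difference quotient at 0 is again a member of
        the family, with one more power of 1/h, and so tends to 0.\<close>
      have "eventually (\<lambda>h. flat (n + 1) h = (flat n (0 + h) - flat n 0) / h) (at_right 0)"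
        by (auto simp: eventually_at_filter flat_def field_simps)
      then show "((\<lambda>h. (flat n (0 + h) - flat n 0) / h) \<longlongrightarrow> 0) (at_right 0)"
        by (rule Lim_transform_eventually[OF flat_tendsto_0])
    qed
    then show ?thesis using 3 by (simp add: DERIV_def flat_def)
  qed
qed

lemma smooth_on_flat: "smooth_on UNIV (flat n)"
proof -
  have "Ck_on k UNIV (flat n)" for k
  proof (induction k arbitrary: n)
    case 0
    have "isCont (flat n) x" for x using flat_has_derivative by (rule DERIV_isCont)
    then show ?case by (simp add: continuous_at_imp_continuous_on)
  next
    case (Suc k)
    have d: "(flat n has_derivative (\<lambda>v. (flat (n + 2) t + - real n * flat (n + 1) t) * v)) (at t)" for t
      using flat_has_derivative[of n t] by (simp add: has_field_derivative_def)
    have "Ck_on k UNIV (\<lambda>t. frechet_derivative (flat n) (at t) v)" for v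
      unfolding frechet_derivative_eqI[OF d]
      by (intro Ck_on_bilinear[OF _ bounded_bilinear_mult] Ck_on_add Ck_on_const Suc.IH) auto
    then show ?case using d by (auto simp: differentiable_def)
  qed
  then show ?thesis by (simp add: smooth_on_def)
qed

section \<open>Pullbacks of closed forms in coordinates\<close>

lemma real_derivative_along_line:
  fixes f :: "'a::real_normed_vector \<Rightarrow> real"
  assumes "f differentiable (at (y + r *\<^sub>R a))"
  shows "((\<lambda>r. f (y + r *\<^sub>R a)) has_real_derivative frechet_derivative f (at (y + r *\<^sub>R a)) a) (at r)"
proof -
  define D where "D = frechet_derivative f (at (y + r *\<^sub>R a))"
  have D: "(f has_derivative D) (at (y + r *\<^sub>R a))" unfolding D_def by (rule differentiableD[OF assms])
  have "((\<lambda>r. y + r *\<^sub>R a) has_derivative (\<lambda>h. h *\<^sub>R a)) (at r)"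
    by (auto intro!: derivative_eq_intros)
  from has_derivative_compose[OF this D]
  have "((\<lambda>r. f (y + r *\<^sub>R a)) has_derivative (\<lambda>h. D (h *\<^sub>R a))) (at r)" .
  moreover have "D (h *\<^sub>R a) = D a * h" for h
    using linear_scale[OF has_derivative_linear[OF D], of h a] by simp
  ultimately show ?thesis
    by (simp add: has_field_derivative_def D_def[symmetric] mult_commute_abs)
qed

text \<open>The mean value theorem is applied twice, first along \<open>a\<close> and then along
  \<open>b\<close>. The left side is symmetric in \<open>a\<close> and \<open>b\<close>, while the
  right side is a mixed derivative in a definite order; comparing both orders is the point.\<close>

lemma second_difference_mvt:
  fixes f :: "'a::real_normed_vector \<Rightarrow> real"
  assumes s: "s > 0" and f: "smooth_on S f"
    and S: "\<And>r q. 0 \<le> r \<Longrightarrow> r \<le> s \<Longrightarrow> 0 \<le> q \<Longrightarrow> q \<le> s \<Longrightarrow> x + r *\<^sub>R a + q *\<^sub>R b \<in> S"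
  shows "\<exists>r q. 0 \<le> r \<and> r \<le> s \<and> 0 \<le> q \<and> q \<le> s \<and>
    f (x + s *\<^sub>R a + s *\<^sub>R b) - f (x + s *\<^sub>R a) - f (x + s *\<^sub>R b) + f x =
      s * s * frechet_derivative (\<lambda>y. frechet_derivative f (at y) a) (at (x + r *\<^sub>R a + q *\<^sub>R b)) b"
proof -
  define g where "g r = f ((x + s *\<^sub>R b) + r *\<^sub>R a) - f (x + r *\<^sub>R a)" for r
  have df: "f differentiable (at (x + r *\<^sub>R a + q *\<^sub>R b))"
    "(\<lambda>y. frechet_derivative f (at y) a) differentiable (at (x + r *\<^sub>R a + q *\<^sub>R b))"
    if "0 \<le> r" "r \<le> s" "0 \<le> q" "q \<le> s" for r q
    using S[OF that] f smooth_on_deriv[OF f] smooth_on_imp_differentiable by blast+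
  have g: "DERIV g r :> frechet_derivative f (at ((x + s *\<^sub>R b) + r *\<^sub>R a)) a -
      frechet_derivative f (at (x + r *\<^sub>R a)) a" if "0 \<le> r" "r \<le> s" for r
    unfolding g_def
    by (intro DERIV_diff real_derivative_along_line)
       (use df(1)[of r s] df(1)[of r 0] that s in \<open>auto simp: algebra_simps\<close>)
  obtain r where r: "0 < r" "r < s" "g s - g 0 = (s - 0) * (frechet_derivative f (at ((x + s *\<^sub>R b) + r *\<^sub>R a)) a -
      frechet_derivative f (at (x + r *\<^sub>R a)) a)"
    using MVT2[OF s g] by blast
  define k where "k q = frechet_derivative f (at ((x + r *\<^sub>R a) + q *\<^sub>R b)) a" for q
  have k: "DERIV k q :> frechet_derivative (\<lambda>y. frechet_derivative f (at y) a) (at ((x + r *\<^sub>R a) + q *\<^sub>R b)) b"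
    if "0 \<le> q" "q \<le> s" for q
    unfolding k_def
    by (rule real_derivative_along_line[of "\<lambda>y. frechet_derivative f (at y) a"]) (use df(2)[of r q] that r in auto)
  obtain q where q: "0 < q" "q < s" "k s - k 0 = (s - 0) * frechet_derivative (\<lambda>y. frechet_derivative f (at y) a) (at ((x + r *\<^sub>R a) + q *\<^sub>R b)) b"
    using MVT2[OF s k] by blast
  have "f (x + s *\<^sub>R a + s *\<^sub>R b) - f (x + s *\<^sub>R a) - f (x + s *\<^sub>R b) + f x = g s - g 0"
    by (simp add: g_def algebra_simps)
  also have "\<dots> = s * (k s - k 0)"
    using r(3) by (simp add: k_def algebra_simps)
  finally show ?thesis using q r(1,2)
    by (intro exI[of _ r] exI[of _ q]) auto
qed

text \<open>The two mixed derivatives take a common value, the second difference divided by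
  \<open>s * s\<close>, at two points that are close to \<open>x\<close> when \<open>s\<close> is
  small. Continuity of both then makes their values at \<open>x\<close> differ by less than any
  \<open>e\<close>.\<close>

lemma second_derivative_symmetric_real:
  fixes f :: "'a::real_normed_vector \<Rightarrow> real"
  assumes S: "open S" "x \<in> S" and f: "smooth_on S f"
  shows "frechet_derivative (\<lambda>y. frechet_derivative f (at y) a) (at x) b =
    frechet_derivative (\<lambda>y. frechet_derivative f (at y) b) (at x) a"
proof -
  define D where "D a b y = frechet_derivative (\<lambda>y. frechet_derivative f (at y) a) (at y) b" for a b y
  have contD: "continuous_on S (D a b)" for a b
    unfolding D_def by (intro smooth_on_continuous smooth_on_deriv f)
  have "\<bar>D a b x - D b a x\<bar> \<le> e" if e: "e > 0" for e
  proof -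
    have "isCont (D a b) x" "isCont (D b a) x"
      using contD S continuous_on_eq_continuous_at by blast+
    then obtain d1 d2 where d: "d1 > 0" "d2 > 0"
      "\<And>y. dist y x < d1 \<Longrightarrow> dist (D a b y) (D a b x) < e / 2"
      "\<And>y. dist y x < d2 \<Longrightarrow> dist (D b a y) (D b a x) < e / 2"
      unfolding continuous_at_eps_delta using e by (metis half_gt_zero)
    obtain d3 where d3: "d3 > 0" "ball x d3 \<subseteq> S" using S openE by blast
    define d where "d = min d1 (min d2 d3)"
    \<comment> \<open>With this step the whole parallelogram spanned by \<open>s *\<^sub>R a\<close>
      and \<open>s *\<^sub>R b\<close> at \<open>x\<close> stays within distance \<open>d\<close>;
      the summand 1 keeps the denominator positive for \<open>a = b = 0\<close>.\<close>
    define s where "s = d / (norm a + norm b + 1)"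
    have n: "norm a + norm b + 1 > 0" by (simp add: add_nonneg_pos)
    have d0: "d > 0" using d d3 by (simp add: d_def)
    have s: "s > 0" using n d0 by (simp add: s_def)
    \<comment> \<open>The condition on the norms allows \<open>a, b\<close> to be inserted in either
      order, as the two applications of the mean value theorem require.\<close>
    have near: "dist (x + r *\<^sub>R a' + q *\<^sub>R b') x < d"
      if "0 \<le> r" "r \<le> s" "0 \<le> q" "q \<le> s" "norm a' + norm b' = norm a + norm b" for r q a' b'
    proof -
      have "dist (x + r *\<^sub>R a' + q *\<^sub>R b') x \<le> norm (r *\<^sub>R a') + norm (q *\<^sub>R b')"
        by (simp add: dist_norm add.assoc) (metis norm_triangle_ineq norm_scaleR)
      also have "\<dots> \<le> s * norm a' + s * norm b'"
        using that by (auto intro!: add_mono mult_right_mono)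
      also have "\<dots> = s * (norm a + norm b)"
        using that by (simp flip: distrib_left)
      also have "\<dots> < s * (norm a + norm b + 1)" using s by simp
      also have "\<dots> = d" using n by (simp add: s_def)
      finally show ?thesis .
    qed
    have inS: "x + r *\<^sub>R a' + q *\<^sub>R b' \<in> S"
      if "0 \<le> r" "r \<le> s" "0 \<le> q" "q \<le> s" "norm a' + norm b' = norm a + norm b" for r q a' b'
      using near[OF that] d3 by (auto simp: d_def dist_commute subset_eq)
    obtain r q where rq: "0 \<le> r" "r \<le> s" "0 \<le> q" "q \<le> s"
      "f (x + s *\<^sub>R a + s *\<^sub>R b) - f (x + s *\<^sub>R a) - f (x + s *\<^sub>R b) + f x = s * s * D a b (x + r *\<^sub>R a + q *\<^sub>R b)"
      using second_difference_mvt[OF s f, of x a b] inS unfolding D_def by auto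
    obtain r' q' where rq': "0 \<le> r'" "r' \<le> s" "0 \<le> q'" "q' \<le> s"
      "f (x + s *\<^sub>R b + s *\<^sub>R a) - f (x + s *\<^sub>R b) - f (x + s *\<^sub>R a) + f x = s * s * D b a (x + r' *\<^sub>R b + q' *\<^sub>R a)"
      using second_difference_mvt[OF s f, of x b a] inS[of _ _ b a] unfolding D_def by auto
    have "x + s *\<^sub>R b + s *\<^sub>R a = x + s *\<^sub>R a + s *\<^sub>R b" by simp
    then have "s * s * D a b (x + r *\<^sub>R a + q *\<^sub>R b) = s * s * D b a (x + r' *\<^sub>R b + q' *\<^sub>R a)"
      using rq(5) rq'(5) by (simp add: algebra_simps)
    then have "D a b (x + r *\<^sub>R a + q *\<^sub>R b) = D b a (x + r' *\<^sub>R b + q' *\<^sub>R a)"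
      using s by simp
    moreover have "dist (D a b (x + r *\<^sub>R a + q *\<^sub>R b)) (D a b x) < e / 2"
      using near[OF rq(1-4), of a b] d by (auto simp: d_def)
    moreover have "dist (D b a (x + r' *\<^sub>R b + q' *\<^sub>R a)) (D b a x) < e / 2"
      using near[OF rq'(1-4), of b a] d by (auto simp: d_def)
    ultimately show ?thesis by (simp add: dist_real_def abs_le_iff) argo
  qed
  then have "\<bar>D a b x - D b a x\<bar> \<le> 0" by (rule field_le_epsilon) simp
  then show ?thesis by (simp add: D_def)
qed

lemma second_derivative_symmetric:
  fixes f :: "'a::real_normed_vector \<Rightarrow> 'b::euclidean_space"
  assumes S: "open S" "x \<in> S" and f: "smooth_on S f"
  shows "frechet_derivative (\<lambda>y. frechet_derivative f (at y) a) (at x) b =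
    frechet_derivative (\<lambda>y. frechet_derivative f (at y) b) (at x) a"
proof (rule euclidean_eqI)
  fix i :: 'b assume "i \<in> Basis"
  have d: "frechet_derivative (\<lambda>y. g y \<bullet> i) (at y) v = frechet_derivative g (at y) v \<bullet> i"
    if "smooth_on S g" "y \<in> S" for g y v
    by (subst frechet_derivative_eqI[OF has_derivative_inner_left[OF smooth_on_has_derivative[OF that]]]) simp
  have e: "frechet_derivative (\<lambda>y. frechet_derivative f (at y) v \<bullet> i) (at x) w =
      frechet_derivative (\<lambda>y. frechet_derivative (\<lambda>y. f y \<bullet> i) (at y) v) (at x) w" for v w
    using frechet_derivative_cong_open[OF S, of "\<lambda>y. frechet_derivative f (at y) v \<bullet> i"
        "\<lambda>y. frechet_derivative (\<lambda>y. f y \<bullet> i) (at y) v"] d[OF f] by simp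
  have "smooth_on S (\<lambda>y. f y \<bullet> i)" by (intro smooth_on_inner S f smooth_on_const)
  from second_derivative_symmetric_real[OF S this, of a b]
  show "frechet_derivative (\<lambda>y. frechet_derivative f (at y) a) (at x) b \<bullet> i =
    frechet_derivative (\<lambda>y. frechet_derivative f (at y) b) (at x) a \<bullet> i"
    by (simp add: d[OF smooth_on_deriv[OF f] S(2), symmetric] e)
qed

text \<open>In \<open>W v w y\<close> the point comes last, as in \<open>form2_coord\<close>.\<close>

locale smooth_bilinear_field =
  fixes V :: "'e::euclidean_space set" and W :: "'e \<Rightarrow> 'e \<Rightarrow> 'e \<Rightarrow> real"
  assumes linear_left: "y \<in> V \<Longrightarrow> linear (\<lambda>v. W v w y)"
    and linear_right: "y \<in> V \<Longrightarrow> linear (\<lambda>w. W v w y)"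
    and smooth: "smooth_on V (W v w)"
begin

text \<open>Smoothness of \<open>W\<close> is known only for fixed vectors. The expansion moves
  varying vectors into scalar coefficients and leaves \<open>W i j\<close> with basis
  vectors.\<close>

lemma expansion:
  assumes "y \<in> V"
  shows "W v w y = (\<Sum>i\<in>Basis. \<Sum>j\<in>Basis. (v \<bullet> i) * ((w \<bullet> j) * W i j y))"
  using linear_basis_expansion[OF linear_left[OF assms], of v w]
    linear_basis_expansion[OF linear_right[OF assms], of _ w]
  by (simp add: sum_distrib_left)

lemma smooth_on_along:
  fixes g p q :: "'a::real_normed_vector \<Rightarrow> 'e"
  assumes T: "open T" and g: "smooth_on T g" "g ` T \<subseteq> V" and pq: "smooth_on T p" "smooth_on T q"
  shows "smooth_on T (\<lambda>z. W (p z) (q z) (g z))"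
proof (rule smooth_on_cong[OF T])
  show "smooth_on T (\<lambda>z. \<Sum>i\<in>Basis. \<Sum>j\<in>Basis. (p z \<bullet> i) * ((q z \<bullet> j) * W i j (g z)))"
    by (intro smooth_on_sum smooth_on_mult smooth_on_inner smooth_on_const T pq
        smooth_on_compose[OF T g(1) smooth g(2)])
qed (rule expansion[symmetric], use g in auto)

text \<open>A Leibniz rule with three sources of variation; in the last term the vectors are frozen
  at \<open>z\<close>. The basis expansion is differentiated once with frozen and once with moving
  vectors, and the two results are compared.\<close>

lemma has_derivative_along:
  fixes g p q :: "'a::real_normed_vector \<Rightarrow> 'e"
  assumes V: "open V" and T: "open T" "z \<in> T" and gV: "g ` T \<subseteq> V"
    and g: "(g has_derivative g') (at z)" and p: "(p has_derivative p') (at z)"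
    and q: "(q has_derivative q') (at z)"
  shows "((\<lambda>z. W (p z) (q z) (g z)) has_derivative
    (\<lambda>h. W (p' h) (q z) (g z) + W (p z) (q' h) (g z) +
      frechet_derivative (W (p z) (q z)) (at (g z)) (g' h))) (at z)"
proof -
  have gz: "g z \<in> V" using gV T by auto
  have eq: "(\<Sum>i\<in>Basis. \<Sum>j\<in>Basis. (p z \<bullet> i) * ((q z \<bullet> j) * W i j (g z))) = W (p z) (q z) (g z)" if "z \<in> T" for z
    by (rule expansion[symmetric]) (use gV that in auto)
  define D where "D i j = frechet_derivative (W i j) (at (g z))" for i j
  have D: "(W i j has_derivative D i j) (at (g z))" for i j
    unfolding D_def by (rule smooth_on_has_derivative[OF smooth gz])
  have "((\<lambda>y. \<Sum>i\<in>Basis. \<Sum>j\<in>Basis. (p z \<bullet> i) * ((q z \<bullet> j) * W i j y)) has_derivative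
     (\<lambda>h. \<Sum>i\<in>Basis. \<Sum>j\<in>Basis. (p z \<bullet> i) * ((q z \<bullet> j) * D i j h))) (at (g z))"
    by (intro has_derivative_sum has_derivative_mult_right D)
  then have "(W (p z) (q z) has_derivative
     (\<lambda>h. \<Sum>i\<in>Basis. \<Sum>j\<in>Basis. (p z \<bullet> i) * ((q z \<bullet> j) * D i j h))) (at (g z))"
    by (rule has_derivative_transform_within_open[OF _ V gz]) (rule expansion[symmetric])
  then have Dpq: "frechet_derivative (W (p z) (q z)) (at (g z)) =
     (\<lambda>h. \<Sum>i\<in>Basis. \<Sum>j\<in>Basis. (p z \<bullet> i) * ((q z \<bullet> j) * D i j h))"
    by (rule frechet_derivative_eqI)
  have Dg: "((\<lambda>z. W i j (g z)) has_derivative (\<lambda>h. D i j (g' h))) (at z)" for i j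
    by (rule has_derivative_compose[OF g D])
  have "((\<lambda>z. \<Sum>i\<in>Basis. \<Sum>j\<in>Basis. (p z \<bullet> i) * ((q z \<bullet> j) * W i j (g z))) has_derivative
    (\<lambda>h. \<Sum>i\<in>Basis. \<Sum>j\<in>Basis. (p z \<bullet> i) * ((q z \<bullet> j) * D i j (g' h) + (q' h \<bullet> j) * W i j (g z))
      + (p' h \<bullet> i) * ((q z \<bullet> j) * W i j (g z)))) (at z)"
    by (intro has_derivative_sum has_derivative_mult has_derivative_inner_left p q Dg)
  then have "((\<lambda>z. W (p z) (q z) (g z)) has_derivative
    (\<lambda>h. \<Sum>i\<in>Basis. \<Sum>j\<in>Basis. (p z \<bullet> i) * ((q z \<bullet> j) * D i j (g' h) + (q' h \<bullet> j) * W i j (g z))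
      + (p' h \<bullet> i) * ((q z \<bullet> j) * W i j (g z)))) (at z)"
    by (rule has_derivative_transform_within_open[OF _ T eq])
  then show ?thesis
    by (rule has_derivative_eq_rhs)
       (simp add: fun_eq_iff Dpq expansion[OF gz, of "p' _"] expansion[OF gz, of "p z" "q' _"] distrib_left sum.distrib)
qed

text \<open>The exterior derivative commutes with pullback. The six terms containing second
  derivatives of \<open>G\<close> cancel in pairs, by their symmetry and by skewness of
  \<open>W\<close>; what remains is the closedness identity of \<open>W\<close> on the image
  vectors.\<close>

lemma pullback_closed:
  fixes G :: "'a::real_normed_vector \<Rightarrow> 'e"
  assumes V: "open V" and T: "open T" and G: "smooth_on T G" "G ` T \<subseteq> V"
    and skew: "\<And>v w y. y \<in> V \<Longrightarrow> W v w y = - W w v y"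
    and closed: "\<And>v1 v2 v3 y. y \<in> V \<Longrightarrow> frechet_derivative (W v2 v3) (at y) v1
        - frechet_derivative (W v1 v3) (at y) v2 + frechet_derivative (W v1 v2) (at y) v3 = 0"
    and z: "z \<in> T"
  defines "L \<equiv> \<lambda>a b z. W (frechet_derivative G (at z) a) (frechet_derivative G (at z) b) (G z)"
  shows "frechet_derivative (L b c) (at z) a - frechet_derivative (L a c) (at z) b
    + frechet_derivative (L a b) (at z) c = 0"
proof -
  define D where "D v = frechet_derivative G (at z) v" for v
  define D2 where "D2 v w = frechet_derivative (\<lambda>z. frechet_derivative G (at z) v) (at z) w" for v w
  have Gz: "G z \<in> V" using G z by auto
  have sym: "D2 v w = D2 w v" for v w
    unfolding D2_def by (rule second_derivative_symmetric[OF T z G(1)])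
  have L: "frechet_derivative (L v w) (at z) h = W (D2 v h) (D w) (G z) + W (D v) (D2 w h) (G z)
      + frechet_derivative (W (D v) (D w)) (at (G z)) (D h)" for v w h
  proof -
    have "(L v w has_derivative (\<lambda>h. W (D2 v h) (D w) (G z) + W (D v) (D2 w h) (G z)
      + frechet_derivative (W (D v) (D w)) (at (G z)) (D h))) (at z)"
      unfolding L_def D_def D2_def
      by (intro has_derivative_along[OF V T z G(2)] smooth_on_has_derivative[OF _ z] smooth_on_deriv G)
    then show ?thesis by (simp add: frechet_derivative_eqI)
  qed
  have "W (D2 a b) (D c) (G z) = W (D2 b a) (D c) (G z)" "W (D2 a c) (D b) (G z) = W (D2 c a) (D b) (G z)"
    "W (D2 b c) (D a) (G z) = W (D2 c b) (D a) (G z)" by (simp_all add: sym)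
  then show ?thesis
    unfolding L using closed[OF Gz, of "D b" "D c" "D a"]
      skew[OF Gz, of "D b" "D2 c a"] skew[OF Gz, of "D a" "D2 c b"] skew[OF Gz, of "D a" "D2 b c"]
    by linarith
qed

end

text \<open>The integral of \<open>x \<mapsto> \<phi> (x + t v)\<close> over a large box does not depend on \<open>t\<close>; its derivative at
  \<open>t = 0\<close> is the integral in question.\<close>

lemma has_integral_derivative_compact_support:
  fixes \<phi> :: "'a::euclidean_space \<Rightarrow> real"
  assumes der: "\<And>x. (\<phi> has_derivative \<phi>' x) (at x)"
    and cont: "continuous_on UNIV (\<lambda>x. \<phi>' x v)"
    and K: "bounded K" "\<And>x. x \<notin> K \<Longrightarrow> \<phi> x = 0" "\<And>x. x \<notin> K \<Longrightarrow> \<phi>' x v = 0"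
  shows "((\<lambda>x. \<phi>' x v) has_integral 0) UNIV"
proof -
  obtain M where M: "\<And>x. x \<in> K \<Longrightarrow> norm x \<le> M" using K(1) by (auto simp: bounded_iff)
  have "norm (x - t *\<^sub>R v) \<le> M + norm v" if "x \<in> K" "t \<in> {-1..1}" for x t
  proof -
    have "norm (x - t *\<^sub>R v) \<le> norm x + \<bar>t\<bar> * norm v"
      by (metis norm_scaleR norm_triangle_ineq4)
    also have "\<dots> \<le> M + 1 * norm v"
      using that M by (intro add_mono mult_right_mono) auto
    finally show ?thesis by simp
  qed
  \<comment> \<open>A single box is to contain every translate of \<open>K\<close> by
    \<open>- t *\<^sub>R v\<close> with \<open>t\<close> in \<open>{-1..1}\<close>, so that all the
    shifted functions vanish outside the same box.\<close>
  then have "bounded ((\<lambda>(x, t). x - t *\<^sub>R v) ` (K \<times> {-1..1::real}))"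
    by (auto simp: bounded_iff intro!: exI[of _ "M + norm v"])
  then obtain a where a: "(\<lambda>(x, t). x - t *\<^sub>R v) ` (K \<times> {-1..1}) \<subseteq> cbox (-a) a"
    using bounded_subset_cbox_symmetric by metis
  have supp: "\<phi> (x + t *\<^sub>R v) = 0" if "x \<notin> cbox (-a) a" "t \<in> {-1..1}" for x t
  proof (rule K(2))
    show "x + t *\<^sub>R v \<notin> K"
    proof
      assume "x + t *\<^sub>R v \<in> K"
      then have "(x + t *\<^sub>R v) - t *\<^sub>R v \<in> cbox (-a) a" using a that(2) by force
      then show False using that(1) by simp
    qed
  qed
  have cphi: "continuous_on S \<phi>" for S
    by (intro continuous_at_imp_continuous_on ballI has_derivative_continuous[OF der])
  obtain I where I: "(\<phi> has_integral I) (cbox (-a) a)"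
    using integrable_continuous[OF cphi] unfolding integrable_on_def by blast
  have IU: "(\<phi> has_integral I) UNIV"
    by (rule has_integral_on_superset[OF I]) (use supp[of _ 0] in auto)
  have int: "((\<lambda>x. \<phi> (x + t *\<^sub>R v)) has_integral I) (cbox (-a) a)" if t: "t \<in> {-1<..<1}" for t
  proof -
    \<comment> \<open>The translate of the box of \<open>a\<close> is a different box, so the
      comparison runs through a larger one that contains both. Translating the larger box back still
      covers the box of \<open>a\<close>, outside of which the shifted function is 0.\<close>
    obtain b where b: "cbox (-a) a \<union> (\<lambda>x. x + t *\<^sub>R v) ` cbox (-a) a \<subseteq> cbox (-b) b"
    proof (rule bounded_subset_cbox_symmetric)
      show "bounded (cbox (-a) a \<union> (\<lambda>x. x + t *\<^sub>R v) ` cbox (-a) a)"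
        by (intro compact_imp_bounded compact_Un compact_continuous_image continuous_intros compact_cbox)
    qed
    have "(\<phi> has_integral I) (cbox (-b) b)"
      by (rule has_integral_on_superset[OF I]) (use supp[of _ 0] b in auto)
    from has_integral_affinity'[OF this, of 1 "t *\<^sub>R v"]
    have "((\<lambda>x. \<phi> (x + t *\<^sub>R v)) has_integral I) (cbox (-b - t *\<^sub>R v) (b - t *\<^sub>R v))" by simp
    moreover have "cbox (-a) a \<subseteq> cbox (-b - t *\<^sub>R v) (b - t *\<^sub>R v)"
    proof
      fix x assume "x \<in> cbox (-a) a"
      then have "x + t *\<^sub>R v \<in> cbox (-b) b" using b by auto
      then show "x \<in> cbox (-b - t *\<^sub>R v) (b - t *\<^sub>R v)" by (auto simp: mem_box algebra_simps)
    qed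
    moreover have "(if x \<in> cbox (-a) a then \<phi> (x + t *\<^sub>R v) else 0) = \<phi> (x + t *\<^sub>R v)" for x
      using supp[of x t] t by auto
    ultimately show ?thesis
      by (subst has_integral_restrict[symmetric, of _ "cbox (-b - t *\<^sub>R v) (b - t *\<^sub>R v)"]) simp_all
  qed
  have "((\<lambda>t. integral (cbox (-a) a) (\<lambda>x. \<phi> (x + t *\<^sub>R v))) has_vector_derivative
      integral (cbox (-a) a) (\<lambda>x. \<phi>' (x + 0 *\<^sub>R v) v)) (at 0 within {-1<..<1})"
  proof (rule leibniz_rule_vector_derivative)
    fix t :: real and x
    show "((\<lambda>t. \<phi> (x + t *\<^sub>R v)) has_vector_derivative \<phi>' (x + t *\<^sub>R v) v) (at t within {-1<..<1})"
      using real_derivative_along_line[of \<phi> x t v] der[of "x + t *\<^sub>R v"] frechet_derivative_eqI[OF der]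
      by (auto simp: differentiable_def has_real_derivative_iff_has_vector_derivative intro: has_vector_derivative_at_within)
    show "(\<lambda>x. \<phi> (x + t *\<^sub>R v)) integrable_on cbox (-a) a"
      by (intro integrable_continuous continuous_on_compose2[OF cphi[of UNIV]] continuous_intros) auto
    show "continuous_on ({-1<..<1} \<times> cbox (-a) a) (\<lambda>(t, x). \<phi>' (x + t *\<^sub>R v) v)"
      unfolding case_prod_unfold
      by (intro continuous_on_compose2[OF cont] continuous_intros) auto
  qed auto
  then have "((\<lambda>t. integral (cbox (-a) a) (\<lambda>x. \<phi> (x + t *\<^sub>R v))) has_vector_derivative
      integral (cbox (-a) a) (\<lambda>x. \<phi>' x v)) (at 0)"
    by (simp add: at_within_open[of 0 "{-1<..<1::real}"])
  moreover have "((\<lambda>t. integral (cbox (-a) a) (\<lambda>x. \<phi> (x + t *\<^sub>R v))) has_vector_derivative 0) (at 0)"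
    by (rule has_vector_derivative_transform_within_open[of "\<lambda>_. I" _ _ "{-1<..<1}"])
       (use integral_unique[OF int] in auto)
  ultimately have "integral (cbox (-a) a) (\<lambda>x. \<phi>' x v) = 0"
    by (rule vector_derivative_unique_at)
  then have "((\<lambda>x. \<phi>' x v) has_integral 0) (cbox (-a) a)"
    using integrable_integral[OF integrable_continuous[OF continuous_on_subset[OF cont subset_UNIV]], of "-a" a] by simp
  then show ?thesis
  proof (rule has_integral_on_superset)
    fix x assume x: "x \<notin> cbox (-a) a"
    have "x \<in> cbox (-a) a" if "x \<in> K"
      using subsetD[OF a, of "x - 0 *\<^sub>R v"] that by (force intro: image_eqI[of _ _ "(x, 0)"])
    then have "x \<notin> K" using x by blast
    then show "\<phi>' x v = 0" by (rule K(3))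
  qed auto
qed

section \<open>Charts and tangent vectors\<close>

lemma frechet_derivative_chain:
  assumes "g differentiable (at x)" "f differentiable (at (g x))"
    and "open S" "x \<in> S" "\<And>y. y \<in> S \<Longrightarrow> h y = f (g y)"
  shows "frechet_derivative h (at x) v = frechet_derivative f (at (g x)) (frechet_derivative g (at x) v)"
    and "h differentiable (at x)"
proof -
  have "((\<lambda>y. f (g y)) has_derivative
      (\<lambda>v. frechet_derivative f (at (g x)) (frechet_derivative g (at x) v))) (at x)"
    using has_derivative_compose[OF differentiableD[OF assms(1)] differentiableD[OF assms(2)]] .
  then have "(h has_derivative
      (\<lambda>v. frechet_derivative f (at (g x)) (frechet_derivative g (at x) v))) (at x)"
    by (rule has_derivative_transform_within_open[OF _ assms(3,4)]) (use assms(5) in auto)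
  then show "frechet_derivative h (at x) v = frechet_derivative f (at (g x)) (frechet_derivative g (at x) v)"
    and "h differentiable (at x)"
    by (simp_all add: frechet_derivative_eqI differentiable_def) blast
qed

locale atlas =
  fixes A :: "('m::topological_space, 'e::euclidean_space) atlas"
  assumes smooth_atlas: "smooth_atlas A"
begin

lemma chart_open: "c \<in> A \<Longrightarrow> open (fst c)" "c \<in> A \<Longrightarrow> open (snd c ` fst c)"
  using smooth_atlas unfolding smooth_atlas_def by auto

lemma chart_homeomorphism: "c \<in> A \<Longrightarrow> homeomorphism (fst c) (snd c ` fst c) (snd c) (inv_chart c)"
  using smooth_atlas unfolding smooth_atlas_def by auto

lemma inv_chart_chart [simp]: "c \<in> A \<Longrightarrow> x \<in> fst c \<Longrightarrow> inv_chart c (snd c x) = x"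
  using chart_homeomorphism by (simp add: homeomorphism_def)

lemma chart_covers: "\<exists>c. c \<in> A \<and> x \<in> fst c"
  using smooth_atlas unfolding smooth_atlas_def by blast

lemma chart_at: "chart_at A x \<in> A" "x \<in> fst (chart_at A x)"
  using someI_ex[OF chart_covers[of x]] unfolding chart_at_def by blast+

lemma chart_image_open:
  assumes "c \<in> A" "open U"
  shows "open (snd c ` (fst c \<inter> U))"
proof -
  have "openin (top_of_set (snd c ` fst c)) (snd c ` (fst c \<inter> U))"
    using homeomorphism_imp_open_map[OF chart_homeomorphism[OF assms(1)]] assms(2)
    by (metis openin_open Int_commute)
  then show ?thesis using openin_open_trans chart_open(2)[OF assms(1)] by blast
qed

lemma transition_chart [simp]: "c \<in> A \<Longrightarrow> x \<in> fst c \<Longrightarrow> transition c d (snd c x) = snd d x"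
  by (simp add: transition_def)

lemma transition_smooth: "c \<in> A \<Longrightarrow> d \<in> A \<Longrightarrow> smooth_on (snd c ` (fst c \<inter> fst d)) (transition c d)"
  using smooth_atlas unfolding smooth_atlas_def by blast

lemma transition_differentiable:
  "c \<in> A \<Longrightarrow> d \<in> A \<Longrightarrow> x \<in> fst c \<Longrightarrow> x \<in> fst d \<Longrightarrow> transition c d differentiable (at (snd c x))"
  by (rule smooth_on_imp_differentiable[OF transition_smooth]) auto

text \<open>Near the point, \<open>k \<circ> inv_chart c\<close> factors through
  \<open>transition c d\<close>. With \<open>k\<close> a coordinate map this is the cocycle rule for
  transition maps; for other \<open>k\<close> it gives the independence of differentials from the
  chart in which they are computed.\<close>

lemma derivative_change_chart:
  fixes k :: "'m \<Rightarrow> 'b::real_normed_vector"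
  assumes cd: "c \<in> A" "d \<in> A" "x \<in> fst c" "x \<in> fst d"
    and k: "(k \<circ> inv_chart d) differentiable (at (snd d x))"
  shows "frechet_derivative (k \<circ> inv_chart c) (at (snd c x)) v =
      frechet_derivative (k \<circ> inv_chart d) (at (snd d x)) (frechet_derivative (transition c d) (at (snd c x)) v)"
    and "(k \<circ> inv_chart c) differentiable (at (snd c x))"
proof -
  have "(k \<circ> inv_chart d) differentiable (at (transition c d (snd c x)))"
    using k cd by simp
  moreover have "snd c x \<in> snd c ` (fst c \<inter> fst d)" using cd by blast
  moreover have "(k \<circ> inv_chart c) y = (k \<circ> inv_chart d) (transition c d y)"
    if "y \<in> snd c ` (fst c \<inter> fst d)" for y
    using that cd by auto
  ultimately have "frechet_derivative (k \<circ> inv_chart c) (at (snd c x)) v =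
      frechet_derivative (k \<circ> inv_chart d) (at (transition c d (snd c x))) (frechet_derivative (transition c d) (at (snd c x)) v)"
    and *: "(k \<circ> inv_chart c) differentiable (at (snd c x))"
    using frechet_derivative_chain[OF transition_differentiable[OF cd], of "k \<circ> inv_chart d"]
      chart_image_open[OF cd(1) chart_open(1)[OF cd(2)]] by blast+
  then show "frechet_derivative (k \<circ> inv_chart c) (at (snd c x)) v =
      frechet_derivative (k \<circ> inv_chart d) (at (snd d x)) (frechet_derivative (transition c d) (at (snd c x)) v)"
    by (simp only: transition_chart[OF cd(1,3)])
  show "(k \<circ> inv_chart c) differentiable (at (snd c x))" by (rule *)
qed

lemma transition_derivative_trans:
  assumes "c \<in> A" "d \<in> A" "e \<in> A" "x \<in> fst c" "x \<in> fst d" "x \<in> fst e"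
  shows "frechet_derivative (transition c e) (at (snd c x)) v =
    frechet_derivative (transition d e) (at (snd d x)) (frechet_derivative (transition c d) (at (snd c x)) v)"
  using derivative_change_chart(1)[of c d x "snd e"] transition_differentiable[of d e x] assms
  unfolding transition_def by blast

lemma transition_derivative_same:
  assumes "c \<in> A" "x \<in> fst c"
  shows "frechet_derivative (transition c c) (at (snd c x)) v = v"
proof -
  have "frechet_derivative (transition c c) (at (snd c x)) = frechet_derivative (\<lambda>y. y) (at (snd c x))"
    by (rule frechet_derivative_cong_open[OF chart_open(2)[OF assms(1)]]) (use assms in auto)
  then show ?thesis by simp
qed

lemma transition_derivative_linear:
  "c \<in> A \<Longrightarrow> d \<in> A \<Longrightarrow> x \<in> fst c \<Longrightarrow> x \<in> fst d \<Longrightarrow>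
    linear (frechet_derivative (transition c d) (at (snd c x)))"
  by (rule linear_frechet_derivative[OF transition_differentiable])

lemma chart_vector_in_tangent_space:
  assumes "c \<in> A" "x \<in> fst c"
  shows "chart_vector A c x v \<in> tangent_space A x"
  unfolding tangent_space_def
proof (intro CollectI conjI allI ballI impI)
  fix d e assume de: "d \<in> A" "e \<in> A" "x \<in> fst d \<inter> fst e"
  then show "chart_vector A c x v e = frechet_derivative (transition d e) (at (snd d x)) (chart_vector A c x v d)"
    using transition_derivative_trans[OF assms(1) de(1,2) assms(2), of v] by (simp add: chart_vector_def)
qed (auto simp: chart_vector_def)

lemma chart_vector_coordinate: "c \<in> A \<Longrightarrow> x \<in> fst c \<Longrightarrow> chart_vector A c x v c = v"
  by (simp add: chart_vector_def transition_derivative_same)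

text \<open>The compatibility condition recovers the whole family from one entry. Together with
  \<open>chart_vector_coordinate\<close> this identifies \<open>tangent_space A x\<close> with the
  coordinate space, so tangent vectors may always be taken to be chart vectors.\<close>

lemma chart_vector_of_tangent:
  assumes "c \<in> A" "x \<in> fst c" "X \<in> tangent_space A x"
  shows "chart_vector A c x (X c) = X"
proof
  fix d
  have "X d = 0" if "d \<notin> A \<or> x \<notin> fst d"
    using assms(3) that unfolding tangent_space_def by blast
  moreover have "X d = frechet_derivative (transition c d) (at (snd c x)) (X c)" if "d \<in> A" "x \<in> fst d"
    using assms that unfolding tangent_space_def by blast
  ultimately show "chart_vector A c x (X c) d = X d"
    unfolding chart_vector_def by (metis (full_types))
qed

lemma chart_vector_change:
  assumes "c \<in> A" "d \<in> A" "x \<in> fst c" "x \<in> fst d"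
  shows "chart_vector A c x v = chart_vector A d x (frechet_derivative (transition c d) (at (snd c x)) v)"
proof
  fix e
  show "chart_vector A c x v e = chart_vector A d x (frechet_derivative (transition c d) (at (snd c x)) v) e"
    using transition_derivative_trans[OF assms(1,2) _ assms(3,4), of e v] by (simp add: chart_vector_def)
qed

lemma chart_vector_combination:
  assumes "c \<in> A" "x \<in> fst c"
  shows "chart_vector A c x (a *\<^sub>R v + b *\<^sub>R w) = (\<lambda>d. a *\<^sub>R chart_vector A c x v d + b *\<^sub>R chart_vector A c x w d)"
proof
  fix d
  show "chart_vector A c x (a *\<^sub>R v + b *\<^sub>R w) d = a *\<^sub>R chart_vector A c x v d + b *\<^sub>R chart_vector A c x w d"
  proof (cases "d \<in> A \<and> x \<in> fst d")
    case True
    then have "linear (frechet_derivative (transition c d) (at (snd c x)))"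
      using transition_derivative_linear assms by blast
    from linear_add[OF this] linear_scale[OF this] show ?thesis using True by (simp add: chart_vector_def)
  qed (auto simp: chart_vector_def)
qed

lemma tangent_space_combination:
  assumes "X \<in> tangent_space A x" "Y \<in> tangent_space A x"
  shows "(\<lambda>c. a *\<^sub>R X c + b *\<^sub>R Y c) \<in> tangent_space A x"
proof -
  obtain c where c: "c \<in> A" "x \<in> fst c" using chart_covers by blast
  then show ?thesis
    using chart_vector_of_tangent[OF c assms(1)] chart_vector_of_tangent[OF c assms(2)]
      chart_vector_combination[OF c, of a "X c" b "Y c"] chart_vector_in_tangent_space[OF c]
    by metis
qed

lemma fun_differential_chart:
  assumes h: "smooth_fun A h" and c: "c \<in> A" "x \<in> fst c"
  shows "fun_differential A h x (chart_vector A c x v) = frechet_derivative (h \<circ> inv_chart c) (at (snd c x)) v"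
proof -
  let ?d = "chart_at A x"
  have "(h \<circ> inv_chart ?d) differentiable (at (snd ?d x))"
    using h chart_at[of x] unfolding smooth_fun_def by (blast intro: smooth_on_imp_differentiable)
  from derivative_change_chart(1)[OF c(1) chart_at(1) c(2) chart_at(2) this]
  show ?thesis
    using chart_at[of x] by (simp add: fun_differential_def chart_vector_def Let_def)
qed

end

text \<open>\<open>tangent_map\<close> is computed in the chart picked by \<open>chart_at\<close>.
  Two chain rules, one in the source and one in the target, carry the formula to any pair of
  charts.\<close>

lemma tangent_map_chart:
  fixes f :: "'s::topological_space \<Rightarrow> 'm::topological_space"
    and A :: "('s, 'd::euclidean_space) atlas" and B :: "('m, 'e::euclidean_space) atlas"
  assumes A: "smooth_atlas A" and B: "smooth_atlas B" and f: "smooth_map A B f"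
    and c: "c \<in> A" "x \<in> fst c" and d: "d \<in> B" "f x \<in> fst d"
  shows "tangent_map A B f x (chart_vector A c x v) =
    chart_vector B d (f x) (frechet_derivative (snd d \<circ> f \<circ> inv_chart c) (at (snd c x)) v)"
proof
  fix e
  interpret A: atlas A by unfold_locales fact
  interpret B: atlas B by unfold_locales fact
  let ?c = "chart_at A x"
  have fd: "(snd e \<circ> f \<circ> inv_chart c) differentiable (at (snd c x))"
    if "c \<in> A" "x \<in> fst c" "e \<in> B" "f x \<in> fst e" for c e
    using f that unfolding smooth_map_def by (intro smooth_on_imp_differentiable) auto
  show "tangent_map A B f x (chart_vector A c x v) e =
    chart_vector B d (f x) (frechet_derivative (snd d \<circ> f \<circ> inv_chart c) (at (snd c x)) v) e"
  proof (cases "e \<in> B \<and> f x \<in> fst e")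
    case False
    then show ?thesis by (auto simp: tangent_map_def chart_vector_def Let_def)
  next
    case True
    have "continuous_on UNIV f" using f by (simp add: smooth_map_def)
    then have o: "open (f -` (fst d \<inter> fst e))"
      using B.chart_open True d by (intro open_vimage open_Int) auto
    have "tangent_map A B f x (chart_vector A c x v) e =
        frechet_derivative ((snd e \<circ> f) \<circ> inv_chart c) (at (snd c x)) v"
      using A.derivative_change_chart(1)[OF c(1) A.chart_at(1) c(2) A.chart_at(2), of "snd e \<circ> f"]
        fd[OF A.chart_at] True A.chart_at c
      by (simp add: tangent_map_def Let_def chart_vector_def comp_assoc)
    also have "\<dots> = frechet_derivative (transition d e) (at ((snd d \<circ> f \<circ> inv_chart c) (snd c x)))
        (frechet_derivative (snd d \<circ> f \<circ> inv_chart c) (at (snd c x)) v)"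
    proof (rule frechet_derivative_chain(1)[OF fd[OF c d] _ A.chart_image_open[OF c(1) o]])
      show "transition d e differentiable (at ((snd d \<circ> f \<circ> inv_chart c) (snd c x)))"
        using B.transition_differentiable[of d e "f x"] True d c by simp
      show "snd c x \<in> snd c ` (fst c \<inter> f -` (fst d \<inter> fst e))" using c d True by auto
      fix y assume "y \<in> snd c ` (fst c \<inter> f -` (fst d \<inter> fst e))"
      then show "(snd e \<circ> f \<circ> inv_chart c) y = transition d e ((snd d \<circ> f \<circ> inv_chart c) y)"
        using c d by auto
    qed
    finally show ?thesis using True c by (simp add: chart_vector_def)
  qed
qed

lemma velocity_chart:
  fixes \<gamma> :: "real \<Rightarrow> 'm::topological_space" and B :: "('m, 'e::euclidean_space) atlas"
  assumes B: "smooth_atlas B" and \<gamma>: "continuous_on UNIV \<gamma>" and d: "d \<in> B" "\<gamma> 0 \<in> fst d"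
    and w: "((snd d \<circ> \<gamma>) has_vector_derivative w) (at 0)"
  shows "velocity B \<gamma> = chart_vector B d (\<gamma> 0) w"
proof
  fix e
  interpret B: atlas B by unfold_locales fact
  show "velocity B \<gamma> e = chart_vector B d (\<gamma> 0) w e"
  proof (cases "e \<in> B \<and> \<gamma> 0 \<in> fst e")
    case True
    have o: "open (\<gamma> -` (fst d \<inter> fst e))"
      using B.chart_open True d \<gamma> by (intro open_vimage open_Int) auto
    have lin: "linear (frechet_derivative (transition d e) (at (snd d (\<gamma> 0))))"
      using B.transition_derivative_linear d True by blast
    have "(transition d e has_derivative frechet_derivative (transition d e) (at (snd d (\<gamma> 0))))
        (at ((snd d \<circ> \<gamma>) 0))"
      using B.transition_differentiable d True by (simp add: differentiableD)
    from has_derivative_compose[OF w[unfolded has_vector_derivative_def] this]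
    have "((\<lambda>t. transition d e ((snd d \<circ> \<gamma>) t)) has_vector_derivative
        frechet_derivative (transition d e) (at (snd d (\<gamma> 0))) w) (at 0)"
      by (simp only: has_vector_derivative_def linear_scale[OF lin])
    then have "((snd e \<circ> \<gamma>) has_vector_derivative
        frechet_derivative (transition d e) (at (snd d (\<gamma> 0))) w) (at 0)"
      by (rule has_vector_derivative_transform_within_open[OF _ o]) (use d True in auto)
    then show ?thesis
      using True by (simp add: velocity_def chart_vector_def vector_derivative_at)
  qed (auto simp: velocity_def chart_vector_def)
qed

section \<open>Alternating 2-forms in a chart\<close>

text \<open>The algebraic half of \<open>smooth_form2\<close>; it is what the transformation of a
  coefficient under a change of charts depends on.\<close>

definition alternating_form2 :: "('m::topological_space, 'e::euclidean_space) atlas \<Rightarrow> ('m, 'e) form2 \<Rightarrow> bool" where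
  "alternating_form2 A \<alpha> \<longleftrightarrow>
     (\<forall>p. \<forall>X\<in>tangent_space A p. \<forall>Y\<in>tangent_space A p. \<forall>Z\<in>tangent_space A p. \<forall>a b.
        \<alpha> p (\<lambda>c. a *\<^sub>R X c + b *\<^sub>R Y c) Z = a * \<alpha> p X Z + b * \<alpha> p Y Z \<and> \<alpha> p X Y = - \<alpha> p Y X)"

lemma smooth_form2_alternating: "smooth_form2 A \<alpha> \<Longrightarrow> alternating_form2 A \<alpha>"
  unfolding smooth_form2_def alternating_form2_def by (rule conjunct1)

context atlas
begin

lemma form2_coord_chart:
  "c \<in> A \<Longrightarrow> x \<in> fst c \<Longrightarrow>
    form2_coord A \<alpha> c v w (snd c x) = \<alpha> x (chart_vector A c x v) (chart_vector A c x w)"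
  by (simp add: form2_coord_def Let_def)

lemma form2_coord_skew:
  assumes "alternating_form2 A \<alpha>" "c \<in> A" "y \<in> snd c ` fst c"
  shows "form2_coord A \<alpha> c v w y = - form2_coord A \<alpha> c w v y"
proof -
  obtain x where x: "x \<in> fst c" "y = snd c x" using assms(3) by auto
  have "\<alpha> x X Y = - \<alpha> x Y X" if "X \<in> tangent_space A x" "Y \<in> tangent_space A x" for X Y
    using assms(1) that unfolding alternating_form2_def by blast
  then show ?thesis
    unfolding x(2) form2_coord_chart[OF assms(2) x(1)]
    using chart_vector_in_tangent_space[OF assms(2) x(1)] by blast
qed

lemma form2_coord_linear:
  assumes \<alpha>: "alternating_form2 A \<alpha>" and c: "c \<in> A" and y: "y \<in> snd c ` fst c"
  shows "linear (\<lambda>v. form2_coord A \<alpha> c v w y)" "linear (\<lambda>v. form2_coord A \<alpha> c w v y)"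
proof -
  obtain x where x: "x \<in> fst c" "y = snd c x" using y by auto
  have comb: "form2_coord A \<alpha> c (a *\<^sub>R v1 + b *\<^sub>R v2) w y =
      a * form2_coord A \<alpha> c v1 w y + b * form2_coord A \<alpha> c v2 w y" for a b v1 v2 w
    using \<alpha> chart_vector_in_tangent_space[OF c x(1)] chart_vector_combination[OF c x(1)]
    unfolding alternating_form2_def x(2) form2_coord_chart[OF c x(1)] by simp
  show l: "linear (\<lambda>v. form2_coord A \<alpha> c v w y)" for w
  proof (rule linearI)
    show "form2_coord A \<alpha> c (v1 + v2) w y = form2_coord A \<alpha> c v1 w y + form2_coord A \<alpha> c v2 w y" for v1 v2
      using comb[of 1 v1 1 v2 w] by simp
    show "form2_coord A \<alpha> c (a *\<^sub>R v1) w y = a *\<^sub>R form2_coord A \<alpha> c v1 w y" for a v1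
      using comb[of a v1 0 0 w] by simp
  qed
  have "linear (\<lambda>v. - form2_coord A \<alpha> c v w y)"
    using linear_compose_neg[OF l[of w]] .
  moreover have "(\<lambda>v. - form2_coord A \<alpha> c v w y) = (\<lambda>v. form2_coord A \<alpha> c w v y)"
    using form2_coord_skew[OF \<alpha> c y] by (metis (full_types))
  ultimately show "linear (\<lambda>v. form2_coord A \<alpha> c w v y)" by simp
qed

lemma smooth_form2_field:
  assumes "smooth_form2 A \<alpha>" "c \<in> A"
  shows "smooth_bilinear_field (snd c ` fst c) (form2_coord A \<alpha> c)"
proof (rule smooth_bilinear_field.intro)
  show "smooth_on (snd c ` fst c) (form2_coord A \<alpha> c v w)" for v w
    using assms unfolding smooth_form2_def by blast
qed (use form2_coord_linear[OF smooth_form2_alternating[OF assms(1)] assms(2)] in blast)+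

end

section \<open>A curve of maps in local coordinates\<close>

locale curve_of_maps = A: atlas A + B: atlas B
  for A :: "('s::topological_space, 'd::euclidean_space) atlas"
    and B :: "('m::topological_space, 'e::euclidean_space) atlas" +
  fixes F :: "real \<Rightarrow> 's \<Rightarrow> 'm"
  assumes smooth_F: "smooth_map (cylinder_atlas A) B (case_prod F)"
    and smooth_at: "smooth_map A B (F t)"
begin

definition local_domain :: "('s, 'd) chart \<Rightarrow> ('m, 'e) chart \<Rightarrow> (real \<times> 'd) set" where
  "local_domain c d = {(t, y). y \<in> snd c ` fst c \<and> F t (inv_chart c y) \<in> fst d}"

text \<open>With time as an additional coordinate, the velocity is the derivative in direction
  \<open>(1, 0)\<close> and the tangent map of a slice the derivative in directions
  \<open>(0, v)\<close>. Both are thus partial derivatives of one smooth map on an open set.\<close>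

definition local_map :: "('s, 'd) chart \<Rightarrow> ('m, 'e) chart \<Rightarrow> real \<times> 'd \<Rightarrow> 'e" where
  "local_map c d = (\<lambda>(t, y). snd d (F t (inv_chart c y)))"

lemma local_domainI: "c \<in> A \<Longrightarrow> x \<in> fst c \<Longrightarrow> F t x \<in> fst d \<Longrightarrow> (t, snd c x) \<in> local_domain c d"
  by (auto simp: local_domain_def)

lemma local_mem: "c \<in> A \<Longrightarrow> (t, snd c x) \<in> local_domain c d \<Longrightarrow> x \<in> fst c \<Longrightarrow> F t x \<in> fst d"
  by (auto simp: local_domain_def)

lemma local_domain_open:
  assumes c: "c \<in> A" and d: "d \<in> B"
  shows "open (local_domain c d)"
proof -
  have "continuous_on UNIV (case_prod F)" using smooth_F by (simp add: smooth_map_def)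
  moreover have "continuous_on (snd c ` fst c) (inv_chart c)"
    using A.chart_homeomorphism[OF c] by (simp add: homeomorphism_def)
  then have "continuous_on (UNIV \<times> snd c ` fst c) (\<lambda>p :: real \<times> 'd. inv_chart c (snd p))"
    by (rule continuous_on_compose2) (auto intro: continuous_on_snd continuous_on_id)
  then have "continuous_on (UNIV \<times> snd c ` fst c) (\<lambda>p. (fst p :: real, inv_chart c (snd p)))"
    by (intro continuous_on_Pair continuous_on_fst continuous_on_id)
  ultimately have "continuous_on (UNIV \<times> snd c ` fst c) (\<lambda>p. case_prod F (fst p :: real, inv_chart c (snd p)))"
    by (rule continuous_on_compose2) auto
  then have "open ((\<lambda>p. case_prod F (fst p :: real, inv_chart c (snd p))) -` fst d \<inter> (UNIV \<times> snd c ` fst c))"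
    using continuous_on_open_vimage[OF open_Times[OF open_UNIV A.chart_open(2)[OF c]]] B.chart_open(1)[OF d] by blast
  also have "((\<lambda>p. case_prod F (fst p :: real, inv_chart c (snd p))) -` fst d \<inter> (UNIV \<times> snd c ` fst c)) = local_domain c d"
    by (auto simp: local_domain_def)
  finally show ?thesis .
qed

lemma local_map_smooth:
  assumes c: "c \<in> A" and d: "d \<in> B"
  shows "smooth_on (local_domain c d) (local_map c d)"
proof -
  define c' :: "(real \<times> 's, real \<times> 'd) chart" where "c' = (UNIV \<times> fst c, map_prod id (snd c))"
  have "c' \<in> cylinder_atlas A" using c by (auto simp: c'_def cylinder_atlas_def)
  then have s: "smooth_on (snd c' ` (fst c' \<inter> case_prod F -` fst d)) (snd d \<circ> case_prod F \<circ> inv_chart c')"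
    using smooth_F d by (simp add: smooth_map_def)
  \<comment> \<open>\<open>inv_chart c'\<close> is an \<open>inv_into\<close> on the product;
    injectivity is what makes it split into the identity in time and \<open>inv_chart c\<close> in
    space.\<close>
  have "inj_on (snd c) (fst c)" by (metis inj_on_inverseI A.inv_chart_chart[OF c])
  then have "inj_on (snd c') (fst c')" by (auto simp: c'_def inj_on_def)
  from inv_into_f_f[OF this]
  have inv: "inv_chart c' (t, snd c x) = (t, x)" if "x \<in> fst c" for t x
    using that unfolding inv_chart_def c'_def by fastforce
  have "snd c' ` (fst c' \<inter> case_prod F -` fst d) = local_domain c d"
    using c by (auto simp: c'_def local_domain_def image_iff) force
  moreover have "(snd d \<circ> case_prod F \<circ> inv_chart c') z = local_map c d z" if "z \<in> local_domain c d" for z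
    using that c inv by (auto simp: local_domain_def local_map_def)
  ultimately show ?thesis
    using smooth_on_cong[OF local_domain_open[OF c d]] s by metis
qed

lemma local_map_has_derivative:
  assumes "c \<in> A" "d \<in> B" "x \<in> fst c" "F t x \<in> fst d"
  shows "(local_map c d has_derivative frechet_derivative (local_map c d) (at (t, snd c x))) (at (t, snd c x))"
  using smooth_on_has_derivative[OF local_map_smooth local_domainI] assms by blast

lemma tangent_map_local:
  assumes "c \<in> A" "d \<in> B" "x \<in> fst c" "F t x \<in> fst d"
  shows "tangent_map A B (F t) x (chart_vector A c x v) =
    chart_vector B d (F t x) (frechet_derivative (local_map c d) (at (t, snd c x)) (0, v))"
proof -
  have "((\<lambda>y. (t, y)) has_derivative (\<lambda>v. (0, v))) (at (snd c x))"
    by (auto intro!: derivative_eq_intros)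
  from has_derivative_compose[OF this local_map_has_derivative[OF assms]]
  have "((snd d \<circ> F t \<circ> inv_chart c) has_derivative
      (\<lambda>v. frechet_derivative (local_map c d) (at (t, snd c x)) (0, v))) (at (snd c x))"
    by (simp add: local_map_def comp_def)
  from frechet_derivative_eqI[OF this] show ?thesis
    using tangent_map_chart[OF A.smooth_atlas B.smooth_atlas smooth_at assms(1,3,2,4)] by simp
qed

lemma velocity_local:
  assumes "c \<in> A" "d \<in> B" "x \<in> fst c" "F 0 x \<in> fst d"
  shows "velocity B (\<lambda>t. F t x) =
    chart_vector B d (F 0 x) (frechet_derivative (local_map c d) (at (0, snd c x)) (1, 0))"
proof (rule velocity_chart[where \<gamma> = "\<lambda>t. F t x", OF B.smooth_atlas _ assms(2,4)])
  have "continuous_on UNIV (case_prod F)" using smooth_F by (simp add: smooth_map_def)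
  then have "continuous_on UNIV (\<lambda>t. case_prod F (t, x))"
    by (rule continuous_on_compose2) (auto intro!: continuous_intros)
  then show "continuous_on UNIV (\<lambda>t. F t x)" by simp
  let ?D = "frechet_derivative (local_map c d) (at (0, snd c x))"
  have "((\<lambda>t. (t, snd c x)) has_derivative (\<lambda>h. (h, 0))) (at 0)"
    by (auto intro!: derivative_eq_intros)
  from has_derivative_compose[OF this local_map_has_derivative[OF assms]]
  have "((\<lambda>t. local_map c d (t, snd c x)) has_derivative (\<lambda>h. ?D (h, 0))) (at 0)" .
  moreover have "?D (h, 0) = h *\<^sub>R ?D (1, 0)" for h
    using linear_scale[OF has_derivative_linear[OF local_map_has_derivative[OF assms]], of h "(1, 0)"] by simp
  then have "(\<lambda>h. ?D (h, 0)) = (\<lambda>h. h *\<^sub>R ?D (1, 0))" by (rule ext)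
  moreover have "(\<lambda>t. local_map c d (t, snd c x)) = snd d \<circ> (\<lambda>t. F t x)"
    using assms by (simp add: local_map_def fun_eq_iff)
  ultimately show "((snd d \<circ> (\<lambda>t. F t x)) has_vector_derivative ?D (1, 0)) (at 0)"
    unfolding has_vector_derivative_def by (simp only:)
qed

end

section \<open>Closed 1-forms from curves of symplectic maps\<close>

definition form1_coord :: "('m::topological_space, 'e::euclidean_space) atlas \<Rightarrow> ('m, 'e) form1 \<Rightarrow> ('m, 'e) chart \<Rightarrow>
     'e \<Rightarrow> 'e \<Rightarrow> real" where
  "form1_coord A \<alpha> c v y = \<alpha> (inv_chart c y) (chart_vector A c (inv_chart c y) v)"

definition linear_form1 :: "('m::topological_space, 'e::euclidean_space) atlas \<Rightarrow> ('m, 'e) form1 \<Rightarrow> bool" where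
  "linear_form1 A \<alpha> \<longleftrightarrow> (\<forall>p. \<forall>X\<in>tangent_space A p. \<forall>Y\<in>tangent_space A p. \<forall>a b.
     \<alpha> p (\<lambda>c. a *\<^sub>R X c + b *\<^sub>R Y c) = a * \<alpha> p X + b * \<alpha> p Y)"

text \<open>The last clause is d\<alpha> = 0 on constant coordinate fields. Linearity and smoothness
  are included because a \<open>form1\<close> is an arbitrary family of functions.\<close>

definition closed_form1 :: "('m::topological_space, 'e::euclidean_space) atlas \<Rightarrow> ('m, 'e) form1 \<Rightarrow> bool" where
  "closed_form1 A \<alpha> \<longleftrightarrow> linear_form1 A \<alpha> \<and>
     (\<forall>c\<in>A. \<forall>v. smooth_on (snd c ` fst c) (form1_coord A \<alpha> c v)) \<and>
     (\<forall>c\<in>A. \<forall>y \<in> snd c ` fst c. \<forall>v w.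
        frechet_derivative (form1_coord A \<alpha> c w) (at y) v = frechet_derivative (form1_coord A \<alpha> c v) (at y) w)"

lemma alternating_form2_combination:
  assumes "alternating_form2 A \<alpha>" "X \<in> tangent_space A p" "Y \<in> tangent_space A p" "Z \<in> tangent_space A p"
  shows "\<alpha> p (\<lambda>c. a *\<^sub>R X c + b *\<^sub>R Y c) Z = a * \<alpha> p X Z + b * \<alpha> p Y Z"
  using assms unfolding alternating_form2_def by blast

lemma alternating_form2_skew:
  assumes "alternating_form2 A \<alpha>" "X \<in> tangent_space A p" "Y \<in> tangent_space A p"
  shows "\<alpha> p X Y = - \<alpha> p Y X"
  using assms unfolding alternating_form2_def by blast

lemma smooth_on_Pair_const: "smooth_on S (\<lambda>y::'a::euclidean_space. (t::real, y))"
proof -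
  have "open (UNIV :: 'a set)" by simp
  then have "smooth_on UNIV (\<lambda>y::'a. (t, 0) + (0, y))"
    by (intro smooth_on_add smooth_on_const smooth_on_bounded_linear bounded_linear_Pair
        bounded_linear_zero bounded_linear_ident)
  then show ?thesis by (auto intro: smooth_on_subset)
qed

context curve_of_maps
begin

lemma tangent_map_in_tangent_space:
  assumes "\<xi> \<in> tangent_space A x"
  shows "tangent_map A B (F t) x \<xi> \<in> tangent_space B (F t x)"
proof -
  obtain d where d: "d \<in> B" "F t x \<in> fst d" using B.chart_covers by blast
  have c: "chart_at A x \<in> A" "x \<in> fst (chart_at A x)" by (rule A.chart_at)+
  show ?thesis
    using tangent_map_local[OF c(1) d(1) c(2) d(2)] A.chart_vector_of_tangent[OF c assms]
      B.chart_vector_in_tangent_space[OF d] by metis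
qed

lemma velocity_in_tangent_space: "velocity B (\<lambda>t. F t x) \<in> tangent_space B (F 0 x)"
proof -
  obtain d where d: "d \<in> B" "F 0 x \<in> fst d" using B.chart_covers by blast
  have c: "chart_at A x \<in> A" "x \<in> fst (chart_at A x)" by (rule A.chart_at)+
  show ?thesis
    using velocity_local[OF c(1) d(1) c(2) d(2)] B.chart_vector_in_tangent_space[OF d] by metis
qed

lemma tangent_map_combination:
  assumes "X \<in> tangent_space A x" "Y \<in> tangent_space A x"
  shows "tangent_map A B (F t) x (\<lambda>c. a *\<^sub>R X c + b *\<^sub>R Y c) =
    (\<lambda>d. a *\<^sub>R tangent_map A B (F t) x X d + b *\<^sub>R tangent_map A B (F t) x Y d)"
proof -
  obtain d where d: "d \<in> B" "F t x \<in> fst d" using B.chart_covers by blast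
  define c where "c = chart_at A x"
  have c: "c \<in> A" "x \<in> fst c" unfolding c_def by (rule A.chart_at)+
  define D where "D = frechet_derivative (local_map c d) (at (t, snd c x))"
  have lin: "linear D" unfolding D_def by (rule has_derivative_linear[OF local_map_has_derivative[OF c(1) d(1) c(2) d(2)]])
  have D: "D (0, a *\<^sub>R v + b *\<^sub>R w) = a *\<^sub>R D (0, v) + b *\<^sub>R D (0, w)" for v w
    using linear_add[OF lin, of "a *\<^sub>R (0, v)" "b *\<^sub>R (0, w)"]
      linear_scale[OF lin, of a "(0, v)"] linear_scale[OF lin, of b "(0, w)"] by simp
  have tm: "tangent_map A B (F t) x (chart_vector A c x v) = chart_vector B d (F t x) (D (0, v))" for v
    unfolding D_def by (rule tangent_map_local[OF c(1) d(1) c(2) d(2)])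
  have "(\<lambda>c. a *\<^sub>R X c + b *\<^sub>R Y c) = chart_vector A c x (a *\<^sub>R X c + b *\<^sub>R Y c)"
    by (simp only: A.chart_vector_combination[OF c] A.chart_vector_of_tangent[OF c assms(1)]
        A.chart_vector_of_tangent[OF c assms(2)])
  then have "tangent_map A B (F t) x (\<lambda>c. a *\<^sub>R X c + b *\<^sub>R Y c) =
      chart_vector B d (F t x) (a *\<^sub>R D (0, X c) + b *\<^sub>R D (0, Y c))"
    by (simp only: tm D)
  also have "\<dots> = (\<lambda>e. a *\<^sub>R tangent_map A B (F t) x (chart_vector A c x (X c)) e +
      b *\<^sub>R tangent_map A B (F t) x (chart_vector A c x (Y c)) e)"
    by (simp only: B.chart_vector_combination[OF d] tm)
  finally show ?thesis
    by (simp only: A.chart_vector_of_tangent[OF c assms(1)] A.chart_vector_of_tangent[OF c assms(2)])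
qed

lemma tangent_map_zero: "tangent_map A B (F t) x (\<lambda>_. 0) = (\<lambda>_. 0)"
proof -
  have "chart_vector A (chart_at A x) x 0 \<in> tangent_space A x"
    by (rule A.chart_vector_in_tangent_space[OF A.chart_at])
  from tangent_map_combination[OF this this, of t 0 0] show ?thesis by simp
qed

lemma local_map_range: "c \<in> A \<Longrightarrow> local_map c d ` local_domain c d \<subseteq> snd d ` fst d"
  by (auto simp: local_map_def local_domain_def)

lemma local_map_derivative_slice_smooth:
  assumes c: "c \<in> A" and d: "d \<in> B"
  shows "smooth_on (snd c ` (fst c \<inter> F t -` fst d)) (\<lambda>y. frechet_derivative (local_map c d) (at (t, y)) w)"
    and "smooth_on (snd c ` (fst c \<inter> F t -` fst d)) (\<lambda>y. local_map c d (t, y))"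
proof -
  have "continuous_on UNIV (F t)" using smooth_at by (simp add: smooth_map_def)
  then have o: "open (snd c ` (fst c \<inter> F t -` fst d))"
    using A.chart_image_open[OF c] B.chart_open(1)[OF d] open_vimage by blast
  have im: "(\<lambda>y. (t, y)) ` (snd c ` (fst c \<inter> F t -` fst d)) \<subseteq> local_domain c d"
    using local_domainI[OF c, of _ t d] by auto
  show "smooth_on (snd c ` (fst c \<inter> F t -` fst d)) (\<lambda>y. frechet_derivative (local_map c d) (at (t, y)) w)"
    by (rule smooth_on_compose[OF o smooth_on_Pair_const smooth_on_deriv[OF local_map_smooth[OF c d]] im])
  show "smooth_on (snd c ` (fst c \<inter> F t -` fst d)) (\<lambda>y. local_map c d (t, y))"
    by (rule smooth_on_compose[OF o smooth_on_Pair_const local_map_smooth[OF c d] im])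
qed

lemma preimage_open: "c \<in> A \<Longrightarrow> d \<in> B \<Longrightarrow> open (snd c ` (fst c \<inter> F t -` fst d))"
  using smooth_at[of t] A.chart_image_open B.chart_open(1) unfolding smooth_map_def
  by (blast intro: open_vimage)

text \<open>The right side is the coefficient of F^*\<omega> in a product chart on the time
  direction and the spatial direction \<open>v\<close>, at time 0. This is how the form on the
  surface becomes a component of a form on the cylinder.\<close>

lemma velocity_form_local:
  assumes "c \<in> A" "d \<in> B" "x \<in> fst c" "F 0 x \<in> fst d"
  shows "form1_coord A (\<lambda>x \<xi>. \<omega> (F 0 x) (velocity B (\<lambda>t. F t x)) (tangent_map A B (F 0) x \<xi>)) c v (snd c x) =
    form2_coord B \<omega> d (frechet_derivative (local_map c d) (at (0, snd c x)) (1, 0))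
      (frechet_derivative (local_map c d) (at (0, snd c x)) (0, v)) (local_map c d (0, snd c x))"
  using velocity_local[OF assms] tangent_map_local[OF assms] B.form2_coord_chart[OF assms(2,4)] assms
  by (simp add: form1_coord_def local_map_def)

lemma velocity_form_closed:
  assumes \<omega>: "smooth_form2 B \<omega>" "closed_form2 B \<omega>"
    and pull: "\<And>t x \<xi> \<zeta>. \<xi> \<in> tangent_space A x \<Longrightarrow> \<zeta> \<in> tangent_space A x \<Longrightarrow>
      \<omega> (F t x) (tangent_map A B (F t) x \<xi>) (tangent_map A B (F t) x \<zeta>) = \<sigma> x \<xi> \<zeta>"
  shows "closed_form1 A (\<lambda>x \<xi>. \<omega> (F 0 x) (velocity B (\<lambda>t. F t x)) (tangent_map A B (F 0) x \<xi>))"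
    (is "closed_form1 A ?\<beta>")
  unfolding closed_form1_def
proof (intro conjI ballI allI)
  have alt: "alternating_form2 B \<omega>" by (rule smooth_form2_alternating[OF \<omega>(1)])
  show "linear_form1 A ?\<beta>"
    unfolding linear_form1_def
  proof (intro allI ballI)
    fix p X Y and a b :: real assume XY: "X \<in> tangent_space A p" "Y \<in> tangent_space A p"
    let ?v = "velocity B (\<lambda>t. F t p)" and ?X = "tangent_map A B (F 0) p X" and ?Y = "tangent_map A B (F 0) p Y"
    have T: "?v \<in> tangent_space B (F 0 p)" "?X \<in> tangent_space B (F 0 p)" "?Y \<in> tangent_space B (F 0 p)"
      using velocity_in_tangent_space tangent_map_in_tangent_space XY by auto
    have "\<omega> (F 0 p) ?v (\<lambda>d. a *\<^sub>R ?X d + b *\<^sub>R ?Y d) = - (a * \<omega> (F 0 p) ?X ?v + b * \<omega> (F 0 p) ?Y ?v)"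
      using alternating_form2_skew[OF alt T(1) B.tangent_space_combination[OF T(2,3)], of a b]
        alternating_form2_combination[OF alt T(2,3,1)] by simp
    then show "\<omega> (F 0 p) ?v (tangent_map A B (F 0) p (\<lambda>c. a *\<^sub>R X c + b *\<^sub>R Y c)) =
        a * \<omega> (F 0 p) ?v ?X + b * \<omega> (F 0 p) ?v ?Y"
      using alternating_form2_skew[OF alt T(1,2)] alternating_form2_skew[OF alt T(1,3)]
      by (simp add: tangent_map_combination[OF XY])
  qed
next
  fix c v assume c: "c \<in> A"
  show "smooth_on (snd c ` fst c) (form1_coord A ?\<beta> c v)"
  \<comment> \<open>\<open>F 0\<close> may spread the domain of \<open>c\<close> over several target
    charts, so a chart \<open>d\<close> is chosen around the image of each point.\<close>
  proof (rule smooth_on_local)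
    fix y assume "y \<in> snd c ` fst c"
    then obtain x where x: "x \<in> fst c" "y = snd c x" by auto
    obtain d where d: "d \<in> B" "F 0 x \<in> fst d" using B.chart_covers by blast
    interpret W: smooth_bilinear_field "snd d ` fst d" "form2_coord B \<omega> d"
      by (rule B.smooth_form2_field[OF \<omega>(1) d(1)])
    let ?U = "snd c ` (fst c \<inter> F 0 -` fst d)"
    let ?D = "\<lambda>v y. frechet_derivative (local_map c d) (at (0, y)) v"
    have "smooth_on ?U (\<lambda>y. form2_coord B \<omega> d (?D (1, 0) y) (?D (0, v) y) (local_map c d (0, y)))"
    proof (rule W.smooth_on_along[OF preimage_open[OF c d(1)]])
      show "(\<lambda>y. local_map c d (0, y)) ` ?U \<subseteq> snd d ` fst d"
        using c by (auto simp: local_map_def)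
    qed (rule local_map_derivative_slice_smooth[OF c d(1)])+
    then have "smooth_on ?U (form1_coord A ?\<beta> c v)"
    proof (rule smooth_on_cong[OF preimage_open[OF c d(1)]])
      fix y assume "y \<in> ?U"
      then obtain z where z: "z \<in> fst c" "F 0 z \<in> fst d" "y = snd c z" by auto
      show "form2_coord B \<omega> d (?D (1, 0) y) (?D (0, v) y) (local_map c d (0, y)) = form1_coord A ?\<beta> c v y"
        unfolding z(3) by (rule velocity_form_local[OF c d(1) z(1,2), symmetric])
    qed
    then show "\<exists>U. open U \<and> y \<in> U \<and> smooth_on U (form1_coord A ?\<beta> c v)"
      using preimage_open[OF c d(1), of 0] x d by blast
  qed
next
  fix c y v w assume c: "c \<in> A" and "y \<in> snd c ` fst c"
  then obtain x where x: "x \<in> fst c" "y = snd c x" by auto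
  obtain d where d: "d \<in> B" "F 0 x \<in> fst d" using B.chart_covers by blast
  interpret W: smooth_bilinear_field "snd d ` fst d" "form2_coord B \<omega> d"
    by (rule B.smooth_form2_field[OF \<omega>(1) d(1)])
  let ?U = "snd c ` (fst c \<inter> F 0 -` fst d)"
  let ?T = "local_domain c d"
  define D where "D v z = frechet_derivative (local_map c d) (at z) v" for v z
  \<comment> \<open>The coefficients of F^*\<omega> in the product chart.\<close>
  define L where "L a b z = form2_coord B \<omega> d (D a z) (D b z) (local_map c d z)" for a b z
  have yT: "(0, y) \<in> ?T" using local_domainI[OF c x(1) d(2)] x by simp
  have oT: "open ?T" by (rule local_domain_open[OF c d(1)])
  have alt: "alternating_form2 B \<omega>" by (rule smooth_form2_alternating[OF \<omega>(1)])
  have smooth_L: "smooth_on ?T (L a b)" for a b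
    unfolding L_def D_def
    by (intro W.smooth_on_along oT local_map_smooth[OF c d(1)] local_map_range[OF c] smooth_on_deriv)
  have closed_L: "frechet_derivative (L b b') (at (0, y)) a - frechet_derivative (L a b') (at (0, y)) b
      + frechet_derivative (L a b) (at (0, y)) b' = 0" for a b b'
    unfolding L_def D_def
  proof (rule W.pullback_closed[OF B.chart_open(2)[OF d(1)] oT local_map_smooth[OF c d(1)] local_map_range[OF c] _ _ yT])
    show "form2_coord B \<omega> d v w y = - form2_coord B \<omega> d w v y" if "y \<in> snd d ` fst d" for v w y
      by (rule B.form2_coord_skew[OF alt d(1) that])
    show "frechet_derivative (form2_coord B \<omega> d v2 v3) (at y) v1
        - frechet_derivative (form2_coord B \<omega> d v1 v3) (at y) v2
        + frechet_derivative (form2_coord B \<omega> d v1 v2) (at y) v3 = 0" if "y \<in> snd d ` fst d" for v1 v2 v3 y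
      using \<omega>(2) d(1) that unfolding closed_form2_def by blast
  qed
  \<comment> \<open>The purely spatial coefficients are those of \<open>\<sigma>\<close>, by the
    pullback condition at every time, hence constant in \<open>t\<close>. This is the only use of
    the condition at times other than 0.\<close>
  have L_time: "frechet_derivative (L (0, v) (0, w)) (at (0, y)) (1, 0) = 0"
  proof -
    have "L (0, v) (0, w) (t, snd c z) = \<sigma> z (chart_vector A c z v) (chart_vector A c z w)"
      if "(t, snd c z) \<in> ?T" "z \<in> fst c" for t z
    proof -
      have Fz: "F t z \<in> fst d" by (rule local_mem[OF c that])
      have "\<sigma> z (chart_vector A c z v) (chart_vector A c z w) = form2_coord B \<omega> d
          (D (0, v) (t, snd c z)) (D (0, w) (t, snd c z)) (snd d (F t z))"
        unfolding B.form2_coord_chart[OF d(1) Fz] D_def tangent_map_local[OF c d(1) that(2) Fz, symmetric]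
        by (rule pull[symmetric]) (rule A.chart_vector_in_tangent_space[OF c that(2)])+
      then show ?thesis using c that by (simp add: L_def local_map_def)
    qed
    from this[of _ x] have const: "L (0, v) (0, w) (t, y) = L (0, v) (0, w) (0, y)" if "(t, y) \<in> ?T" for t
      using that yT x by simp
    have "((\<lambda>t. (t, y)) has_derivative (\<lambda>h. (h, 0))) (at 0)"
      by (auto intro!: derivative_eq_intros)
    from has_derivative_compose[OF this smooth_on_has_derivative[OF smooth_L yT]]
    have 1: "((\<lambda>t. L (0, v) (0, w) (t, y)) has_derivative
        (\<lambda>h. frechet_derivative (L (0, v) (0, w)) (at (0, y)) (h, 0))) (at 0)" .
    have o: "open ((\<lambda>t. (t, y)) -` ?T)"
      by (intro open_vimage oT continuous_intros)
    have 2: "((\<lambda>t. L (0, v) (0, w) (t, y)) has_derivative (\<lambda>h. 0)) (at 0)"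
    proof (rule has_derivative_transform_within_open[OF has_derivative_const o])
      show "0 \<in> (\<lambda>t. (t, y)) -` ?T" using yT by simp
      show "L (0, v) (0, w) (0, y) = L (0, v) (0, w) (t, y)" if "t \<in> (\<lambda>t. (t, y)) -` ?T" for t
        using const[of t] that by simp
    qed
    show ?thesis using has_derivative_unique[OF 1 2] by metis
  qed
  have space: "frechet_derivative (form1_coord A ?\<beta> c a) (at y) b = frechet_derivative (L (1, 0) (0, a)) (at (0, y)) (0, b)" for a b
  proof -
    have "((\<lambda>y. (0, y)) has_derivative (\<lambda>h. (0, h))) (at y)"
      by (auto intro!: derivative_eq_intros)
    from has_derivative_compose[OF this smooth_on_has_derivative[OF smooth_L yT]]
    have "((\<lambda>y. L (1, 0) (0, a) (0, y)) has_derivative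
        (\<lambda>h. frechet_derivative (L (1, 0) (0, a)) (at (0, y)) (0, h))) (at y)" .
    then have "(form1_coord A ?\<beta> c a has_derivative
        (\<lambda>h. frechet_derivative (L (1, 0) (0, a)) (at (0, y)) (0, h))) (at y)"
    proof (rule has_derivative_transform_within_open[OF _ preimage_open[OF c d(1), of 0]])
      show "y \<in> ?U" using x d by auto
      fix y assume "y \<in> ?U"
      then obtain z where z: "z \<in> fst c" "F 0 z \<in> fst d" "y = snd c z" by auto
      show "L (1, 0) (0, a) (0, y) = form1_coord A ?\<beta> c a y"
        unfolding z(3) L_def D_def by (rule velocity_form_local[OF c d(1) z(1,2), symmetric])
    qed
    then show ?thesis by (simp add: frechet_derivative_eqI)
  qed
  \<comment> \<open>In the closedness identity on the time direction and two spatial directions, the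
    time derivative of the spatial coefficient drops out. The other two terms are the cross
    derivatives of \<open>?\<beta>\<close>, which must therefore agree.\<close>
  show "frechet_derivative (form1_coord A ?\<beta> c w) (at y) v = frechet_derivative (form1_coord A ?\<beta> c v) (at y) w"
    unfolding space using closed_L[of "(0, v)" "(0, w)" "(1, 0)"] L_time by simp
qed

end

text \<open>Provides the continuity of \<omega>(u, v) that is required to split the surface
  integral. Since both curves start at the same map, one neighbourhood serves for both local
  descriptions.\<close>

lemma velocity_pairing_smooth:
  assumes "curve_of_maps A B F" "curve_of_maps A B F'" and F0: "F 0 = F' 0"
    and \<omega>: "smooth_form2 B \<omega>"
  shows "smooth_fun A (\<lambda>x. \<omega> (F 0 x) (velocity B (\<lambda>t. F t x)) (velocity B (\<lambda>t. F' t x)))"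
    (is "smooth_fun A ?h")
  unfolding smooth_fun_def
proof (intro ballI smooth_on_local)
  interpret F: curve_of_maps A B F by fact
  interpret F': curve_of_maps A B F' by fact
  fix c y assume c: "c \<in> A" and "y \<in> snd c ` fst c"
  then obtain x where x: "x \<in> fst c" "y = snd c x" by auto
  obtain d where d: "d \<in> B" "F 0 x \<in> fst d" using F.B.chart_covers by blast
  interpret W: smooth_bilinear_field "snd d ` fst d" "form2_coord B \<omega> d"
    by (rule F.B.smooth_form2_field[OF \<omega> d(1)])
  let ?U = "snd c ` (fst c \<inter> F 0 -` fst d)"
  let ?D = "\<lambda>y. frechet_derivative (F.local_map c d) (at (0, y)) (1, 0)"
  let ?D' = "\<lambda>y. frechet_derivative (F'.local_map c d) (at (0, y)) (1, 0)"
  have o: "open ?U" by (rule F.preimage_open[OF c d(1)])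
  have "smooth_on ?U (\<lambda>y. form2_coord B \<omega> d (?D y) (?D' y) (F.local_map c d (0, y)))"
  proof (rule W.smooth_on_along[OF o])
    show "(\<lambda>y. F.local_map c d (0, y)) ` ?U \<subseteq> snd d ` fst d"
      using c by (auto simp: F.local_map_def)
    show "smooth_on ?U ?D'" unfolding F0 by (rule F'.local_map_derivative_slice_smooth[OF c d(1)])
  qed (rule F.local_map_derivative_slice_smooth[OF c d(1)])+
  then have "smooth_on ?U (?h \<circ> inv_chart c)"
  proof (rule smooth_on_cong[OF o])
    fix y assume "y \<in> ?U"
    then obtain z where z: "z \<in> fst c" "F 0 z \<in> fst d" "y = snd c z" by auto
    show "form2_coord B \<omega> d (?D y) (?D' y) (F.local_map c d (0, y)) = (?h \<circ> inv_chart c) y"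
      using F.velocity_local[OF c d(1) z(1,2)] F'.velocity_local[OF c d(1) z(1) z(2)[unfolded F0]]
        F.B.form2_coord_chart[OF d(1) z(2)] c z(1)
      by (simp add: z(3) F.local_map_def F0)
  qed
  then show "\<exists>U. open U \<and> y \<in> U \<and> smooth_on U (?h \<circ> inv_chart c)"
    using o x d by blast
qed

lemma smooth_fun_continuous:
  assumes "smooth_atlas A" "smooth_fun A h"
  shows "continuous_on UNIV h"
proof -
  interpret atlas A by unfold_locales fact
  have "continuous_on (fst c) h" if c: "c \<in> A" for c
  proof -
    have "continuous_on (fst c) (\<lambda>x. (h \<circ> inv_chart c) (snd c x))"
    proof (rule continuous_on_compose2[of "snd c ` fst c" "h \<circ> inv_chart c" "fst c" "snd c"])
      show "continuous_on (snd c ` fst c) (h \<circ> inv_chart c)"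
        using assms(2) c unfolding smooth_fun_def by (blast intro: smooth_on_continuous)
      show "continuous_on (fst c) (snd c)"
        using chart_homeomorphism[OF c] by (simp add: homeomorphism_def)
    qed simp
    then show ?thesis using c by (simp cong: continuous_on_cong)
  qed
  then have "continuous_on (\<Union>c\<in>A. fst c) h"
    by (intro continuous_on_open_UN chart_open(1)) auto
  moreover have "(\<Union>c\<in>A. fst c) = UNIV" using chart_covers by blast
  ultimately show ?thesis by simp
qed

section \<open>Partitions of unity\<close>

text \<open>The function is \<open>flat 0\<close> of r^2 - |y - y0|^2 in coordinates, extended by 0.
  The closed coordinate ball corresponds to a compact set, which is closed because the space is
  Hausdorff; hence the extension is smooth and the closure of its support stays inside the
  chart.\<close>

lemma chart_bump_function:
  fixes A :: "('m::t2_space, 'e::euclidean_space) atlas"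
  assumes A: "smooth_atlas A" and c: "c \<in> A" "p \<in> fst c"
  shows "\<exists>b. smooth_fun A b \<and> (\<forall>x. 0 \<le> b x) \<and> 0 < b p \<and> closure {x. b x \<noteq> 0} \<subseteq> fst c"
proof -
  interpret atlas A by unfold_locales fact
  obtain r where r: "r > 0" "cball (snd c p) r \<subseteq> snd c ` fst c"
    using chart_open(2)[OF c(1)] c(2) open_contains_cball by (metis imageI)
  define K where "K = inv_chart c ` cball (snd c p) r"
  have hom: "homeomorphism (fst c) (snd c ` fst c) (snd c) (inv_chart c)" by (rule chart_homeomorphism[OF c(1)])
  have "compact K"
    unfolding K_def
    by (rule compact_continuous_image[OF continuous_on_subset[OF _ r(2)]]) (use hom in \<open>auto simp: homeomorphism_def\<close>)
  then have K: "closed K" by (rule compact_imp_closed)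
  have Kc: "K \<subseteq> fst c" unfolding K_def using hom r(2) by (auto simp: homeomorphism_def)
  define b where "b x = (if x \<in> fst c then flat 0 (r\<^sup>2 - (snd c x - snd c p) \<bullet> (snd c x - snd c p)) else 0)" for x
  have bK: "b x = 0" if "x \<notin> K" for x
  proof (cases "x \<in> fst c")
    case True
    have "snd c x \<notin> cball (snd c p) r"
      using that True c(1) unfolding K_def by (metis image_eqI inv_chart_chart)
    then have "r < norm (snd c x - snd c p)" by (simp add: dist_norm norm_minus_commute)
    then have "r\<^sup>2 < (norm (snd c x - snd c p))\<^sup>2" using r(1) by (intro power_strict_mono) auto
    then show ?thesis using True by (simp add: b_def flat_def power2_norm_eq_inner)
  qed (simp add: b_def)
  have "closure {x. b x \<noteq> 0} \<subseteq> K"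
    using bK by (intro closure_minimal K) auto
  moreover have "0 \<le> b x" for x by (simp add: b_def flat_def)
  moreover have "0 < b p" using c r by (simp add: b_def flat_def)
  moreover have "smooth_fun A b"
    unfolding smooth_fun_def
  proof (intro ballI smooth_on_local)
    fix e y assume e: "e \<in> A" and "y \<in> snd e ` fst e"
    then obtain x where x: "x \<in> fst e" "y = snd e x" by auto
    show "\<exists>U. open U \<and> y \<in> U \<and> smooth_on U (b \<circ> inv_chart e)"
    proof (cases "x \<in> fst c")
      case True
      let ?U = "snd e ` (fst e \<inter> fst c)"
      have o: "open ?U" by (rule chart_image_open[OF e chart_open(1)[OF c(1)]])
      have t: "smooth_on ?U (\<lambda>y. transition e c y + - snd c p)"
        by (intro smooth_on_add o transition_smooth[OF e c(1)] smooth_on_const)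
      have "smooth_on ?U (\<lambda>y. r\<^sup>2 + - 1 * ((transition e c y + - snd c p) \<bullet> (transition e c y + - snd c p)))"
        by (intro t smooth_on_add smooth_on_mult smooth_on_inner o smooth_on_const)
      then have "smooth_on ?U (\<lambda>y. flat 0 (r\<^sup>2 + - 1 * ((transition e c y + - snd c p) \<bullet> (transition e c y + - snd c p))))"
        by (rule smooth_on_compose[OF o _ smooth_on_flat]) simp
      then have "smooth_on ?U (b \<circ> inv_chart e)"
        by (rule smooth_on_cong[OF o]) (use e in \<open>auto simp: b_def\<close>)
      then show ?thesis using o x True by blast
    next
      case False
      let ?U = "snd e ` (fst e \<inter> - K)"
      have o: "open ?U" by (rule chart_image_open[OF e]) (use K in auto)
      have "smooth_on ?U (b \<circ> inv_chart e)"
        by (rule smooth_on_cong[OF o smooth_on_const[of _ 0]]) (use e bK in auto)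
      moreover have "y \<in> ?U" using x False Kc by auto
      ultimately show ?thesis using o by blast
    qed
  qed
  ultimately show ?thesis using Kc by blast
qed

context atlas
begin

lemma smooth_fun_sum:
  "(\<And>i. i \<in> I \<Longrightarrow> smooth_fun A (h i)) \<Longrightarrow> smooth_fun A (\<lambda>x. \<Sum>i\<in>I. h i x)"
  unfolding smooth_fun_def comp_def by (intro ballI smooth_on_sum chart_open) blast+

lemma smooth_fun_mult:
  "smooth_fun A h \<Longrightarrow> smooth_fun A k \<Longrightarrow> smooth_fun A (\<lambda>x. h x * k x)"
  unfolding smooth_fun_def comp_def by (intro ballI smooth_on_mult chart_open) blast+

lemma smooth_fun_inverse:
  "smooth_fun A h \<Longrightarrow> (\<And>x. h x \<noteq> 0) \<Longrightarrow> smooth_fun A (\<lambda>x. inverse (h x))"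
  unfolding smooth_fun_def comp_def by (intro ballI smooth_on_inverse chart_open) blast+

end

lemma partition_of_unity_exists:
  fixes A :: "('m::t2_space, 'e::euclidean_space) atlas"
  assumes A: "smooth_atlas A" and compact: "compact (UNIV :: 'm set)"
  shows "\<exists>I \<rho>. partition_of_unity A I \<rho>"
proof -
  interpret atlas A by unfold_locales fact
  let ?c = "chart_at A"
  have "\<exists>b. smooth_fun A b \<and> (\<forall>x. 0 \<le> b x) \<and> 0 < b p \<and> closure {x. b x \<noteq> 0} \<subseteq> fst (?c p)" for p
    by (rule chart_bump_function[OF A chart_at])
  then obtain b where b: "\<And>p. smooth_fun A (b p)" "\<And>p x. 0 \<le> b p x" "\<And>p. 0 < b p p"
      "\<And>p. closure {x. b p x \<noteq> 0} \<subseteq> fst (?c p)" by metis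
  have o: "open {x. 0 < b p x}" for p
    by (rule open_Collect_less) (rule continuous_on_const smooth_fun_continuous[OF A b(1)])+
  have cover: "UNIV \<subseteq> (\<Union>p\<in>UNIV. {x. 0 < b p x})" using b(3) by auto
  obtain P where P: "finite P" "UNIV \<subseteq> (\<Union>p\<in>P. {x. 0 < b p x})"
    using compactE_image[OF compact o cover] by metis
  define s where "s x = (\<Sum>p\<in>P. b p x)" for x
  have s: "s x > 0" for x
  proof -
    obtain p where "p \<in> P" "0 < b p x" using P by blast
    then show ?thesis unfolding s_def using P(1) b(2) by (intro sum_pos2) auto
  qed
  \<comment> \<open>The bump functions are indexed by points but a partition of unity by charts, so
    those of all points with the same \<open>chart_at\<close> are added up. Division by the total
    \<open>s\<close> normalises the sum.\<close>
  define \<rho> where "\<rho> c x = (\<Sum>p\<in>{p \<in> P. ?c p = c}. b p x) * inverse (s x)" for c x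
  have "partition_of_unity A (?c ` P) \<rho>"
    unfolding partition_of_unity_def
  proof (intro conjI ballI allI)
    show "?c ` P \<subseteq> A" using chart_at by blast
    show "(\<Sum>c\<in>?c ` P. \<rho> c x) = 1" for x
    proof -
      have "(\<Sum>c\<in>?c ` P. \<rho> c x) = s x * inverse (s x)"
        unfolding \<rho>_def sum_distrib_right[symmetric] s_def using P(1) by (subst sum.group) auto
      then show ?thesis using s[of x] by simp
    qed
    fix c
    show "smooth_fun A (\<rho> c)"
      unfolding \<rho>_def
    proof (intro smooth_fun_mult smooth_fun_sum smooth_fun_inverse b(1))
      show "smooth_fun A s" unfolding s_def by (intro smooth_fun_sum b(1))
      show "s x \<noteq> 0" for x using s[of x] by simp
    qed
    show "0 \<le> \<rho> c x" for x
      unfolding \<rho>_def using s[of x] b(2) by (intro mult_nonneg_nonneg sum_nonneg) auto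
    have "{x. \<rho> c x \<noteq> 0} \<subseteq> (\<Union>p\<in>{p \<in> P. ?c p = c}. closure {x. b p x \<noteq> 0})"
    proof
      fix x assume "x \<in> {x. \<rho> c x \<noteq> 0}"
      then have "(\<Sum>p\<in>{p \<in> P. ?c p = c}. b p x) \<noteq> 0" by (auto simp: \<rho>_def)
      then obtain p where "p \<in> {p \<in> P. ?c p = c}" "b p x \<noteq> 0" by (meson sum.neutral)
      then show "x \<in> (\<Union>p\<in>{p \<in> P. ?c p = c}. closure {x. b p x \<noteq> 0})"
        using closure_subset[of "{x. b p x \<noteq> 0}"] by blast
    qed
    then have "closure {x. \<rho> c x \<noteq> 0} \<subseteq> (\<Union>p\<in>{p \<in> P. ?c p = c}. closure {x. b p x \<noteq> 0})"
      using P(1) by (intro closure_minimal closed_UN) auto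
    then show "closure {x. \<rho> c x \<noteq> 0} \<subseteq> fst c" using b(4) by blast
  qed (use P in auto)
  then show ?thesis by blast
qed

section \<open>Integration and Stokes' theorem on a closed surface\<close>

text \<open>The 24 permutations fall into the three ways of pairing four slots, and the 8 belonging
  to one pairing contribute equally. Division by 2! 2! = 4 leaves the factor 2, which is the
  constant of the theorem.\<close>

lemma wedge2_square:
  assumes skew: "\<And>i j. i < 4 \<Longrightarrow> j < 4 \<Longrightarrow> \<alpha> (v i) (v j) = - \<alpha> (v j) (v i)"
  shows "wedge2 \<alpha> \<alpha> v = 2 * (\<alpha> (v 0) (v 1) * \<alpha> (v 2) (v 3) - \<alpha> (v 0) (v 2) * \<alpha> (v 1) (v 3)
    + \<alpha> (v 0) (v 3) * \<alpha> (v 1) (v 2))"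
proof -
  have set: "{..<4::nat} = {0, 1, 2, 3}" by auto
  have f: "finite {1, 2, 3::nat}" "0 \<notin> {1, 2, 3::nat}" "finite {2, 3::nat}" "1 \<notin> {2, 3::nat}"
    "finite {3::nat}" "2 \<notin> {3::nat}" by auto
  have *: "\<alpha> (v 1) (v 0) = - \<alpha> (v 0) (v 1)" "\<alpha> (v 2) (v 0) = - \<alpha> (v 0) (v 2)" "\<alpha> (v 3) (v 0) = - \<alpha> (v 0) (v 3)"
    "\<alpha> (v 2) (v 1) = - \<alpha> (v 1) (v 2)" "\<alpha> (v 3) (v 1) = - \<alpha> (v 1) (v 3)" "\<alpha> (v 3) (v 2) = - \<alpha> (v 2) (v 3)"
    by (rule skew; simp)+
  show ?thesis
    unfolding wedge2_def set
    unfolding sum_over_permutations_insert[OF f(1,2)] sum_over_permutations_insert[OF f(3,4)]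
      sum_over_permutations_insert[OF f(5,6)] permutes_sing
    by (simp add: sign_swap_id sign_compose permutation_swap_id permutation_compose sign_id transpose_def *[unfolded One_nat_def] * algebra_simps)
      (simp add: field_simps)
qed

text \<open>Coordinate integrands are continuous only on an open chart image and could misbehave
  towards its boundary; compact support excludes this.\<close>

lemma absolutely_integrable_compact_support:
  fixes g :: "'a::euclidean_space \<Rightarrow> real"
  assumes K: "compact K" "continuous_on K g" and U: "K \<subseteq> U" "\<And>x. x \<in> U \<Longrightarrow> x \<notin> K \<Longrightarrow> g x = 0"
  shows "g absolutely_integrable_on U"
proof -
  have int: "integrable lborel (\<lambda>x. indicator K x *\<^sub>R g x)"
    by (rule borel_integrable_compact[OF K])
  then have "g absolutely_integrable_on K"
    unfolding set_integrable_def
    using integrable_completion[OF borel_measurable_integrable[OF int]] by blast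
  then have "(\<lambda>x. if x \<in> K then g x else 0) absolutely_integrable_on UNIV"
    by (simp only: absolutely_integrable_restrict_UNIV)
  moreover have "(\<lambda>x. if x \<in> K then g x else 0) = (\<lambda>x. if x \<in> U then g x else 0)"
    using U by (auto simp: fun_eq_iff)
  ultimately show ?thesis by (simp only: absolutely_integrable_restrict_UNIV)
qed

lemma integral_vanishing_outside:
  fixes g :: "'a::euclidean_space \<Rightarrow> real"
  assumes "T \<subseteq> S" "\<And>x. x \<in> S \<Longrightarrow> x \<notin> T \<Longrightarrow> g x = 0"
  shows "integral S g = integral T g"
proof -
  have "integral S g = integral S (\<lambda>x. if x \<in> T then g x else 0)"
    by (rule integral_cong) (use assms(2) in auto)
  also have "\<dots> = integral T g"
    using assms(1) by (simp add: integral_restrict_Int inf_absorb1)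
  finally show ?thesis .
qed

section \<open>Alternating forms in dimension two and products of 1-forms\<close>

text \<open>The factor is the determinant of the pair \<open>v, w\<close>. Applied to the columns of
  a Jacobian matrix it gives the transformation law of the single coefficient of a 2-form.\<close>

lemma alternating_bilinear_2:
  fixes b :: "real^2 \<Rightarrow> real^2 \<Rightarrow> real"
  assumes l: "\<And>w. linear (\<lambda>v. b v w)" and r: "\<And>v. linear (b v)" and skew: "\<And>v w. b v w = - b w v"
  shows "b v w = (v $ 1 * w $ 2 - v $ 2 * w $ 1) * b (axis 1 1) (axis 2 1)"
proof -
  have e: "x = x $ 1 *\<^sub>R axis 1 1 + x $ 2 *\<^sub>R axis 2 1" for x :: "real^2"
    by (simp add: vec_eq_iff axis_def forall_2)
  have bl: "b (a *\<^sub>R x + c *\<^sub>R y) z = a * b x z + c * b y z" for a c x y z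
    using linear_add[OF l[of z]] linear_scale[OF l[of z]] by simp
  have br: "b z (a *\<^sub>R x + c *\<^sub>R y) = a * b z x + c * b z y" for a c x y z
    using linear_add[OF r[of z]] linear_scale[OF r[of z]] by simp
  have z: "b x x = 0" for x using skew[of x x] by simp
  have "b v w = b (v $ 1 *\<^sub>R axis 1 1 + v $ 2 *\<^sub>R axis 2 1) (w $ 1 *\<^sub>R axis 1 1 + w $ 2 *\<^sub>R axis 2 1)"
    using e[of v] e[of w] by simp
  also have "\<dots> = v $ 1 * (w $ 2 * b (axis 1 1) (axis 2 1)) + v $ 2 * (w $ 1 * b (axis 2 1) (axis 1 1))"
    unfolding bl br z by simp
  also have "\<dots> = (v $ 1 * w $ 2 - v $ 2 * w $ 1) * b (axis 1 1) (axis 2 1)"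
    using skew[of "axis 2 1" "axis 1 1"] by (simp add: algebra_simps)
  finally show ?thesis .
qed

definition wedge_form1 :: "('m, 'e) form1 \<Rightarrow> ('m, 'e) form1 \<Rightarrow> ('m, 'e) form2" where
  "wedge_form1 \<alpha> \<beta> = (\<lambda>x \<xi> \<zeta>. \<alpha> x \<xi> * \<beta> x \<zeta> - \<alpha> x \<zeta> * \<beta> x \<xi>)"

lemma form2_coord_wedge:
  "form2_coord A (wedge_form1 \<alpha> \<beta>) c v w y =
    form1_coord A \<alpha> c v y * form1_coord A \<beta> c w y - form1_coord A \<alpha> c w y * form1_coord A \<beta> c v y"
  by (simp add: form2_coord_def wedge_form1_def form1_coord_def Let_def)

lemma wedge_alternating:
  assumes "linear_form1 A \<alpha>" "linear_form1 A \<beta>"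
  shows "alternating_form2 A (wedge_form1 \<alpha> \<beta>)"
  unfolding alternating_form2_def
proof (intro allI ballI conjI)
  fix p X Y Z and a b :: real
  assume T: "X \<in> tangent_space A p" "Y \<in> tangent_space A p" "Z \<in> tangent_space A p"
  have "\<alpha> p (\<lambda>c. a *\<^sub>R X c + b *\<^sub>R Y c) = a * \<alpha> p X + b * \<alpha> p Y"
    "\<beta> p (\<lambda>c. a *\<^sub>R X c + b *\<^sub>R Y c) = a * \<beta> p X + b * \<beta> p Y"
    using assms T unfolding linear_form1_def by blast+
  then show "wedge_form1 \<alpha> \<beta> p (\<lambda>c. a *\<^sub>R X c + b *\<^sub>R Y c) Z =
      a * wedge_form1 \<alpha> \<beta> p X Z + b * wedge_form1 \<alpha> \<beta> p Y Z"
    by (simp add: wedge_form1_def algebra_simps)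
  show "wedge_form1 \<alpha> \<beta> p X Y = - wedge_form1 \<alpha> \<beta> p Y X"
    by (simp add: wedge_form1_def algebra_simps)
qed

context atlas
begin

lemma fun_differential_linear:
  assumes h: "smooth_fun A h"
  shows "linear_form1 A (fun_differential A h)"
  unfolding linear_form1_def
proof (intro allI ballI)
  fix p X Y and a b :: real assume T: "X \<in> tangent_space A p" "Y \<in> tangent_space A p"
  let ?c = "chart_at A p"
  have "(h \<circ> inv_chart ?c) differentiable (at (snd ?c p))"
    using h chart_at[of p] unfolding smooth_fun_def by (blast intro: smooth_on_imp_differentiable)
  then have "linear (frechet_derivative (h \<circ> inv_chart ?c) (at (snd ?c p)))"
    by (rule linear_frechet_derivative)
  from linear_add[OF this] linear_scale[OF this]
  show "fun_differential A h p (\<lambda>c. a *\<^sub>R X c + b *\<^sub>R Y c) = a * fun_differential A h p X + b * fun_differential A h p Y"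
    by (simp add: fun_differential_def Let_def)
qed

lemma fun_differential_coord:
  assumes h: "smooth_fun A h" and c: "c \<in> A" and y: "y \<in> snd c ` fst c"
  shows "form1_coord A (fun_differential A h) c v y = frechet_derivative (h \<circ> inv_chart c) (at y) v"
  using fun_differential_chart[OF h c] y c by (auto simp: form1_coord_def)

lemma fun_differential_coord_smooth:
  assumes h: "smooth_fun A h" and c: "c \<in> A"
  shows "smooth_on (snd c ` fst c) (form1_coord A (fun_differential A h) c v)"
proof (rule smooth_on_cong[OF chart_open(2)[OF c]])
  show "smooth_on (snd c ` fst c) (\<lambda>y. frechet_derivative (h \<circ> inv_chart c) (at y) v)"
    using h c unfolding smooth_fun_def by (blast intro: smooth_on_deriv)
qed (rule fun_differential_coord[OF h c, symmetric])

lemma fun_differential_coord_zero: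
  assumes h: "smooth_fun A h" and c: "c \<in> A" "x \<in> fst c" and x: "x \<notin> closure {x. h x \<noteq> 0}"
  shows "form1_coord A (fun_differential A h) c v (snd c x) = 0"
proof -
  let ?U = "snd c ` (fst c \<inter> - closure {x. h x \<noteq> 0})"
  have "open ?U" by (rule chart_image_open[OF c(1)]) auto
  moreover have "snd c x \<in> ?U" using c x by auto
  moreover have "(h \<circ> inv_chart c) y = 0" if "y \<in> ?U" for y
    using that c(1) closure_subset[of "{x. h x \<noteq> 0}"] by auto
  ultimately have "frechet_derivative (h \<circ> inv_chart c) (at (snd c x)) = frechet_derivative (\<lambda>_. 0) (at (snd c x))"
    by (rule frechet_derivative_cong_open)
  then show ?thesis
    using fun_differential_coord[OF h c(1), of "snd c x" v] c(2) by simp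
qed

lemma wedge_coord_smooth:
  assumes h: "smooth_fun A h" and \<beta>: "closed_form1 A \<beta>" and c: "c \<in> A"
  shows "smooth_on (snd c ` fst c) (form2_coord A (wedge_form1 (fun_differential A h) \<beta>) c v w)"
proof (rule smooth_on_cong[OF chart_open(2)[OF c]])
  have \<beta>s: "smooth_on (snd c ` fst c) (form1_coord A \<beta> c v)" for v
    using \<beta> c unfolding closed_form1_def by blast
  show "smooth_on (snd c ` fst c) (\<lambda>y. form1_coord A (fun_differential A h) c v y * form1_coord A \<beta> c w y
      + - 1 * (form1_coord A (fun_differential A h) c w y * form1_coord A \<beta> c v y))"
    by (intro smooth_on_add smooth_on_mult smooth_on_const chart_open(2)[OF c] \<beta>s
        fun_differential_coord_smooth[OF h c])
qed (simp add: form2_coord_wedge)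

end

section \<open>Change of charts and linearity of the surface integral\<close>

text \<open>The weight \<open>q\<close> is kept as a parameter: it is a member of a partition of
  unity at first, and the constant 1 once the weights have been summed inside one chart.\<close>

definition chart_integrand :: "('s::topological_space, real^2) atlas \<Rightarrow> ('s, real^2) form2 \<Rightarrow> ('s \<Rightarrow> real) \<Rightarrow>
     ('s, real^2) form2 \<Rightarrow> ('s, real^2) chart \<Rightarrow> real^2 \<Rightarrow> real" where
  "chart_integrand A \<sigma> q \<eta> c y = q (inv_chart c y) * sgn (form2_coord A \<sigma> c (axis 1 1) (axis 2 1) y)
     * form2_coord A \<eta> c (axis 1 1) (axis 2 1) y"

locale oriented_closed_surface = atlas A
  for A :: "('s::t2_space, real^2) atlas" +
  fixes \<sigma> :: "('s, real^2) form2"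
  assumes compact_surface: "compact (UNIV :: 's set)"
    and area_smooth: "smooth_form2 A \<sigma>" and area_nondegenerate: "nondegenerate_form2 A \<sigma>"
begin

lemma form2_coord_change:
  assumes \<eta>: "alternating_form2 A \<eta>" and cd: "c \<in> A" "d \<in> A" "x \<in> fst c" "x \<in> fst d"
  shows "form2_coord A \<eta> c (axis 1 1) (axis 2 1) (snd c x) =
    det (matrix (frechet_derivative (transition c d) (at (snd c x)))) *
      form2_coord A \<eta> d (axis 1 1) (axis 2 1) (snd d x)"
proof -
  let ?J = "frechet_derivative (transition c d) (at (snd c x))"
  let ?b = "\<lambda>v w. form2_coord A \<eta> d v w (snd d x)"
  have y: "snd d x \<in> snd d ` fst d" using cd by blast
  have "form2_coord A \<eta> c (axis 1 1) (axis 2 1) (snd c x) = ?b (?J (axis 1 1)) (?J (axis 2 1))"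
    unfolding form2_coord_chart[OF cd(1,3)] form2_coord_chart[OF cd(2,4)] chart_vector_change[OF cd] ..
  also have "\<dots> = (?J (axis 1 1) $ 1 * ?J (axis 2 1) $ 2 - ?J (axis 1 1) $ 2 * ?J (axis 2 1) $ 1) *
      ?b (axis 1 1) (axis 2 1)"
    by (rule alternating_bilinear_2[of ?b])
      (use form2_coord_linear[OF \<eta> cd(2) y] form2_coord_skew[OF \<eta> cd(2) y] in blast)+
  also have "?J (axis 1 1) $ 1 * ?J (axis 2 1) $ 2 - ?J (axis 1 1) $ 2 * ?J (axis 2 1) $ 1 = det (matrix ?J)"
    by (simp add: det_2 matrix_def)
  finally show ?thesis .
qed

lemma area_alternating: "alternating_form2 A \<sigma>"
  by (rule smooth_form2_alternating[OF area_smooth])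

text \<open>In dimension two a vanishing coefficient would put the first coordinate vector into the
  kernel of \<open>\<sigma>\<close>. Consequently its sign is 1 or -1 everywhere and varies
  continuously.\<close>

lemma area_coord_nonzero:
  assumes c: "c \<in> A" and y: "y \<in> snd c ` fst c"
  shows "form2_coord A \<sigma> c (axis 1 1) (axis 2 1) y \<noteq> 0"
proof
  assume 0: "form2_coord A \<sigma> c (axis 1 1) (axis 2 1) y = 0"
  obtain x where x: "x \<in> fst c" "y = snd c x" using y by auto
  let ?X = "chart_vector A c x (axis 1 1)"
  have "\<sigma> x ?X Y = 0" if Y: "Y \<in> tangent_space A x" for Y
  proof -
    have "form2_coord A \<sigma> c (axis 1 1) (Y c) y = ((axis 1 1 :: real^2) $ 1 * Y c $ 2 - (axis 1 1 :: real^2) $ 2 * Y c $ 1) *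
        form2_coord A \<sigma> c (axis 1 1) (axis 2 1) y"
      by (rule alternating_bilinear_2[of "\<lambda>v w. form2_coord A \<sigma> c v w y"])
        (use form2_coord_linear[OF area_alternating c y] form2_coord_skew[OF area_alternating c y] in blast)+
    then have "form2_coord A \<sigma> c (axis 1 1) (Y c) y = 0" using 0 by simp
    then show ?thesis
      unfolding x(2) form2_coord_chart[OF c x(1)] chart_vector_of_tangent[OF c x(1) Y] .
  qed
  then have "?X = (\<lambda>_. 0)"
    using area_nondegenerate chart_vector_in_tangent_space[OF c x(1)] unfolding nondegenerate_form2_def by blast
  then have "?X c = 0" by simp
  then show False using chart_vector_coordinate[OF c x(1)] by simp
qed

lemma area_sign_continuous:
  assumes c: "c \<in> A"
  shows "continuous_on (snd c ` fst c) (\<lambda>y. sgn (form2_coord A \<sigma> c (axis 1 1) (axis 2 1) y))"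
proof (rule continuous_on_sgn)
  show "continuous_on (snd c ` fst c) (form2_coord A \<sigma> c (axis 1 1) (axis 2 1))"
    using area_smooth c unfolding smooth_form2_def by (blast intro: smooth_on_continuous)
qed (use area_coord_nonzero[OF c] in blast)

lemma area_sign_locally_constant:
  assumes c: "c \<in> A" and y: "y \<in> snd c ` fst c"
  shows "\<exists>U. open U \<and> y \<in> U \<and> U \<subseteq> snd c ` fst c \<and>
    (\<forall>z\<in>U. sgn (form2_coord A \<sigma> c (axis 1 1) (axis 2 1) z) = sgn (form2_coord A \<sigma> c (axis 1 1) (axis 2 1) y))"
proof -
  let ?s = "\<lambda>y. sgn (form2_coord A \<sigma> c (axis 1 1) (axis 2 1) y)"
  \<comment> \<open>The values 1 and -1 have distance 2, so a ball of radius 1 contains only one of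
    them.\<close>
  let ?U = "?s -` ball (?s y) 1 \<inter> snd c ` fst c"
  have "open ?U"
    using continuous_on_open_vimage[OF chart_open(2)[OF c]] area_sign_continuous[OF c] by blast
  moreover have "?s z = ?s y" if "z \<in> ?U" for z
    using that area_coord_nonzero[OF c y] area_coord_nonzero[OF c, of z]
    by (auto simp: sgn_if dist_real_def split: if_splits)
  moreover have "y \<in> ?U" using y by simp
  ultimately show ?thesis by blast
qed

lemma chart_integrand_continuous:
  assumes c: "c \<in> A" and q: "smooth_fun A q"
    and \<eta>: "continuous_on (snd c ` fst c) (form2_coord A \<eta> c (axis 1 1) (axis 2 1))"
  shows "continuous_on (snd c ` fst c) (chart_integrand A \<sigma> q \<eta> c)"
proof -
  have "continuous_on (snd c ` fst c) (q \<circ> inv_chart c)"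
    using q c unfolding smooth_fun_def by (blast intro: smooth_on_continuous)
  then have "continuous_on (snd c ` fst c) (\<lambda>y. (q \<circ> inv_chart c) y *
      sgn (form2_coord A \<sigma> c (axis 1 1) (axis 2 1) y) * form2_coord A \<eta> c (axis 1 1) (axis 2 1) y)"
    by (intro continuous_on_mult area_sign_continuous[OF c] \<eta>)
  then show ?thesis by (simp add: chart_integrand_def[abs_def])
qed

lemma chart_image_compact:
  assumes c: "c \<in> A" and K: "closed K" "K \<subseteq> fst c"
  shows "compact (snd c ` K)"
proof (rule compact_continuous_image)
  show "continuous_on K (snd c)"
    by (rule continuous_on_subset[OF homeomorphism_cont1[OF chart_homeomorphism[OF c]] K(2)])
  show "compact K" using compact_Int_closed[OF compact_surface K(1)] by simp
qed

text \<open>The support may be cut out by the weight, by the form or by both, and \<open>W\<close>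
  may be a whole chart domain or an overlap of two; the later arguments call on all of
  these.\<close>

lemma chart_integrand_absolutely_integrable:
  assumes c: "c \<in> A" and q: "smooth_fun A q"
    and \<eta>: "continuous_on (snd c ` fst c) (form2_coord A \<eta> c (axis 1 1) (axis 2 1))"
    and K: "closed K" "K \<subseteq> W" "W \<subseteq> fst c"
    and zero: "\<And>x. x \<in> W \<Longrightarrow> x \<notin> K \<Longrightarrow> q x = 0 \<or> form2_coord A \<eta> c (axis 1 1) (axis 2 1) (snd c x) = 0"
  shows "chart_integrand A \<sigma> q \<eta> c absolutely_integrable_on (snd c ` W)"
proof (rule absolutely_integrable_compact_support)
  show "compact (snd c ` K)" by (rule chart_image_compact[OF c K(1)]) (use K in blast)
  show "continuous_on (snd c ` K) (chart_integrand A \<sigma> q \<eta> c)"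
    by (rule continuous_on_subset[OF chart_integrand_continuous[OF c q \<eta>]]) (use K in blast)
  show "snd c ` K \<subseteq> snd c ` W" using K by blast
  fix y assume y: "y \<in> snd c ` W" "y \<notin> snd c ` K"
  then obtain x where x: "x \<in> W" "y = snd c x" by auto
  then have "x \<notin> K" "x \<in> fst c" using y K by auto
  then show "chart_integrand A \<sigma> q \<eta> c y = 0"
    using zero[OF x(1)] c x(2) by (auto simp: chart_integrand_def)
qed

text \<open>The coefficient of \<open>\<eta>\<close> changes by the Jacobian determinant, the change
  of variables asks for its absolute value, and the coefficient of \<open>\<sigma>\<close> under
  \<open>sgn\<close> supplies the missing sign. Both integrands vanish off the overlap, so the
  integrals over the full chart images agree too.\<close>

lemma integral_change_chart:
  assumes \<eta>: "alternating_form2 A \<eta>" and cd: "c \<in> A" "d \<in> A"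
    and int: "chart_integrand A \<sigma> q \<eta> d absolutely_integrable_on (snd d ` (fst c \<inter> fst d))"
    and zc: "\<And>x. x \<in> fst c \<Longrightarrow> x \<notin> fst d \<Longrightarrow> chart_integrand A \<sigma> q \<eta> c (snd c x) = 0"
    and zd: "\<And>x. x \<in> fst d \<Longrightarrow> x \<notin> fst c \<Longrightarrow> chart_integrand A \<sigma> q \<eta> d (snd d x) = 0"
  shows "integral (snd c ` fst c) (chart_integrand A \<sigma> q \<eta> c) = integral (snd d ` fst d) (chart_integrand A \<sigma> q \<eta> d)"
proof -
  let ?W = "fst c \<inter> fst d"
  let ?S = "snd c ` ?W"
  let ?g = "transition c d"
  let ?J = "\<lambda>y. frechet_derivative ?g (at y)"
  \<comment> \<open>the library states the change of variables only for functions with values in \<open>real^'n\<close>\<close>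
  let ?f = "\<lambda>y. vec (chart_integrand A \<sigma> q \<eta> d y) :: real^1"
  have img: "?g ` ?S = snd d ` ?W"
    using cd by (auto simp: image_image intro!: image_cong)
  have oS: "open ?S" by (rule chart_image_open[OF cd(1) chart_open(1)[OF cd(2)]])
  have "integral (?g ` ?S) ?f = integral ?S (\<lambda>y. \<bar>det (matrix (?J y))\<bar> *\<^sub>R ?f (?g y))"
  proof (rule integral_change_of_variables)
    show "?S \<in> sets lebesgue" using oS by (simp add: borel_open)
    show "(?g has_derivative ?J y) (at y within ?S)" if "y \<in> ?S" for y
      using smooth_on_has_derivative[OF transition_smooth[OF cd] that] by (rule has_derivative_at_withinI)
    show "inj_on ?g ?S"
    proof (rule inj_onI)
      fix y z assume "y \<in> ?S" "z \<in> ?S" "?g y = ?g z"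
      then obtain a b where "a \<in> ?W" "b \<in> ?W" "y = snd c a" "z = snd c b" "snd d a = snd d b"
        using cd by auto
      then show "y = z" using inv_chart_chart[OF cd(2)] by (metis IntD2)
    qed
    show "?f absolutely_integrable_on ?g ` ?S \<or> (\<lambda>y. \<bar>det (matrix (?J y))\<bar> *\<^sub>R ?f (?g y)) absolutely_integrable_on ?S"
      using int unfolding img by (simp add: absolutely_integrable_on_1_iff)
  qed
  then have "integral (snd d ` ?W) (chart_integrand A \<sigma> q \<eta> d) =
      integral ?S (\<lambda>y. \<bar>det (matrix (?J y))\<bar> * chart_integrand A \<sigma> q \<eta> d (?g y))"
    unfolding img by (simp add: integral_on_1_eq)
  also have "\<dots> = integral ?S (chart_integrand A \<sigma> q \<eta> c)"
  proof (rule integral_cong)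
    fix y assume "y \<in> ?S"
    then obtain x where x: "x \<in> fst c" "x \<in> fst d" "y = snd c x" by auto
    show "\<bar>det (matrix (?J y))\<bar> * chart_integrand A \<sigma> q \<eta> d (?g y) = chart_integrand A \<sigma> q \<eta> c y"
      using cd x unfolding x(3) chart_integrand_def form2_coord_change[OF \<eta> cd x(1,2)]
        form2_coord_change[OF area_alternating cd x(1,2)]
      by (simp add: sgn_mult abs_sgn)
  qed
  also have "integral ?S (chart_integrand A \<sigma> q \<eta> c) = integral (snd c ` fst c) (chart_integrand A \<sigma> q \<eta> c)"
    by (rule integral_vanishing_outside[symmetric]) (use zc in auto)
  also have "integral (snd d ` ?W) (chart_integrand A \<sigma> q \<eta> d) = integral (snd d ` fst d) (chart_integrand A \<sigma> q \<eta> d)"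
    by (rule integral_vanishing_outside[symmetric]) (use zd in auto)
  finally show ?thesis by simp
qed

text \<open>The order of the quantifiers matters: the choice in \<open>surface_integral\<close> does
  not involve the form, so one partition serves all forms at once.\<close>

lemma surface_integral_partition:
  "\<exists>I \<rho>. partition_of_unity A I \<rho> \<and>
    (\<forall>\<eta>. surface_integral A \<sigma> \<eta> = (\<Sum>c\<in>I. integral (snd c ` fst c) (chart_integrand A \<sigma> (\<rho> c) \<eta> c)))"
proof -
  obtain I0 \<rho>0 where "partition_of_unity A I0 \<rho>0"
    using partition_of_unity_exists[OF smooth_atlas compact_surface] by blast
  then have ex: "\<exists>p. case p of (I, \<rho>) \<Rightarrow> partition_of_unity A I \<rho>" by auto
  obtain I \<rho> where p: "(SOME p. case p of (I, \<rho>) \<Rightarrow> partition_of_unity A I \<rho>) = (I, \<rho>)" by fastforce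
  have "partition_of_unity A I \<rho>" using someI_ex[OF ex] unfolding p by simp
  moreover have "surface_integral A \<sigma> \<eta> = (\<Sum>c\<in>I. integral (snd c ` fst c) (chart_integrand A \<sigma> (\<rho> c) \<eta> c))" for \<eta>
    unfolding surface_integral_def p Let_def by (simp add: chart_integrand_def[abs_def])
  ultimately show ?thesis by blast
qed

text \<open>Equality is asked only on \<open>tangent_space\<close>, since forms are unconstrained
  elsewhere and the integrand sees chart vectors alone. Continuity makes each weighted summand
  integrable, so that sum and integral may be interchanged.\<close>

lemma surface_integral_linear:
  assumes J: "finite J"
    and cont: "\<And>j c. j \<in> J \<Longrightarrow> c \<in> A \<Longrightarrow> continuous_on (snd c ` fst c) (form2_coord A (\<eta>' j) c (axis 1 1) (axis 2 1))"
    and eq: "\<And>x \<xi> \<zeta>. \<xi> \<in> tangent_space A x \<Longrightarrow> \<zeta> \<in> tangent_space A x \<Longrightarrow> \<eta> x \<xi> \<zeta> = (\<Sum>j\<in>J. a j * \<eta>' j x \<xi> \<zeta>)"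
  shows "surface_integral A \<sigma> \<eta> = (\<Sum>j\<in>J. a j * surface_integral A \<sigma> (\<eta>' j))"
proof -
  obtain I \<rho> where part: "partition_of_unity A I \<rho>"
    and si: "\<And>\<eta>. surface_integral A \<sigma> \<eta> = (\<Sum>c\<in>I. integral (snd c ` fst c) (chart_integrand A \<sigma> (\<rho> c) \<eta> c))"
    using surface_integral_partition by blast
  have chart: "integral (snd c ` fst c) (chart_integrand A \<sigma> (\<rho> c) \<eta> c) =
      (\<Sum>j\<in>J. a j * integral (snd c ` fst c) (chart_integrand A \<sigma> (\<rho> c) (\<eta>' j) c))" if "c \<in> I" for c
  proof -
    have c: "c \<in> A" and \<rho>: "smooth_fun A (\<rho> c)" "closure {x. \<rho> c x \<noteq> 0} \<subseteq> fst c"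
      using part that unfolding partition_of_unity_def by auto
    have int: "chart_integrand A \<sigma> (\<rho> c) (\<eta>' j) c integrable_on (snd c ` fst c)" if "j \<in> J" for j
      by (rule set_lebesgue_integral_eq_integral(1),
          rule chart_integrand_absolutely_integrable[OF c \<rho>(1) cont[OF that c] closed_closure \<rho>(2) order_refl])
        (use closure_subset[of "{x. \<rho> c x \<noteq> 0}"] in blast)
    have "integral (snd c ` fst c) (chart_integrand A \<sigma> (\<rho> c) \<eta> c) =
        integral (snd c ` fst c) (\<lambda>y. \<Sum>j\<in>J. a j * chart_integrand A \<sigma> (\<rho> c) (\<eta>' j) c y)"
    proof (rule integral_cong)
      fix y assume "y \<in> snd c ` fst c"
      then obtain x where x: "x \<in> fst c" "y = snd c x" by auto
      show "chart_integrand A \<sigma> (\<rho> c) \<eta> c y = (\<Sum>j\<in>J. a j * chart_integrand A \<sigma> (\<rho> c) (\<eta>' j) c y)"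
        unfolding chart_integrand_def x(2) form2_coord_chart[OF c x(1)]
          eq[OF chart_vector_in_tangent_space[OF c x(1)] chart_vector_in_tangent_space[OF c x(1)]]
        by (simp add: sum_distrib_left algebra_simps)
    qed
    also have "\<dots> = (\<Sum>j\<in>J. integral (snd c ` fst c) (\<lambda>y. a j * chart_integrand A \<sigma> (\<rho> c) (\<eta>' j) c y))"
      by (rule Henstock_Kurzweil_Integration.integral_sum[OF J]) (intro integrable_on_mult_right int)
    finally show ?thesis by simp
  qed
  have "surface_integral A \<sigma> \<eta> = (\<Sum>c\<in>I. \<Sum>j\<in>J. a j * integral (snd c ` fst c) (chart_integrand A \<sigma> (\<rho> c) (\<eta>' j) c))"
    unfolding si by (rule sum.cong[OF refl chart])
  also have "\<dots> = (\<Sum>j\<in>J. a j * surface_integral A \<sigma> (\<eta>' j))"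
    unfolding si sum_distrib_left by (rule sum.swap)
  finally show ?thesis .
qed

section \<open>Stokes' theorem for the product of an exact and a closed 1-form\<close>

lemma chart_stokes:
  assumes d: "d \<in> A" and k: "smooth_fun A k" and supp: "closure {x. k x \<noteq> 0} \<subseteq> fst d" and \<beta>: "closed_form1 A \<beta>"
  shows "integral (snd d ` fst d) (chart_integrand A \<sigma> (\<lambda>_. 1) (wedge_form1 (fun_differential A k) \<beta>) d) = 0"
proof -
  let ?U = "snd d ` fst d" and ?K = "snd d ` closure {x. k x \<noteq> 0}"
  let ?e1 = "axis 1 1 :: real^2" and ?e2 = "axis 2 1 :: real^2"
  define s where "s y = sgn (form2_coord A \<sigma> d ?e1 ?e2 y)" for y
  define kd where "kd = k \<circ> inv_chart d"
  define b where "b v y = form1_coord A \<beta> d v y" for v y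
  \<comment> \<open>The component of k\<beta> in direction \<open>w\<close> with the orientation
    sign, extended by 0. As k vanishes near the edge of the chart image, the extension is
    differentiable on the whole plane.\<close>
  define \<phi> where "\<phi> w y = (if y \<in> ?U then s y * (kd y * b w y) else 0)" for w y
  \<comment> \<open>The sign is treated as a constant factor here, which is correct because it is
    constant near each point of the chart image.\<close>
  define \<phi>' where "\<phi>' w y v = (if y \<in> ?U then s y * (kd y * frechet_derivative (b w) (at y) v
      + frechet_derivative kd (at y) v * b w y) else 0)" for w y v
  have oU: "open ?U" by (rule chart_open(2)[OF d])
  have cK: "compact ?K" by (rule chart_image_compact[OF d closed_closure supp])
  have KU: "?K \<subseteq> ?U" by (rule image_mono[OF supp])
  have oK: "open (- ?K)" using compact_imp_closed[OF cK] by auto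
  have skd: "smooth_on ?U kd" using k d unfolding smooth_fun_def kd_def by blast
  have sb: "smooth_on ?U (b w)" for w
    using \<beta> d unfolding closed_form1_def b_def by blast
  have kd0: "kd y = 0" if y: "y \<in> ?U" "y \<notin> ?K" for y
  proof -
    obtain x where x: "x \<in> fst d" "y = snd d x" using y(1) by blast
    then have "x \<notin> closure {x. k x \<noteq> 0}" using y(2) by auto
    then have "k x = 0" using closure_subset[of "{x. k x \<noteq> 0}"] by blast
    then show ?thesis using x d by (simp add: kd_def)
  qed
  have dkd0: "frechet_derivative kd (at y) v = 0" if "y \<in> ?U" "y \<notin> ?K" for y v
  proof -
    have "frechet_derivative kd (at y) = frechet_derivative (\<lambda>_. 0) (at y)"
      by (rule frechet_derivative_cong_open[of "?U \<inter> - ?K"]) (use oU oK that kd0 in auto)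
    then show ?thesis by simp
  qed
  have der: "(\<phi> w has_derivative \<phi>' w y) (at y)" for w y
  proof (cases "y \<in> ?U")
    case True
    obtain N where N: "open N" "y \<in> N" "N \<subseteq> ?U" "\<And>z. z \<in> N \<Longrightarrow> s z = s y"
      using area_sign_locally_constant[OF d True] unfolding s_def by blast
    have "((\<lambda>z. s y * (kd z * b w z)) has_derivative (\<lambda>v. s y * (kd y * frechet_derivative (b w) (at y) v
        + frechet_derivative kd (at y) v * b w y))) (at y)"
      by (intro has_derivative_mult_right has_derivative_mult smooth_on_has_derivative[OF skd True]
          smooth_on_has_derivative[OF sb True])
    then have "(\<phi> w has_derivative (\<lambda>v. s y * (kd y * frechet_derivative (b w) (at y) v
        + frechet_derivative kd (at y) v * b w y))) (at y)"
    proof (rule has_derivative_transform_within_open[OF _ N(1,2)])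
      fix z assume z: "z \<in> N"
      then have "z \<in> ?U" using N(3) by blast
      then show "s y * (kd z * b w z) = \<phi> w z" using N(4)[OF z] by (simp only: \<phi>_def if_True)
    qed
    moreover have "\<phi>' w y = (\<lambda>v. s y * (kd y * frechet_derivative (b w) (at y) v
        + frechet_derivative kd (at y) v * b w y))" using True by (simp add: \<phi>'_def fun_eq_iff)
    ultimately show ?thesis by simp
  next
    case False
    then have "y \<in> - ?K" using KU by blast
    then have "(\<phi> w has_derivative (\<lambda>_. 0)) (at y)"
      by (rule has_derivative_transform_within_open[OF has_derivative_const oK]) (use kd0 in \<open>auto simp: \<phi>_def\<close>)
    moreover have "\<phi>' w y = (\<lambda>_. 0)" using False by (simp add: \<phi>'_def fun_eq_iff)
    ultimately show ?thesis by simp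
  qed
  have cont: "continuous_on UNIV (\<lambda>y. \<phi>' w y v)" for w v
  proof -
    have "continuous_on ?U (\<lambda>y. s y * (kd y * frechet_derivative (b w) (at y) v
      + frechet_derivative kd (at y) v * b w y))"
      unfolding s_def
      by (intro continuous_on_mult continuous_on_add area_sign_continuous[OF d] smooth_on_continuous skd sb smooth_on_deriv)
    then have "continuous_on ?U (\<lambda>y. \<phi>' w y v)"
      by (rule continuous_on_eq) (simp add: \<phi>'_def)
    moreover have "continuous_on (- ?K) (\<lambda>y. \<phi>' w y v)"
      by (rule continuous_on_eq[OF continuous_on_const[of _ 0]]) (use kd0 dkd0 in \<open>auto simp: \<phi>'_def\<close>)
    ultimately have "continuous_on (?U \<union> - ?K) (\<lambda>y. \<phi>' w y v)"
      by (rule continuous_on_open_Un[OF oU oK])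
    moreover have "?U \<union> - ?K = UNIV" using KU by blast
    ultimately show ?thesis by simp
  qed
  have int0: "((\<lambda>y. \<phi>' w y v) has_integral 0) UNIV" for w v
    by (rule has_integral_derivative_compact_support[OF der cont compact_imp_bounded[OF cK]])
       (use kd0 dkd0 in \<open>auto simp: \<phi>_def \<phi>'_def\<close>)
  have "((\<lambda>y. \<phi>' ?e2 y ?e1 - \<phi>' ?e1 y ?e2) has_integral 0) UNIV"
    using has_integral_diff[OF int0 int0] by simp
  moreover have "\<phi>' ?e2 y ?e1 - \<phi>' ?e1 y ?e2 =
      (if y \<in> ?U then chart_integrand A \<sigma> (\<lambda>_. 1) (wedge_form1 (fun_differential A k) \<beta>) d y else 0)" for y
  proof (cases "y \<in> ?U")
    case True
    \<comment> \<open>Closedness of \<beta> cancels the terms in which k is not differentiated; the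
      rest is the coefficient of dk \<and> \<beta>.\<close>
    have "frechet_derivative (b ?e2) (at y) ?e1 = frechet_derivative (b ?e1) (at y) ?e2"
      using \<beta> d True unfolding closed_form1_def b_def by blast
    then show ?thesis
      using True fun_differential_coord[OF k d True]
      by (simp add: \<phi>'_def chart_integrand_def form2_coord_wedge s_def[symmetric] b_def[symmetric] kd_def[symmetric] algebra_simps)
  qed (simp add: \<phi>'_def)
  ultimately have "((\<lambda>y. if y \<in> ?U then chart_integrand A \<sigma> (\<lambda>_. 1) (wedge_form1 (fun_differential A k) \<beta>) d y else 0)
      has_integral 0) UNIV" by simp
  then have "(chart_integrand A \<sigma> (\<lambda>_. 1) (wedge_form1 (fun_differential A k) \<beta>) d has_integral 0) ?U"
    by (simp only: has_integral_restrict_UNIV)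
  then show ?thesis by (rule integral_unique)
qed

text \<open>The chart \<open>d\<close> need not occur in the partition behind
  \<open>surface_integral\<close>. Every weighted piece is carried over to \<open>d\<close>, where
  the weights sum to 1 and leave the one integral of \<open>chart_stokes\<close>.\<close>

lemma stokes_supported_in_chart:
  assumes d: "d \<in> A" and k: "smooth_fun A k" and supp: "closure {x. k x \<noteq> 0} \<subseteq> fst d" and \<beta>: "closed_form1 A \<beta>"
  shows "surface_integral A \<sigma> (wedge_form1 (fun_differential A k) \<beta>) = 0"
proof -
  let ?\<eta> = "wedge_form1 (fun_differential A k) \<beta>"
  let ?K = "closure {x. k x \<noteq> 0}"
  obtain I \<rho> where part: "partition_of_unity A I \<rho>"
    and si: "\<And>\<eta>. surface_integral A \<sigma> \<eta> = (\<Sum>c\<in>I. integral (snd c ` fst c) (chart_integrand A \<sigma> (\<rho> c) \<eta> c))"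
    using surface_integral_partition by blast
  have I: "finite I" "I \<subseteq> A" and one: "\<And>x. (\<Sum>c\<in>I. \<rho> c x) = 1"
    and \<rho>: "\<And>c. c \<in> I \<Longrightarrow> smooth_fun A (\<rho> c)" "\<And>c. c \<in> I \<Longrightarrow> closure {x. \<rho> c x \<noteq> 0} \<subseteq> fst c"
    using part unfolding partition_of_unity_def by auto
  have alt: "alternating_form2 A ?\<eta>"
    using \<beta> fun_differential_linear[OF k] unfolding closed_form1_def by (intro wedge_alternating) blast+
  have cont: "continuous_on (snd c ` fst c) (form2_coord A ?\<eta> c v w)" if "c \<in> A" for c v w
    by (rule smooth_on_continuous[OF wedge_coord_smooth[OF k \<beta> that]])
  have zero: "form2_coord A ?\<eta> c v w (snd c x) = 0" if "c \<in> A" "x \<in> fst c" "x \<notin> ?K" for c v w x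
    using fun_differential_coord_zero[OF k that] by (simp add: form2_coord_wedge)
  have \<rho>0: "\<rho> c x = 0" if "x \<notin> closure {x. \<rho> c x \<noteq> 0}" for c x
    using that closure_subset[of "{x. \<rho> c x \<noteq> 0}"] by blast
  have move: "integral (snd c ` fst c) (chart_integrand A \<sigma> (\<rho> c) ?\<eta> c) =
      integral (snd d ` fst d) (chart_integrand A \<sigma> (\<rho> c) ?\<eta> d)" if c: "c \<in> I" for c
  proof -
    have cA: "c \<in> A" using c I by blast
    show ?thesis
    proof (rule integral_change_chart[OF alt cA d])
      \<comment> \<open>On the overlap neither support is compact by itself: the weight confines the
        integrand to \<open>fst c\<close>, the form confines it to \<open>fst d\<close>, and only
        the intersection of both lies inside the overlap.\<close>
      show "chart_integrand A \<sigma> (\<rho> c) ?\<eta> d absolutely_integrable_on (snd d ` (fst c \<inter> fst d))"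
      proof (rule chart_integrand_absolutely_integrable[OF d \<rho>(1)[OF c] cont[OF d]])
        show "closed (closure {x. \<rho> c x \<noteq> 0} \<inter> ?K)" by blast
        show "closure {x. \<rho> c x \<noteq> 0} \<inter> ?K \<subseteq> fst c \<inter> fst d" using \<rho>(2)[OF c] supp by blast
        show "\<rho> c x = 0 \<or> form2_coord A ?\<eta> d (axis 1 1) (axis 2 1) (snd d x) = 0"
          if "x \<in> fst c \<inter> fst d" "x \<notin> closure {x. \<rho> c x \<noteq> 0} \<inter> ?K" for x
          using that \<rho>0 zero[OF d] by blast
      qed blast
      show "chart_integrand A \<sigma> (\<rho> c) ?\<eta> c (snd c x) = 0" if "x \<in> fst c" "x \<notin> fst d" for x
        using that supp zero[OF cA] by (auto simp: chart_integrand_def)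
      show "chart_integrand A \<sigma> (\<rho> c) ?\<eta> d (snd d x) = 0" if "x \<in> fst d" "x \<notin> fst c" for x
        using that \<rho>(2)[OF c] \<rho>0[of x c] d by (auto simp: chart_integrand_def)
    qed
  qed
  have int: "chart_integrand A \<sigma> (\<rho> c) ?\<eta> d integrable_on (snd d ` fst d)" if c: "c \<in> I" for c
    by (rule set_lebesgue_integral_eq_integral(1),
        rule chart_integrand_absolutely_integrable[OF d \<rho>(1)[OF c] cont[OF d] closed_closure supp order_refl])
      (use zero[OF d] in blast)
  have "surface_integral A \<sigma> ?\<eta> = (\<Sum>c\<in>I. integral (snd d ` fst d) (chart_integrand A \<sigma> (\<rho> c) ?\<eta> d))"
    unfolding si by (rule sum.cong[OF refl move])
  also have "\<dots> = integral (snd d ` fst d) (\<lambda>y. \<Sum>c\<in>I. chart_integrand A \<sigma> (\<rho> c) ?\<eta> d y)"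
    by (rule Henstock_Kurzweil_Integration.integral_sum[OF I(1) int, symmetric])
  also have "(\<lambda>y. \<Sum>c\<in>I. chart_integrand A \<sigma> (\<rho> c) ?\<eta> d y) = chart_integrand A \<sigma> (\<lambda>_. 1) ?\<eta> d"
    by (simp add: chart_integrand_def fun_eq_iff sum_distrib_right[symmetric] one)
  also have "integral (snd d ` fst d) \<dots> = 0" by (rule chart_stokes[OF d k supp \<beta>])
  finally show ?thesis .
qed

lemma stokes:
  assumes h: "smooth_fun A h" and \<beta>: "closed_form1 A \<beta>"
  shows "surface_integral A \<sigma> (wedge_form1 (fun_differential A h) \<beta>) = 0"
proof -
  obtain I \<rho> where part: "partition_of_unity A I \<rho>"
    using partition_of_unity_exists[OF smooth_atlas compact_surface] by blast
  then have I: "finite I" "I \<subseteq> A" and one: "\<And>x. (\<Sum>c\<in>I. \<rho> c x) = 1"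
    and \<rho>: "\<And>c. c \<in> I \<Longrightarrow> smooth_fun A (\<rho> c)" "\<And>c. c \<in> I \<Longrightarrow> closure {x. \<rho> c x \<noteq> 0} \<subseteq> fst c"
    unfolding partition_of_unity_def by auto
  \<comment> \<open>This partition serves only to cut up \<open>h\<close>; it need not agree with
    the one behind \<open>surface_integral\<close>.\<close>
  define k where "k c x = \<rho> c x * h x" for c x
  have k: "smooth_fun A (k c)" if "c \<in> I" for c
    unfolding k_def by (rule smooth_fun_mult[OF \<rho>(1)[OF that] h])
  have "closure {x. k c x \<noteq> 0} \<subseteq> closure {x. \<rho> c x \<noteq> 0}" for c
    by (rule closure_mono) (auto simp: k_def)
  then have 0: "surface_integral A \<sigma> (wedge_form1 (fun_differential A (k c)) \<beta>) = 0" if "c \<in> I" for c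
    using stokes_supported_in_chart[OF _ k[OF that] _ \<beta>, of c] \<rho>(2)[OF that] that I by blast
  have dh: "fun_differential A h x \<xi> = (\<Sum>c\<in>I. fun_differential A (k c) x \<xi>)" for x \<xi>
  proof -
    let ?c = "chart_at A x"
    have y: "snd ?c x \<in> snd ?c ` fst ?c" using chart_at by blast
    have "((\<lambda>y. \<Sum>c\<in>I. (k c \<circ> inv_chart ?c) y) has_derivative
        (\<lambda>v. \<Sum>c\<in>I. frechet_derivative (k c \<circ> inv_chart ?c) (at (snd ?c x)) v)) (at (snd ?c x))"
    proof (rule has_derivative_sum)
      fix c assume "c \<in> I"
      then have "smooth_on (snd ?c ` fst ?c) (k c \<circ> inv_chart ?c)"
        using k chart_at unfolding smooth_fun_def by blast
      then show "((k c \<circ> inv_chart ?c) has_derivative frechet_derivative (k c \<circ> inv_chart ?c) (at (snd ?c x))) (at (snd ?c x))"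
        by (rule smooth_on_has_derivative[OF _ y])
    qed
    moreover have "(\<lambda>y. \<Sum>c\<in>I. (k c \<circ> inv_chart ?c) y) = h \<circ> inv_chart ?c"
      by (simp add: k_def fun_eq_iff sum_distrib_right[symmetric] one)
    ultimately show ?thesis
      by (simp add: fun_differential_def Let_def frechet_derivative_eqI)
  qed
  have "surface_integral A \<sigma> (wedge_form1 (fun_differential A h) \<beta>) =
      (\<Sum>c\<in>I. 1 * surface_integral A \<sigma> (wedge_form1 (fun_differential A (k c)) \<beta>))"
  proof (rule surface_integral_linear[OF I(1)])
    fix c e assume "c \<in> I" "e \<in> A"
    then show "continuous_on (snd e ` fst e) (form2_coord A (wedge_form1 (fun_differential A (k c)) \<beta>) e (axis 1 1) (axis 2 1))"
      using wedge_coord_smooth[OF k \<beta>] smooth_on_continuous by blast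
  next
    fix x and \<xi> \<zeta> :: "('s, real^2) tangent"
    show "wedge_form1 (fun_differential A h) \<beta> x \<xi> \<zeta> = (\<Sum>c\<in>I. 1 * wedge_form1 (fun_differential A (k c)) \<beta> x \<xi> \<zeta>)"
      by (simp add: wedge_form1_def dh sum_distrib_right sum_subtractf)
  qed
  then show ?thesis using 0 by simp
qed

end

section \<open>Comparison of the two 2-forms in exact directions\<close>

theorem lemma3p2:
  fixes A :: "('s::{t2_space, second_countable_topology}, real^2) atlas"
    and \<sigma> :: "('s, real^2) form2"
    and B :: "('m::{t2_space, second_countable_topology}, 'e::euclidean_space) atlas"
    and \<omega> :: "('m, 'e) form2"
    and f :: "'s \<Rightarrow> 'm"
    and u :: "'s \<Rightarrow> ('m, 'e) tangent"
  assumes "symplectic_manifold B \<omega>" and "compact (UNIV :: 'm set)"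
    and "symplectic_manifold A \<sigma>" and "compact (UNIV :: 's set)" and "connected (UNIV :: 's set)"
    and "f \<in> symplectic_embeddings A \<sigma> B \<omega>"
    and "u \<in> tangent_symplectic_embeddings A \<sigma> B \<omega> f"
    and "exact_form1 A (\<lambda>x \<xi>. \<omega> (f x) (u x) (tangent_map A B f x \<xi>))"
  shows "\<forall>v \<in> tangent_symplectic_embeddings A \<sigma> B \<omega> f.
    omega_maps A \<sigma> B \<omega> f u v
      = 2 * surface_integral A \<sigma> (\<lambda>x \<xi>1 \<xi>2. \<omega> (f x) (u x) (v x) * \<sigma> x \<xi>1 \<xi>2) \<and>
    2 * surface_integral A \<sigma> (\<lambda>x \<xi>1 \<xi>2. \<omega> (f x) (u x) (v x) * \<sigma> x \<xi>1 \<xi>2)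
      = 2 * omega_D A \<sigma> \<omega> f u v"
proof (intro ballI conjI)
  fix v assume v: "v \<in> tangent_symplectic_embeddings A \<sigma> B \<omega> f"
  show "2 * surface_integral A \<sigma> (\<lambda>x \<xi>1 \<xi>2. \<omega> (f x) (u x) (v x) * \<sigma> x \<xi>1 \<xi>2) = 2 * omega_D A \<sigma> \<omega> f u v"
    by (simp add: omega_D_def)
  have A: "smooth_atlas A" and \<sigma>: "smooth_form2 A \<sigma>" "nondegenerate_form2 A \<sigma>"
    using assms(3) unfolding symplectic_manifold_def by auto
  have B: "smooth_atlas B" and \<omega>: "smooth_form2 B \<omega>" "closed_form2 B \<omega>"
    using assms(1) unfolding symplectic_manifold_def by auto
  interpret S: oriented_closed_surface A \<sigma>
    by unfold_locales (fact A, fact assms(4), fact \<sigma>(1), fact \<sigma>(2))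
  have curve: "curve_of_maps A B F" if "smooth_map (cylinder_atlas A) B (case_prod F)"
    "\<And>t. F t \<in> symplectic_embeddings A \<sigma> B \<omega>" for F
  proof unfold_locales
    show "smooth_map A B (F t)" for t
      using that(2) unfolding symplectic_embeddings_def smooth_embedding_def by blast
  qed (use A B that(1) in auto)
  obtain F where F: "smooth_map (cylinder_atlas A) B (case_prod F)"
    "\<And>t. F t \<in> symplectic_embeddings A \<sigma> B \<omega>" "F 0 = f" "u = (\<lambda>x. velocity B (\<lambda>t. F t x))"
    using assms(7) unfolding tangent_symplectic_embeddings_def by blast
  obtain G where G: "smooth_map (cylinder_atlas A) B (case_prod G)"
    "\<And>t. G t \<in> symplectic_embeddings A \<sigma> B \<omega>" "G 0 = f" "v = (\<lambda>x. velocity B (\<lambda>t. G t x))"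
    using v unfolding tangent_symplectic_embeddings_def by blast
  interpret F: curve_of_maps A B F by (rule curve[OF F(1,2)])
  interpret G: curve_of_maps A B G by (rule curve[OF G(1,2)])
  have pull: "\<omega> (g x) (tangent_map A B g x \<xi>) (tangent_map A B g x \<zeta>) = \<sigma> x \<xi> \<zeta>"
    if "g \<in> symplectic_embeddings A \<sigma> B \<omega>" "\<xi> \<in> tangent_space A x" "\<zeta> \<in> tangent_space A x" for g x \<xi> \<zeta>
    using that unfolding symplectic_embeddings_def by blast
  define \<beta> where "\<beta> = (\<lambda>x \<xi>. \<omega> (f x) (v x) (tangent_map A B f x \<xi>))"
  \<comment> \<open>Uses the curve \<open>G\<close> that represents \<open>v\<close>: all its
    members pull \<omega> back to \<sigma>.\<close>
  have \<beta>: "closed_form1 A \<beta>"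
    using G.velocity_form_closed[OF \<omega> pull[OF G(2)]] unfolding \<beta>_def G(3,4) .
  obtain h where h: "smooth_fun A h"
    "\<And>x \<xi>. \<xi> \<in> tangent_space A x \<Longrightarrow> \<omega> (f x) (u x) (tangent_map A B f x \<xi>) = fun_differential A h x \<xi>"
    using assms(8) unfolding exact_form1_def by blast
  define q where "q x = \<omega> (f x) (u x) (v x)" for x
  have q: "smooth_fun A q"
    using velocity_pairing_smooth[OF F.curve_of_maps_axioms G.curve_of_maps_axioms _ \<omega>(1)]
    unfolding q_def F(3,4) G(3,4) by simp
  let ?\<eta>D = "\<lambda>x \<xi>1 \<xi>2. \<omega> (f x) (u x) (v x) * \<sigma> x \<xi>1 \<xi>2"
  let ?\<eta>S = "wedge_form1 (fun_differential A h) \<beta>"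
  \<comment> \<open>The two summands as a family over \<open>{0, 1}\<close>, to be combined with
    coefficients 2 and -2 by \<open>surface_integral_linear\<close>; Stokes' theorem then removes
    the second.\<close>
  let ?\<eta> = "\<lambda>i::nat. if i = 0 then ?\<eta>D else ?\<eta>S"
  have alt: "alternating_form2 B \<omega>" by (rule smooth_form2_alternating[OF \<omega>(1)])
  have wedge: "ev_pullback_wedge A B \<omega> f x (nth [(u, \<lambda>_. 0), (v, \<lambda>_. 0), (\<lambda>_ _. 0, \<xi>1), (\<lambda>_ _. 0, \<xi>2)]) =
      2 * ?\<eta>D x \<xi>1 \<xi>2 + - 2 * ?\<eta>S x \<xi>1 \<xi>2"
    if \<xi>: "\<xi>1 \<in> tangent_space A x" "\<xi>2 \<in> tangent_space A x" for x \<xi>1 \<xi>2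
  proof -
    let ?l = "nth [(u, \<lambda>_. 0), (v, \<lambda>_. 0), (\<lambda>_ _. 0, \<xi>1), (\<lambda>_ _. 0, \<xi>2)]"
    let ?d = "\<lambda>i. ev_differential A B f x (?l i)"
    let ?t = "tangent_map A B f x"
    \<comment> \<open>The lifts of \<open>u\<close> and \<open>v\<close> have zero component along
      the surface, so the differential of the evaluation map sends them to \<open>u x\<close> and
      \<open>v x\<close> once df(0) = 0 is known.\<close>
    have "?t (\<lambda>_. 0) = (\<lambda>_. 0)" using F.tangent_map_zero[of 0 x] F(3) by simp
    then have d: "?d 0 = u x" "?d 1 = v x" "?d 2 = ?t \<xi>1" "?d 3 = ?t \<xi>2"
      by (simp_all add: ev_differential_def numeral_eq_Suc)
    have T: "u x \<in> tangent_space B (f x)" "v x \<in> tangent_space B (f x)"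
      "?t \<xi>1 \<in> tangent_space B (f x)" "?t \<xi>2 \<in> tangent_space B (f x)"
      using F.velocity_in_tangent_space[of x] G.velocity_in_tangent_space[of x]
        F.tangent_map_in_tangent_space[OF \<xi>(1), of 0] F.tangent_map_in_tangent_space[OF \<xi>(2), of 0]
      by (simp_all add: F(3,4) G(3,4))
    have "?d i \<in> tangent_space B (f x)" if "i < 4" for i
    proof -
      have "i = 0 \<or> i = 1 \<or> i = 2 \<or> i = 3" using that by auto
      then show ?thesis using T d by metis
    qed
    \<comment> \<open>Of the three pairings, the one joining u with v yields \<omega>(u, v) \<sigma>
      by the pullback condition. The two mixed ones combine to - dh \<and> \<beta>.\<close>
    then have "ev_pullback_wedge A B \<omega> f x ?l = 2 * (\<omega> (f x) (?d 0) (?d 1) * \<omega> (f x) (?d 2) (?d 3)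
        - \<omega> (f x) (?d 0) (?d 2) * \<omega> (f x) (?d 1) (?d 3) + \<omega> (f x) (?d 0) (?d 3) * \<omega> (f x) (?d 1) (?d 2))"
      unfolding ev_pullback_wedge_def
      by (intro wedge2_square alternating_form2_skew[OF alt]) auto
    also have "\<dots> = 2 * (\<omega> (f x) (u x) (v x) * \<sigma> x \<xi>1 \<xi>2
        - fun_differential A h x \<xi>1 * \<beta> x \<xi>2 + fun_differential A h x \<xi>2 * \<beta> x \<xi>1)"
      unfolding d pull[OF assms(6) \<xi>] h(2)[OF \<xi>(1)] h(2)[OF \<xi>(2)] \<beta>_def ..
    finally show ?thesis by (simp add: wedge_form1_def algebra_simps)
  qed
  have "omega_maps A \<sigma> B \<omega> f u v =
      (\<Sum>i\<in>{0, 1}. (if i = 0 then 2 else - 2) * surface_integral A \<sigma> (?\<eta> i))"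
    unfolding omega_maps_def
  proof (rule S.surface_integral_linear)
    fix i :: nat and c assume c: "c \<in> A"
    have "continuous_on (snd c ` fst c) (\<lambda>y. (q \<circ> inv_chart c) y * form2_coord A \<sigma> c (axis 1 1) (axis 2 1) y)"
      using q \<sigma>(1) c unfolding smooth_fun_def smooth_form2_def
      by (intro continuous_on_mult smooth_on_continuous) blast+
    then have "continuous_on (snd c ` fst c) (form2_coord A ?\<eta>D c (axis 1 1) (axis 2 1))"
      by (simp add: form2_coord_def[abs_def] q_def Let_def)
    moreover have "continuous_on (snd c ` fst c) (form2_coord A ?\<eta>S c (axis 1 1) (axis 2 1))"
      by (rule smooth_on_continuous[OF S.wedge_coord_smooth[OF h(1) \<beta> c]])
    ultimately show "continuous_on (snd c ` fst c) (form2_coord A (?\<eta> i) c (axis 1 1) (axis 2 1))"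
      by simp
  qed (use wedge in simp_all)
  then show "omega_maps A \<sigma> B \<omega> f u v = 2 * surface_integral A \<sigma> ?\<eta>D"
    using S.stokes[OF h(1) \<beta>] by simp
qed

end
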